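(* Let $n\ge 1$, let $\mathbf{m}=(m_1,\dots,m_n)$ and $\mathbf{n}=(n_1,\dots,n_n)$ be in $\mathbb{N}_0^n$, and let $\psi(z)=z^{\mathbf{n}}\overline{z}^{\mathbf{m}}$. Then $H_\psi^*H_\psi$ on $A^2(\mathbb{D}^n)$ has the spectrum $$\sigma(H_\psi^*H_\psi)=\{0\}\cup\{\lambda_{\mathbf{n},\mathbf{m},\boldsymbol{\alpha},B}:\boldsymbol{\alpha}\in\mathbb{N}_0^n,\ \emptyset\ne B\subset B_n\}.$$ Furthermore, if $n_k+m_k\ge 1$ for all $k\in B_n$ and $m_k\ge 1$ for some $k\in B_n$, then all of the eigenvalues of $H_\psi^*H_\psi$ have finite multiplicities. On the other hand, if $n_k+m_k=0$ for some $k\in B_n$, then all of the eigenvalues of $H_\psi^*H_\psi$ have infinite multiplicities.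
   Context: $\mathbb{D}$ is the open unit disc in $\mathbb{C}$, $\mathbb{N}_0=\{0,1,2,\dots\}$, $B_n=\{1,2,\dots,n\}$; the inclusion $B\subset B_n$ allows $B=B_n$. Multi-index notation: $z^{\mathbf{n}}\overline{z}^{\mathbf{m}}=\prod_{k=1}^n z_k^{n_k}\overline{z}_k^{m_k}$. $A^2(\mathbb{D}^n)$ is the Bergman space of holomorphic functions on $\mathbb{D}^n$ that are square integrable with respect to Lebesgue measure, $P:L^2(\mathbb{D}^n)\to A^2(\mathbb{D}^n)$ is the orthogonal (Bergman) projection, and the Hankel operator $H_\psi:A^2(\mathbb{D}^n)\to L^2(\mathbb{D}^n)$ is $H_\psi f=(I-P)(\psi f)$, with Hilbert space adjoint $H_\psi^*$. $\sigma(T)$ denotes the spectrum of $T$. For $\mathbf{m},\mathbf{n},\boldsymbol{\alpha}\in\mathbb{N}_0^n$ and $\emptyset\ne B\subset B_n$, the number $\lambda_{\mathbf{n},\mathbf{m},\boldsymbol{\alpha},B}$ is defined by $$\lambda_{\mathbf{n},\mathbf{m},\boldsymbol{\alpha},B}=\prod_{k\in B}\frac{\alpha_k+1}{\alpha_k+n_k+m_k+1}\quad\text{if }\alpha_k<m_k-n_k\text{ for some }k\in B,$$ $$\lambda_{\mathbf{n},\mathbf{m},\boldsymbol{\alpha},B}=\prod_{k\in B}\frac{\alpha_k+1}{\alpha_k+n_k+m_k+1}-\prod_{k\in B}\frac{(\alpha_k+1)(\alpha_k+n_k-m_k+1)}{(\alpha_k+n_k+1)^2}\quad\text{if }\alpha_k\ge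 m_k-n_k\text{ for all }k\in B.$$ *)

theory Defs
  imports "HOL-Analysis.Analysis" "HOL-Library.Function_Algebras"
begin

definition polydisc :: "(complex ^ 'n) set" where
  "polydisc = {z. \<forall>k. cmod (z $ k) < 1}"

text \<open>Holomorphic in several variables: the (real) Frechet derivative exists at every point and is
  complex linear. This is used for open sets only.\<close>

definition holomorphic_vec_on :: "(complex ^ 'n \<Rightarrow> complex) \<Rightarrow> (complex ^ 'n) set \<Rightarrow> bool" where
  "holomorphic_vec_on f S \<longleftrightarrow>
     (\<forall>z\<in>S. \<exists>D. (f has_derivative D) (at z) \<and> (\<forall>c v. D (c *s v) = c * D v))"


text \<open>Elements of the set \<open>L2\<close> are representatives; two of them are the same vector of the
  Hilbert space iff they agree almost everywhere on the polydisc. The form \<open>l2_inner\<close> is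
  invariant under this relation, and is linear in its first argument.\<close>

abbreviation polydisc_measure :: "(complex ^ 'n) measure" where
  "polydisc_measure \<equiv> lebesgue_on polydisc"

definition L2 :: "(complex ^ 'n \<Rightarrow> complex) set" where
  "L2 = {f. f \<in> borel_measurable polydisc_measure \<and>
            integrable polydisc_measure (\<lambda>z. (cmod (f z))\<^sup>2)}"

definition l2_inner :: "(complex ^ 'n \<Rightarrow> complex) \<Rightarrow> (complex ^ 'n \<Rightarrow> complex) \<Rightarrow> complex" where
  "l2_inner f g = (LINT z|polydisc_measure. f z * cnj (g z))"

definition l2_norm :: "(complex ^ 'n \<Rightarrow> complex) \<Rightarrow> real" where
  "l2_norm f = sqrt (LINT z|polydisc_measure. (cmod (f z))\<^sup>2)"

text \<open>A function on the polydisc is encoded as a total function that vanishes outside. As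
  holomorphic functions that agree almost everywhere on the polydisc agree on all of it, distinct
  elements of \<open>bergman\<close> are distinct vectors of the Hilbert space.\<close>

definition bergman :: "(complex ^ 'n \<Rightarrow> complex) set" where
  "bergman = {f \<in> L2. holomorphic_vec_on f polydisc \<and> (\<forall>z. z \<notin> polydisc \<longrightarrow> f z = 0)}"

definition bergman_proj :: "(complex ^ 'n \<Rightarrow> complex) \<Rightarrow> (complex ^ 'n \<Rightarrow> complex)" where
  "bergman_proj f = (THE g. g \<in> bergman \<and> (\<forall>h\<in>bergman. l2_inner (f - g) h = 0))"

definition hankel ::
  "(complex ^ 'n \<Rightarrow> complex) \<Rightarrow> (complex ^ 'n \<Rightarrow> complex) \<Rightarrow> (complex ^ 'n \<Rightarrow> complex)" where
  "hankel \<psi> f = \<psi> * f - bergman_proj (\<psi> * f)"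

text \<open>The adjoint, a map from \<open>L2\<close> to \<open>bergman\<close>, of an operator from \<open>bergman\<close> to \<open>L2\<close>.\<close>

definition bergman_adjoint ::
  "((complex ^ 'n \<Rightarrow> complex) \<Rightarrow> (complex ^ 'n \<Rightarrow> complex)) \<Rightarrow>
   (complex ^ 'n \<Rightarrow> complex) \<Rightarrow> (complex ^ 'n \<Rightarrow> complex)" where
  "bergman_adjoint T g =
     (THE h. h \<in> bergman \<and> (\<forall>f\<in>bergman. l2_inner (T f) g = l2_inner f h))"

definition fscale :: "complex \<Rightarrow> ('a \<Rightarrow> complex) \<Rightarrow> ('a \<Rightarrow> complex)" where
  "fscale c f = (\<lambda>z. c * f z)"

lemma vector_space_fscale: "vector_space fscale"
  by unfold_locales (auto simp: fscale_def fun_eq_iff algebra_simps)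

definition bounded_operator_on ::
  "(complex ^ 'n \<Rightarrow> complex) set \<Rightarrow>
   ((complex ^ 'n \<Rightarrow> complex) \<Rightarrow> (complex ^ 'n \<Rightarrow> complex)) \<Rightarrow> bool" where
  "bounded_operator_on V T \<longleftrightarrow>
     T ` V \<subseteq> V \<and>
     (\<forall>f\<in>V. \<forall>g\<in>V. T (f + g) = T f + T g) \<and>
     (\<forall>c. \<forall>f\<in>V. T (fscale c f) = fscale c (T f)) \<and>
     (\<exists>C. \<forall>f\<in>V. l2_norm (T f) \<le> C * l2_norm f)"

definition spectrum_on ::
  "(complex ^ 'n \<Rightarrow> complex) set \<Rightarrow>
   ((complex ^ 'n \<Rightarrow> complex) \<Rightarrow> (complex ^ 'n \<Rightarrow> complex)) \<Rightarrow> complex set" where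
  "spectrum_on V T = {\<mu>. \<not> (\<exists>R. bounded_operator_on V R \<and>
     (\<forall>f\<in>V. R (T f - fscale \<mu> f) = f \<and> T (R f) - fscale \<mu> (R f) = f))}"

definition eigenspace_on ::
  "('a \<Rightarrow> complex) set \<Rightarrow> (('a \<Rightarrow> complex) \<Rightarrow> ('a \<Rightarrow> complex)) \<Rightarrow> complex \<Rightarrow>
   ('a \<Rightarrow> complex) set" where
  "eigenspace_on V T \<mu> = {f \<in> V. T f = fscale \<mu> f}"

definition eigenvalues_on ::
  "('a \<Rightarrow> complex) set \<Rightarrow> (('a \<Rightarrow> complex) \<Rightarrow> ('a \<Rightarrow> complex)) \<Rightarrow> complex set" where
  "eigenvalues_on V T = {\<mu>. \<exists>f\<in>V. f \<noteq> 0 \<and> T f = fscale \<mu> f}"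

definition finite_dimensional :: "('a \<Rightarrow> complex) set \<Rightarrow> bool" where
  "finite_dimensional W \<longleftrightarrow> (\<exists>S. finite S \<and> W \<subseteq> module.span fscale S)"

definition monomial_symbol :: "('n::finite \<Rightarrow> nat) \<Rightarrow> ('n \<Rightarrow> nat) \<Rightarrow> complex ^ 'n \<Rightarrow> complex" where
  "monomial_symbol n m z = (\<Prod>k\<in>UNIV. (z $ k) ^ n k * cnj (z $ k) ^ m k)"

definition hankel_square ::
  "(complex ^ 'n \<Rightarrow> complex) \<Rightarrow> (complex ^ 'n \<Rightarrow> complex) \<Rightarrow> (complex ^ 'n \<Rightarrow> complex)" where
  "hankel_square \<psi> f = bergman_adjoint (hankel \<psi>) (hankel \<psi> f)"

text \<open>The side condition is stated over the integers, as \<open>m k - n k\<close> may be negative.\<close>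

definition hankel_lambda ::
  "('n \<Rightarrow> nat) \<Rightarrow> ('n \<Rightarrow> nat) \<Rightarrow> ('n \<Rightarrow> nat) \<Rightarrow> 'n set \<Rightarrow> real" where
  "hankel_lambda n m \<alpha> B =
     (if \<exists>k\<in>B. int (\<alpha> k) < int (m k) - int (n k)
      then (\<Prod>k\<in>B. (real (\<alpha> k) + 1) / (real (\<alpha> k) + real (n k) + real (m k) + 1))
      else (\<Prod>k\<in>B. (real (\<alpha> k) + 1) / (real (\<alpha> k) + real (n k) + real (m k) + 1)) -
           (\<Prod>k\<in>B. (real (\<alpha> k) + 1) * (real (\<alpha> k) + real (n k) - real (m k) + 1) /
                    (real (\<alpha> k) + real (n k) + 1)\<^sup>2))"

end

theory Submission
  imports Defs "HOL-Complex_Analysis.Cauchy_Integral_Formula" "HOL-Real_Asymp.Real_Asymp"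
begin

text \<open>The monomials \<open>z\<^sup>\<alpha>\<close> are pairwise orthogonal and complete in the Bergman space, and the operator
\<open>H\<^sup>* H\<close> is diagonal in them. Indeed \<open>\<psi> z\<^sup>\<alpha>\<close> is the mixed monomial \<open>z\<^sup>(\<^sup>n\<^sup>+\<^sup>\<alpha>\<^sup>) cnj z\<^sup>m\<close>; rotation
invariance makes it orthogonal to all monomials except \<open>z\<^sup>(\<^sup>n\<^sup>+\<^sup>\<alpha>\<^sup>-\<^sup>m\<^sup>)\<close>, so its Bergman projection is a multiple of
that one, or zero if the exponent is negative somewhere. The eigenvalue is
\<open>(\<parallel>\<psi> z\<^sup>\<alpha>\<parallel>\<^sup>2 - \<parallel>P (\<psi> z\<^sup>\<alpha>)\<parallel>\<^sup>2) / \<parallel>z\<^sup>\<alpha>\<parallel>\<^sup>2\<close>, which is \<open>hankel_lambda n m \<alpha> UNIV\<close>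
(\<open>coef_hankel_square\<close>).

For a diagonal operator the spectrum is the closure of the set of diagonal entries
(\<open>spectrum_diagonal_operator\<close>), and the dimension of an eigenspace is the number of indices with that entry.
The rest is a study of the eigenvalues as the multi-index varies. Any sequence of multi-indices has a
subsequence in which every coordinate is constant or tends to infinity. The coordinates that tend to infinity
contribute factors with limit \<open>1\<close>, so the limit is the value for the set \<open>B\<close> of constant ones,
and \<open>0\<close> if there are none (\<open>closure_hankel_lambda\<close>). If a value were taken infinitely often while
\<open>n k + m k \<ge> 1\<close> for all \<open>k\<close>, the value would equal such a limit; comparing the speeds at which
the two products converge shows that then \<open>m = 0\<close> (\<open>finite_hankel_lambda_fibre\<close>). A coordinate with
\<open>n k + m k = 0\<close> does not influence the eigenvalue at all, which makes every multiplicity infinite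
(\<open>infinite_hankel_lambda_fibre\<close>).

The analytic work is the completeness of the monomials. In one variable, the moments of an integrable
holomorphic function over the disc are its Taylor coefficients up to a factor, which gives the reproducing formula
for the Bergman kernel. Fubini's theorem carries it to the polydisc
(\<open>separately_holomorphic_reproducing\<close>), and expanding the kernel there shows that a function in the
Bergman space is the sum of its monomial expansion (\<open>bergman_expansion\<close>). Conversely, every square summable
family of coefficients comes from a function in the Bergman space (\<open>bergman_synthesis\<close>). From this the
Bergman projection, the adjoint and the resolvents are constructed, each of them through its
coefficients.\<close>

section \<open>Integrals over the unit disc\<close>

text \<open>Rotations preserve planar Lebesgue measure because, read in the real plane, they are orthogonal
maps; a measure that agrees with Lebesgue measure on all boxes is Lebesgue measure.\<close>

lemma complex_mult_preserves_lborel: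
  assumes c: "cmod c = 1"
  shows "distr lborel borel ((*) c) = (lborel :: complex measure)"
proof -
  define T :: "real ^ 2 \<Rightarrow> complex" where "T = (\<lambda>v. Complex (v $ 1) (v $ 2))"
  define S :: "complex \<Rightarrow> real ^ 2" where "S = (\<lambda>w. vector [Re w, Im w])"
  have ST: "S (T v) = v" for v by (simp add: S_def T_def vec_eq_iff forall_2)
  have TS: "T (S w) = w" for w by (simp add: S_def T_def complex_eq_iff)
  have normS: "norm (S w) = cmod w" for w
    by (simp add: S_def norm_vec_def L2_set_def sum_2 cmod_def)
  have normT: "cmod (T v) = norm v" for v by (metis ST normS)
  have linS: "linear S" by (intro linearI) (auto simp: S_def vec_eq_iff forall_2)
  have linT: "linear T" by (intro linearI) (auto simp: T_def complex_eq_iff)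
  have Tcont: "continuous_on UNIV T" by (simp add: linT linear_continuous_on linear_linear)
  have [measurable]: "T \<in> borel_measurable borel" by (rule borel_measurable_continuous_onI[OF Tcont])
  have [measurable]: "(*) c \<in> borel_measurable borel" for c :: complex
    by (intro borel_measurable_continuous_onI continuous_intros)
  have TB: "T -` box l u = box (S l) (S u)" for l u
    by (auto simp: T_def S_def box_def Basis_complex_def Basis_vec_def inner_axis forall_2)
  have emS: "emeasure lborel (box (S l) (S u)) = (\<Prod>b\<in>Basis. (u - l) \<bullet> b)"
    if "\<And>b. b \<in> Basis \<Longrightarrow> l \<bullet> b \<le> u \<bullet> b" for l u
  proof -
    have le: "Re l \<le> Re u" "Im l \<le> Im u" using that[of 1] that[of \<i>] by (auto simp: Basis_complex_def)
    have B: "(Basis :: (real^2) set) = {axis 1 1, axis 2 1}"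
      by (auto simp: Basis_vec_def UNIV_2)
    have "axis 1 1 \<noteq> (axis 2 1 :: real ^ 2)" by (simp add: axis_eq_axis)
    then show ?thesis using le
      apply (subst emeasure_lborel_box)
       apply (auto simp: B S_def inner_axis Basis_complex_def)
      done
  qed
  have d1: "lborel = distr lborel borel T"
    by (rule lborel_eqI) (auto simp: emeasure_distr TB emS)
  have d2: "distr lborel borel ((*) c) = distr lborel borel (\<lambda>v. c * T v)"
    by (subst d1, subst distr_distr) (auto simp: o_def)
  define R where "R = (\<lambda>v. S (cnj c * T v))"
  have cc: "cnj c * c = 1" "c * cnj c = 1" using c complex_norm_square[of c] by (auto simp: mult.commute)
  have "orthogonal_transformation R"
    unfolding orthogonal_transformation R_def
  proof (intro conjI allI)
    show "linear (\<lambda>v. S (cnj c * T v))"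
      using linear_compose[OF linear_compose[OF linT linear_times[of "cnj c"]] linS] by (simp add: o_def)
    show "norm (S (cnj c * T v)) = norm v" for v by (simp add: normS norm_mult c normT)
  qed
  note R = this
  have im: "(\<lambda>v. c * T v) -` A = R ` (T -` A)" for A
  proof (intro set_eqI iffI)
    fix v assume v: "v \<in> (\<lambda>v. c * T v) -` A"
    have "v = R (S (c * T v))" by (simp add: R_def TS ST mult.assoc[symmetric] cc)
    then show "v \<in> R ` (T -` A)" using v TS by (metis image_eqI vimageE vimageI2)
  next
    fix v assume "v \<in> R ` (T -` A)"
    then show "v \<in> (\<lambda>v. c * T v) -` A" by (auto simp: R_def TS mult.assoc[symmetric] cc)
  qed
  have "lborel = distr lborel borel (\<lambda>v. c * T v)"
  proof (rule lborel_eqI)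
    fix l u :: complex assume lu: "\<And>b. b \<in> Basis \<Longrightarrow> l \<bullet> b \<le> u \<bullet> b"
    have lm: "box (S l) (S u) \<in> lmeasurable" by simp
    have b: "R ` box (S l) (S u) \<in> sets borel"
      by (subst TB[symmetric], subst im[symmetric]) (rule measurable_sets_borel[where M=borel], auto)
    have "emeasure (distr lborel borel (\<lambda>v. c * T v)) (box l u) = emeasure lborel (R ` box (S l) (S u))"
      by (simp add: emeasure_distr im TB)
    also have "\<dots> = emeasure lebesgue (R ` box (S l) (S u))" using b by simp
    also have "\<dots> = measure lebesgue (R ` box (S l) (S u))"
      using measurable_orthogonal_image[OF R lm] by (simp add: emeasure_eq_measure2 fmeasurableD2)
    also have "\<dots> = measure lebesgue (box (S l) (S u))" by (simp add: measure_orthogonal_image[OF R lm])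
    also have "\<dots> = emeasure lborel (box (S l) (S u))" using lm by (simp add: emeasure_eq_measure2 fmeasurableD2)
    finally show "emeasure (distr lborel borel (\<lambda>v. c * T v)) (box l u) = (\<Prod>b\<in>Basis. (u - l) \<bullet> b)"
      using emS[OF lu] by simp
  qed simp
  then show ?thesis using d2 by simp
qed

lemma integrable_ball_bounded:
  fixes f :: "complex \<Rightarrow> complex"
  assumes [measurable]: "f \<in> borel_measurable borel" and B: "\<And>z. z \<in> ball 0 r \<Longrightarrow> cmod (f z) \<le> B"
  shows "integrable lborel (\<lambda>z. indicator (ball 0 r) z * f z)"
proof (rule integrableI_bounded_set[where A = "ball 0 r" and B = B])
  show "emeasure lborel (ball (0::complex) r) < \<infinity>"
    using emeasure_bounded_finite[of "ball (0::complex) r"] by (simp add: less_top)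
qed (auto intro!: AE_I2 simp: B indicator_def)

lemma integrable_disc_monomial:
  "integrable lborel (\<lambda>z::complex. indicator (ball 0 r) z * (z ^ p * cnj z ^ q))"
proof (rule integrable_ball_bounded)
  show "(\<lambda>z. z ^ p * cnj z ^ q) \<in> borel_measurable borel"
    by (intro borel_measurable_continuous_onI continuous_intros)
  show "cmod (z ^ p * cnj z ^ q) \<le> r ^ p * r ^ q" if "z \<in> ball 0 r" for z
  proof -
    have "0 \<le> r" "cmod z \<le> r" using that norm_ge_zero[of z] by (auto simp del: norm_ge_zero)
    then show ?thesis by (auto simp: norm_mult norm_power intro!: mult_mono power_mono)
  qed
qed

text \<open>The rotation by \<open>c\<close> multiplies the integrand by \<open>c ^ p * cnj c ^ q\<close>. For
\<open>p \<noteq> q\<close> the angle can be chosen so that this factor is \<open>-1\<close>, hence the integral is its own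
negative.\<close>

lemma integral_disc_monomial_off_diagonal:
  assumes "p \<noteq> q"
  shows "(\<integral>(z::complex). indicator (ball 0 r) z * (z ^ p * cnj z ^ q) \<partial>lborel) = 0"
proof -
  define c where "c = cis (pi / (real p - real q))"
  have "c ^ p * cnj c ^ q = cis (real p * (pi / (real p - real q)) - real q * (pi / (real p - real q)))"
    unfolding c_def cis_cnj Complex.DeMoivre cis_mult by simp
  also have "real p * (pi / (real p - real q)) - real q * (pi / (real p - real q)) = pi"
    using assms by (simp flip: left_diff_distrib add: divide_simps)
  finally have c1: "c ^ p * cnj c ^ q = - 1" by simp
  have c: "cmod c = 1" by (simp add: c_def)
  let ?f = "\<lambda>z::complex. indicator (ball 0 r) z * (z ^ p * cnj z ^ q) :: complex"
  have [measurable]: "(\<lambda>z. z ^ p * cnj z ^ q) \<in> borel_measurable borel"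
    by (intro borel_measurable_continuous_onI continuous_intros)
  have "integral\<^sup>L lborel ?f = integral\<^sup>L (distr lborel borel ((*) c)) ?f"
    by (simp add: complex_mult_preserves_lborel[OF c])
  also have "\<dots> = (\<integral>z. ?f (c * z) \<partial>lborel)"
    using borel_measurable_integrable[OF integrable_disc_monomial[of r p q]]
    by (subst integral_distr) (auto intro!: borel_measurable_continuous_onI continuous_intros)
  also have "\<dots> = (\<integral>z. - ?f z \<partial>lborel)"
  proof (intro Bochner_Integration.integral_cong refl)
    fix z :: complex
    have "?f (c * z) = indicator (ball 0 r) z * ((c ^ p * cnj c ^ q) * (z ^ p * cnj z ^ q))"
      using c by (simp add: indicator_def norm_mult power_mult_distrib mult_ac)
    then show "?f (c * z) = - ?f z" by (simp only: c1) simp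
  qed
  finally show ?thesis by simp
qed

lemma integral_complex_scale:
  fixes f :: "complex \<Rightarrow> real"
  assumes [measurable]: "f \<in> borel_measurable borel" and s: "s > 0"
  shows "integral\<^sup>L lborel f = s ^ 2 * (\<integral>z. f (of_real s * z) \<partial>lborel)"
proof -
  have "lborel = density (distr lborel borel (\<lambda>x::complex. 0 + s *\<^sub>R x)) (\<lambda>_. ennreal (\<bar>s\<bar>^DIM(complex)))"
    using lborel_affine[of s "0::complex"] s by (simp add: ennreal_power)
  then have "integral\<^sup>L lborel f =
    integral\<^sup>L (density (distr lborel borel (\<lambda>x::complex. 0 + s *\<^sub>R x)) (\<lambda>_. ennreal (\<bar>s\<bar>^DIM(complex)))) f"
    by simp
  also have "\<dots> = s ^ 2 * (\<integral>z. f (of_real s * z) \<partial>lborel)"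
    by (subst integral_density) (auto simp: integral_distr scaleR_conv_of_real)
  finally show ?thesis .
qed

text \<open>Polar coordinates are replaced by scaling. With \<open>J s\<close> the integral over the disc of radius \<open>s\<close>, scaling
gives \<open>J s = s ^ (2 * p + 2) * J 1\<close>, while on the annulus between the radii \<open>s\<close> and \<open>1\<close> the integrand
lies between \<open>s ^ (2 * p)\<close> and \<open>1\<close>. Dividing the resulting bounds for \<open>J 1 - J s\<close> by \<open>1 - s\<^sup>2\<close>
and letting \<open>s\<close> tend to \<open>1\<close> leaves \<open>(p + 1) * J 1 = \<pi>\<close>.\<close>

lemma integral_disc_abs_power:
  assumes r: "r > 0"
  shows "(\<integral>(z::complex). indicator (ball 0 r) z * cmod z ^ (2 * p) \<partial>lborel) = pi * r ^ (2 * p + 2) / (real p + 1)"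
proof -
  define J where "J = (\<lambda>s. \<integral>(z::complex). indicator (ball 0 s) z * cmod z ^ (2 * p) \<partial>lborel)"
  have J_scale: "J s = s ^ (2 * p + 2) * J 1" if s: "s > 0" for s
  proof -
    have "J s = s ^ 2 * (\<integral>z. indicator (ball 0 s) (of_real s * z) * cmod (of_real s * z) ^ (2 * p) \<partial>lborel)"
      unfolding J_def by (rule integral_complex_scale[OF _ s]) (auto intro!: borel_measurable_times borel_measurable_indicator borel_measurable_power)
    also have "(\<lambda>z. indicator (ball 0 s) (of_real s * z) * cmod (of_real s * z) ^ (2 * p)) =
       (\<lambda>z. s ^ (2 * p) * (indicator (ball 0 1) z * cmod z ^ (2 * p)))"
      using s by (auto simp: fun_eq_iff indicator_def norm_mult power_mult_distrib)
    also have "(\<integral>(z::complex). s ^ (2 * p) * (indicator (ball 0 1) z * cmod z ^ (2 * p)) \<partial>lborel) = s ^ (2 * p) * J 1"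
      by (simp add: J_def)
    finally show ?thesis by (simp add: power_add mult_ac power2_eq_square)
  qed
  have int: "integrable lborel (\<lambda>z::complex. indicator (ball 0 s) z * cmod z ^ k :: real)" for s k
  proof (rule integrableI_bounded_set[where A = "ball 0 s" and B = "s ^ k"])
    show "emeasure lborel (ball (0::complex) s) < \<infinity>"
      using emeasure_bounded_finite[of "ball (0::complex) s"] by (simp add: less_top)
  qed (auto intro!: AE_I2 power_mono simp: indicator_def norm_power)
  have area: "(\<integral>(z::complex). indicator (ball 0 s) z \<partial>lborel) = pi * s ^ 2" if "s > 0" for s :: real
    using that by (simp add: content_ball unit_ball_vol_2)
  have int0: "integrable lborel (\<lambda>z::complex. indicator (ball 0 s) z :: real)" for s
    using int[of s 0] by simp
  have up: "(1 - s ^ (2 * p + 2)) * J 1 \<le> pi * (1 - s ^ 2)"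
   and lo: "(1 - s ^ (2 * p + 2)) * J 1 \<ge> s ^ (2 * p) * (pi * (1 - s ^ 2))" if s: "0 < s" "s < 1" for s
  proof -
    have eq: "(1 - s ^ (2 * p + 2)) * J 1 = J 1 - J s" using J_scale[OF s(1)] by (simp add: algebra_simps)
    have sub: "(indicator (ball 0 s) z :: real) \<le> indicator (ball 0 1) z" for z :: complex
      using s by (auto simp: indicator_def)
    have "J 1 - J s = (\<integral>(z::complex). indicator (ball 0 1) z * cmod z ^ (2 * p) - indicator (ball 0 s) z * cmod z ^ (2 * p) \<partial>lborel)"
      unfolding J_def using int by (intro Bochner_Integration.integral_diff[symmetric])
    also have "\<dots> \<le> (\<integral>(z::complex). indicator (ball 0 1) z - indicator (ball 0 s) z \<partial>lborel)"
      using s by (intro Bochner_Integration.integral_mono Bochner_Integration.integrable_diff int int0)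
        (auto simp: indicator_def power_le_one)
    also have "\<dots> = pi * (1 - s ^ 2)"
      using int0 area[OF s(1)] area[of 1] by (simp add: algebra_simps)
    finally show "(1 - s ^ (2 * p + 2)) * J 1 \<le> pi * (1 - s ^ 2)" using eq by simp
    have "s ^ (2 * p) * (pi * (1 - s ^ 2)) = (\<integral>(z::complex). s ^ (2 * p) * (indicator (ball 0 1) z - indicator (ball 0 s) z) \<partial>lborel)"
      using int0 area[OF s(1)] area[of 1] by (simp add: algebra_simps)
    also have "\<dots> \<le> (\<integral>(z::complex). indicator (ball 0 1) z * cmod z ^ (2 * p) - indicator (ball 0 s) z * cmod z ^ (2 * p) \<partial>lborel)"
      using s by (intro Bochner_Integration.integral_mono Bochner_Integration.integrable_diff int int0 Bochner_Integration.integrable_mult_right)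
        (auto simp: indicator_def intro!: power_mono)
    also have "\<dots> = J 1 - J s"
      unfolding J_def using int by (intro Bochner_Integration.integral_diff)
    finally show "(1 - s ^ (2 * p + 2)) * J 1 \<ge> s ^ (2 * p) * (pi * (1 - s ^ 2))" using eq by simp
  qed
  \<comment> \<open>The geometric sum makes the factor \<open>1 - s\<^sup>2\<close> cancel, so that the limit can be taken by continuity.\<close>
  have geo: "1 - s ^ (2 * p + 2) = (1 - s ^ 2) * (\<Sum>i<Suc p. (s ^ 2) ^ i)" for s :: real
  proof -
    have "1 - s ^ (2 * p + 2) = 1 - (s ^ 2) ^ Suc p" by (simp only: power_mult[symmetric]) simp
    then show ?thesis by (simp only: one_diff_power_eq[of "s\<^sup>2" "Suc p"])
  qed
  have up': "(\<Sum>i<Suc p. (s ^ 2) ^ i) * J 1 \<le> pi" and lo': "s ^ (2 * p) * pi \<le> (\<Sum>i<Suc p. (s ^ 2) ^ i) * J 1"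
    if s: "0 < s" "s < 1" for s
  proof -
    have pos: "1 - s ^ 2 > 0" using power_strict_mono[of s 1 2] s by simp
    show "(\<Sum>i<Suc p. (s ^ 2) ^ i) * J 1 \<le> pi"
      using up[OF s] pos unfolding geo by (simp add: mult.assoc mult.commute[of pi] del: sum.lessThan_Suc)
    show "s ^ (2 * p) * pi \<le> (\<Sum>i<Suc p. (s ^ 2) ^ i) * J 1"
      using lo[OF s] pos unfolding geo by (simp add: mult.assoc mult.left_commute[of _ "1 - s\<^sup>2"] mult.commute[of _ "1 - s\<^sup>2"] del: sum.lessThan_Suc)
  qed
  have ev: "\<forall>\<^sub>F s in at_left 1. 0 < s \<and> s < (1::real)"
    using eventually_at_left_real[of 0 "1::real"] by (auto elim: eventually_mono)
  have t1: "((\<lambda>s::real. (\<Sum>i<Suc p. (s ^ 2) ^ i) * J 1) \<longlongrightarrow> (\<Sum>i<Suc p. (1 ^ 2) ^ i) * J 1) (at_left 1)"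
    by (intro tendsto_intros)
  have t2: "((\<lambda>s::real. s ^ (2 * p) * pi) \<longlongrightarrow> 1 ^ (2 * p) * pi) (at_left 1)"
    by (intro tendsto_intros)
  have "(\<Sum>i<Suc p. (1 ^ 2) ^ i) * J 1 \<le> pi"
    by (rule tendsto_upperbound[OF t1]) (use ev up' in \<open>auto elim!: eventually_mono simp del: sum.lessThan_Suc\<close>)
  moreover have "1 ^ (2 * p) * pi \<le> (\<Sum>i<Suc p. (1 ^ 2) ^ i) * J 1"
    by (rule tendsto_le[OF _ t1 t2]) (use ev lo' in \<open>auto elim!: eventually_mono simp del: sum.lessThan_Suc\<close>)
  ultimately have "(real p + 1) * J 1 = pi" by (simp add: add.commute)
  then have "J 1 = pi / (real p + 1)" by (simp add: field_simps)
  then show ?thesis using J_scale[OF r] unfolding J_def by simp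
qed

lemma integral_disc_monomial:
  assumes r: "r > 0"
  shows "(\<integral>(z::complex). indicator (ball 0 r) z * (z ^ p * cnj z ^ q) \<partial>lborel) =
           (if p = q then of_real (pi * r ^ (2 * p + 2) / (real p + 1)) else 0)"
proof (cases "p = q")
  case True
  have "(\<integral>(z::complex). indicator (ball 0 r) z * (z ^ p * cnj z ^ p) \<partial>lborel) =
        (\<integral>(z::complex). complex_of_real (indicator (ball 0 r) z * cmod z ^ (2 * p)) \<partial>lborel)"
    by (intro Bochner_Integration.integral_cong refl)
       (simp add: indicator_def power_mult flip: power_mult_distrib complex_norm_square)
  also have "\<dots> = of_real (pi * r ^ (2 * p + 2) / (real p + 1))"
    by (subst integral_complex_of_real) (simp only: integral_disc_abs_power[OF r])
  finally show ?thesis using True by simp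
qed (simp add: integral_disc_monomial_off_diagonal)

text \<open>On a smaller disc the Taylor series converges uniformly and can be integrated termwise, where the
orthogonality of the monomials leaves one term. As the moment over the smaller disc is explicit in
its radius, dominated convergence extends the formula to the unit disc for every integrable \<open>g\<close>.\<close>

lemma integral_disc_holomorphic_moment:
  assumes hol: "g holomorphic_on ball 0 1" and int: "integrable lborel g"
    and out: "\<And>z. z \<notin> ball 0 1 \<Longrightarrow> g z = 0"
  shows "(\<integral>z. g z * cnj z ^ p \<partial>lborel) = of_real (pi / (real p + 1)) * ((deriv ^^ p) g 0 / fact p)"
proof -
  define a where "a = (\<lambda>q. (deriv ^^ q) g 0 / fact q)"
  have ser: "(\<lambda>q. a q * z ^ q) sums g z" if "z \<in> ball 0 1" for z
    using holomorphic_power_series[OF hol that] by (simp add: a_def)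
  have gm[measurable]: "g \<in> borel_measurable borel" using int by auto
  have [measurable]: "cnj \<in> borel_measurable borel"
    by (intro borel_measurable_continuous_onI continuous_intros)
  have part: "(\<integral>z. indicator (ball 0 r) z * (g z * cnj z ^ p) \<partial>lborel) =
     of_real (pi * r ^ (2 * p + 2) / (real p + 1)) * a p" if r: "0 < r" "r < 1" for r
  proof -
    let ?f = "\<lambda>q z. a q * (indicator (ball 0 r) z * (z ^ q * cnj z ^ p))"
    obtain s where s: "r < s" "s < 1" using r dense by blast
    have abs: "summable (\<lambda>q. norm (a q * of_real r ^ q))"
      by (rule powser_insidea[where x = "of_real s"]) (use s r sums_summable[OF ser[of "of_real s"]] in auto)
    have bd: "norm (?f q z) \<le> norm (a q * of_real r ^ q) * indicator (ball 0 r) z" for q z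
    proof (cases "z \<in> ball 0 r")
      case True
      then have "cmod z ^ q * cmod z ^ p \<le> r ^ q * 1"
        using r by (intro mult_mono power_mono power_le_one) auto
      then show ?thesis using True r
        by (simp add: norm_mult norm_power mult_left_mono)
    qed simp
    have ind: "integrable lborel (\<lambda>z::complex. indicator (ball 0 r) z :: real)"
      using emeasure_bounded_finite[of "ball (0::complex) r"] by (simp add: integrable_indicator_iff less_top)
    have sums: "(\<lambda>q. integral\<^sup>L lborel (?f q)) sums (\<integral>z. (\<Sum>q. ?f q z) \<partial>lborel)"
    proof (rule sums_integral)
      show "integrable lborel (?f q)" for q
        by (intro Bochner_Integration.integrable_mult_right integrable_disc_monomial)
      show "AE z in lborel. summable (\<lambda>q. norm (?f q z))"
      proof (rule AE_I2)
        show "summable (\<lambda>q. norm (?f q z))" for z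
          by (rule summable_comparison_test'[OF summable_mult2[OF abs, of "indicator (ball 0 r) z"]])
             (use bd[of _ z] in simp)
      qed
      show "summable (\<lambda>q. \<integral>z. norm (?f q z) \<partial>lborel)"
      proof (rule summable_comparison_test'[OF summable_mult2[OF abs, of "\<integral>(z::complex). indicator (ball 0 r) z \<partial>lborel"]])
        fix q :: nat
        have "(\<integral>z. norm (?f q z) \<partial>lborel) \<le> (\<integral>(z::complex). norm (a q * of_real r ^ q) * indicator (ball 0 r) z \<partial>lborel)"
        proof (rule Bochner_Integration.integral_mono)
          show "integrable lborel (\<lambda>z. norm (?f q z))"
            by (intro integrable_norm Bochner_Integration.integrable_mult_right integrable_disc_monomial)
          show "integrable lborel (\<lambda>z::complex. norm (a q * of_real r ^ q) * indicator (ball 0 r) z)"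
            using ind by simp
        qed (rule bd)
        then show "norm (\<integral>z. norm (?f q z) \<partial>lborel) \<le> norm (a q * of_real r ^ q) * (\<integral>(z::complex). indicator (ball 0 r) z \<partial>lborel)"
          by simp
      qed
    qed
    have sumeq: "(\<Sum>q. ?f q z) = indicator (ball 0 r) z * (g z * cnj z ^ p)" for z
    proof (cases "z \<in> ball 0 r")
      case True
      then have "(\<lambda>q. a q * z ^ q * cnj z ^ p) sums (g z * cnj z ^ p)"
        using r by (intro sums_mult2 ser) auto
      then show ?thesis using True by (simp add: sums_iff mult_ac)
    qed simp
    have vals: "integral\<^sup>L lborel (?f q) = (if q = p then of_real (pi * r ^ (2 * p + 2) / (real p + 1)) * a p else 0)" for q
      by (subst Bochner_Integration.integral_mult_right_zero) (simp add: integral_disc_monomial[OF r(1)] mult.commute)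
    have "(\<lambda>q. integral\<^sup>L lborel (?f q)) sums (of_real (pi * r ^ (2 * p + 2) / (real p + 1)) * a p)"
      unfolding vals using sums_single[of p "\<lambda>_. of_real (pi * r ^ (2 * p + 2) / (real p + 1)) * a p"] by simp
    with sums show ?thesis unfolding sumeq by (rule sums_unique2)
  qed
  \<comment> \<open>Any sequence of radii in \<open>(0, 1)\<close> that tends to \<open>1\<close> serves to exhaust the disc.\<close>
  define R where "R = (\<lambda>j::nat. 1 - 1 / (real j + 2))"
  have R: "0 < R j" "R j < 1" for j by (auto simp: R_def field_simps)
  have Rlim: "R \<longlonglongrightarrow> 1" unfolding R_def by real_asymp
  have "(\<lambda>j. \<integral>z. indicator (ball 0 (R j)) z * (g z * cnj z ^ p) \<partial>lborel) \<longlonglongrightarrow> (\<integral>z. g z * cnj z ^ p \<partial>lborel)"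
  proof (rule integral_dominated_convergence[where w = "\<lambda>z. norm (g z)"])
    show "integrable lborel (\<lambda>z. norm (g z))" using int by simp
    show "AE z in lborel. (\<lambda>j. indicator (ball 0 (R j)) z * (g z * cnj z ^ p)) \<longlonglongrightarrow> g z * cnj z ^ p"
    proof (rule AE_I2)
      fix z
      show "(\<lambda>j. indicator (ball 0 (R j)) z * (g z * cnj z ^ p)) \<longlonglongrightarrow> g z * cnj z ^ p"
      proof (cases "z \<in> ball 0 1")
        case True
        then have "\<forall>\<^sub>F j in sequentially. cmod z < R j"
          by (intro order_tendstoD(1)[OF Rlim]) simp
        then show ?thesis
          by (intro tendsto_eventually) (erule eventually_mono, simp)
      qed (simp add: out)
    qed
    show "AE z in lborel. norm (indicator (ball 0 (R j)) z * (g z * cnj z ^ p)) \<le> norm (g z)" for j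
    proof (rule AE_I2)
      fix z :: complex
      have "cmod z ^ p \<le> 1" if "cmod z < R j"
        using that R[of j] by (intro power_le_one) auto
      then show "norm (indicator (ball 0 (R j)) z * (g z * cnj z ^ p)) \<le> norm (g z)"
        by (auto simp: indicator_def norm_mult norm_power mult_left_le)
    qed
  next
    have [measurable]: "g \<in> borel_measurable lborel" "cnj \<in> borel_measurable lborel" by simp_all
    show "(\<lambda>z. g z * cnj z ^ p) \<in> borel_measurable lborel" by measurable
    then show "(\<lambda>z. indicator (ball 0 (R j)) z * (g z * cnj z ^ p)) \<in> borel_measurable lborel" for j
      by (intro borel_measurable_times borel_measurable_indicator) auto
  qed
  moreover have "(\<lambda>j. \<integral>z. indicator (ball 0 (R j)) z * (g z * cnj z ^ p) \<partial>lborel) \<longlonglongrightarrow>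
     of_real (pi * 1 ^ (2 * p + 2) / (real p + 1)) * a p"
    unfolding part[OF R] by (intro tendsto_intros Rlim) auto
  ultimately show ?thesis using LIMSEQ_unique by (fastforce simp: a_def)
qed

text \<open>The Bergman kernel of the disc, as a function of the point \<open>w\<close> of evaluation and the variable \<open>z\<close> of
integration; it is holomorphic in \<open>w\<close> and antiholomorphic in \<open>z\<close>.\<close>

definition disc_kernel :: "complex \<Rightarrow> complex \<Rightarrow> complex" where
  "disc_kernel w z = (1 / (1 - w * cnj z) ^ 2) / of_real pi"

lemma disc_kernel_sums:
  assumes "cmod w < 1" "cmod z < 1"
  shows "(\<lambda>p. of_real ((real p + 1) / pi) * (w * cnj z) ^ p) sums disc_kernel w z"
proof -
  have "cmod (w * cnj z) < 1" 
    using assms mult_strict_mono'[of "cmod w" 1 "cmod z" 1] by (simp add: norm_mult)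
  from sums_divide[OF geometric_deriv_sums[OF this], of "of_real pi"] show ?thesis
    by (simp add: disc_kernel_def add.commute)
qed

lemma disc_kernel_measurable[measurable]: "disc_kernel w \<in> borel_measurable borel"
proof -
  have [measurable]: "cnj \<in> borel_measurable borel"
    by (intro borel_measurable_continuous_onI continuous_intros)
  show ?thesis unfolding disc_kernel_def by measurable
qed

text \<open>Integrating the kernel series termwise against \<open>g\<close>, the moments of \<open>g\<close> turn it into the Taylor series
of \<open>g\<close> at \<open>w\<close>. The assumption is integrability and not square integrability because in several
variables the formula is applied to slices, of which Fubini's theorem only says that they are integrable.\<close>

lemma disc_kernel_reproducing:
  assumes hol: "g holomorphic_on ball 0 1" and int: "integrable lborel g"
    and out: "\<And>z. z \<notin> ball 0 1 \<Longrightarrow> g z = 0" and w: "cmod w < 1"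
  shows "(\<integral>z. g z * disc_kernel w z \<partial>lborel) = g w"
proof -
  let ?f = "\<lambda>p z. (of_real ((real p + 1) / pi) * w ^ p) * (g z * cnj z ^ p)"
  have gm[measurable]: "g \<in> borel_measurable borel" using int by auto
  have [measurable]: "cnj \<in> borel_measurable borel"
    by (intro borel_measurable_continuous_onI continuous_intros)
  have abs: "summable (\<lambda>p. (real p + 1) / pi * cmod w ^ p)"
    using sums_summable[OF sums_divide[OF geometric_deriv_sums[of "cmod w"], of pi]] w by (simp add: add.commute)
  have pw: "norm (g z * cnj z ^ p) \<le> norm (g z)" for z p
  proof (cases "z \<in> ball 0 1")
    case True
    then have "cmod z ^ p \<le> 1" by (intro power_le_one) auto
    then show ?thesis by (simp add: norm_mult norm_power mult_left_le)
  qed (simp add: out)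
  have bd: "norm (?f p z) \<le> ((real p + 1) / pi * cmod w ^ p) * norm (g z)" for p z
  proof -
    have "norm (?f p z) = ((real p + 1) / pi * cmod w ^ p) * norm (g z * cnj z ^ p)"
      unfolding norm_mult[of "of_real _ * _"] norm_mult[of "of_real _"] norm_power norm_of_real by simp
    also have "\<dots> \<le> ((real p + 1) / pi * cmod w ^ p) * norm (g z)"
      by (intro mult_left_mono pw) simp
    finally show ?thesis .
  qed
  have intp: "integrable lborel (\<lambda>z. g z * cnj z ^ p)" for p
    by (rule Bochner_Integration.integrable_bound[OF int]) (use pw in auto)
  have "(\<lambda>p. integral\<^sup>L lborel (?f p)) sums (\<integral>z. (\<Sum>p. ?f p z) \<partial>lborel)"
  proof (rule sums_integral)
    show "integrable lborel (?f p)" for p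
      by (intro Bochner_Integration.integrable_mult_right intp)
    show "AE z in lborel. summable (\<lambda>q. norm (?f q z))"
    proof (rule AE_I2)
      show "summable (\<lambda>q. norm (?f q z))" for z
        by (rule summable_comparison_test'[OF summable_mult2[OF abs, of "norm (g z)"]])
           (use bd[of _ z] in simp)
    qed
    show "summable (\<lambda>q. \<integral>z. norm (?f q z) \<partial>lborel)"
    proof (rule summable_comparison_test'[OF summable_mult2[OF abs, of "\<integral>z. norm (g z) \<partial>lborel"]])
      fix q :: nat
      have "(\<integral>z. norm (?f q z) \<partial>lborel) \<le> (\<integral>z. ((real q + 1) / pi * cmod w ^ q) * norm (g z) \<partial>lborel)"
        by (intro Bochner_Integration.integral_mono integrable_norm Bochner_Integration.integrable_mult_right intp int bd)
      then show "norm (\<integral>z. norm (?f q z) \<partial>lborel) \<le> (real q + 1) / pi * cmod w ^ q * (\<integral>z. norm (g z) \<partial>lborel)"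
        by simp
    qed
  qed
  moreover have "(\<Sum>p. ?f p z) = g z * disc_kernel w z" for z
  proof (cases "z \<in> ball 0 1")
    case True
    then have "(\<lambda>p. of_real ((real p + 1) / pi) * (w * cnj z) ^ p * g z) sums (disc_kernel w z * g z)"
      using w by (intro sums_mult2 disc_kernel_sums) auto
    then show ?thesis by (simp add: sums_iff mult_ac power_mult_distrib)
  qed (simp add: out)
  moreover have "integral\<^sup>L lborel (?f p) = (deriv ^^ p) g 0 / fact p * (w - 0) ^ p" for p
  proof -
    have mom: "(\<integral>z. g z * cnj z ^ p \<partial>lborel) = of_real (pi / (real p + 1)) * ((deriv ^^ p) g 0 / fact p)"
      by (rule integral_disc_holomorphic_moment[OF hol int out])
    have "integral\<^sup>L lborel (?f p) = (of_real ((real p + 1) / pi) * w ^ p) * (of_real (pi / (real p + 1)) * ((deriv ^^ p) g 0 / fact p))"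
      by (subst Bochner_Integration.integral_mult_right_zero) (simp only: mom)
    also have "\<dots> = of_real ((real p + 1) / pi * (pi / (real p + 1))) * ((deriv ^^ p) g 0 / fact p * (w - 0) ^ p)"
      by (simp only: of_real_mult) (simp add: mult_ac)
    also have "(real p + 1) / pi * (pi / (real p + 1)) = 1" by (simp add: nonzero_divide_mult_cancel_left)
    finally show ?thesis by simp
  qed
  moreover have "(\<lambda>p. (deriv ^^ p) g 0 / fact p * (w - 0) ^ p) sums g w"
    by (rule holomorphic_power_series[OF hol]) (simp add: w)
  ultimately show ?thesis by (simp add: sums_unique2)
qed


section \<open>The reproducing formula on the polydisc\<close>

interpretation complex_coords: product_sigma_finite "\<lambda>_. lborel :: complex measure" ..

lemma measurable_vec_lambda:
  "(\<lambda>x. \<chi> i. x i) \<in> borel_measurable (Pi\<^sub>M (UNIV :: 'n::finite set) (\<lambda>_. lborel :: complex measure))"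
proof -
  have "(\<lambda>x. x j \<bullet> b) \<in> borel_measurable (Pi\<^sub>M (UNIV :: 'n set) (\<lambda>_. lborel :: complex measure))" for j b
  proof -
    have [measurable]: "(\<lambda>x. x j) \<in> measurable (Pi\<^sub>M (UNIV :: 'n set) (\<lambda>_. lborel :: complex measure)) lborel"
      by (rule measurable_component_singleton) simp
    show ?thesis by measurable
  qed
  then show ?thesis
    by (subst borel_measurable_euclidean_space) (auto simp: Basis_vec_def inner_axis)
qed

text \<open>This identification is what gives access to Fubini's theorem one complex coordinate at a time.\<close>

lemma lborel_vec_eq_product:
  "(lborel :: (complex ^ 'n::finite) measure) =
     distr (Pi\<^sub>M UNIV (\<lambda>_. lborel)) borel (\<lambda>x. \<chi> i. x i)"
proof (rule lborel_eqI)
  fix l u :: "complex ^ 'n" assume lu: "\<And>b. b \<in> Basis \<Longrightarrow> l \<bullet> b \<le> u \<bullet> b"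
  have lu': "l $ i \<bullet> b \<le> u $ i \<bullet> b" if "b \<in> Basis" for i b
    using lu[of "axis i b"] that by (auto simp: Basis_vec_def inner_axis)
  have vim: "(\<lambda>x. \<chi> i. x i) -` box l u \<inter> space (Pi\<^sub>M UNIV (\<lambda>_. lborel :: complex measure)) =
      Pi\<^sub>E UNIV (\<lambda>i. box (l $ i) (u $ i))"
    by (auto simp: box_def Basis_vec_def inner_axis space_PiM PiE_iff)
  have B: "(Basis :: (complex ^ 'n) set) = (\<lambda>(i, b). axis i b) ` (UNIV \<times> Basis)"
    by (auto simp: Basis_vec_def)
  have inj: "inj_on (\<lambda>(i, b). axis i b :: complex ^ 'n) (UNIV \<times> Basis)"
    by (auto simp: inj_on_def axis_eq_axis)
  have "emeasure (distr (Pi\<^sub>M UNIV (\<lambda>_. lborel)) borel (\<lambda>x. \<chi> i. x i)) (box l u) =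
      emeasure (Pi\<^sub>M UNIV (\<lambda>_. lborel :: complex measure)) (Pi\<^sub>E UNIV (\<lambda>i. box (l $ i) (u $ i)))"
    by (subst emeasure_distr) (auto simp: vim measurable_vec_lambda)
  also have "\<dots> = (\<Prod>i\<in>UNIV. emeasure lborel (box (l $ i) (u $ i)))"
    by (intro complex_coords.emeasure_PiM) auto
  also have "\<dots> = (\<Prod>i\<in>UNIV. ennreal (\<Prod>b\<in>Basis. (u $ i - l $ i) \<bullet> b))"
    by (intro prod.cong refl emeasure_lborel_box lu')
  also have "\<dots> = ennreal (\<Prod>i\<in>UNIV. \<Prod>b\<in>Basis. (u $ i - l $ i) \<bullet> b)"
    by (rule prod_ennreal) (auto intro!: prod_nonneg simp: inner_diff_left lu')
  also have "(\<Prod>i\<in>UNIV. \<Prod>b\<in>Basis. (u $ i - l $ i) \<bullet> b) = (\<Prod>b\<in>Basis. (u - l) \<bullet> b)"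
    unfolding B by (subst prod.reindex[OF inj]) (simp add: prod.cartesian_product inner_axis case_prod_unfold)
  finally show "emeasure (distr (Pi\<^sub>M UNIV (\<lambda>_. lborel)) borel (\<lambda>x. \<chi> i. x i)) (box l u) =
      ennreal (\<Prod>b\<in>Basis. (u - l) \<bullet> b)" .
qed simp

lemma integral_vec_product:
  fixes f :: "complex ^ 'n::finite \<Rightarrow> complex"
  assumes "f \<in> borel_measurable borel"
  shows "integral\<^sup>L lborel f = (\<integral>x. f (\<chi> i. x i) \<partial>Pi\<^sub>M UNIV (\<lambda>_. lborel))"
  by (subst lborel_vec_eq_product, subst integral_distr) (simp_all add: assms measurable_vec_lambda)

lemma integrable_vec_product:
  fixes f :: "complex ^ 'n::finite \<Rightarrow> complex"
  assumes "f \<in> borel_measurable borel"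
  shows "integrable lborel f \<longleftrightarrow> integrable (Pi\<^sub>M UNIV (\<lambda>_. lborel)) (\<lambda>x. f (\<chi> i. x i))"
  by (subst lborel_vec_eq_product, subst integrable_distr_eq) (simp_all add: assms measurable_vec_lambda)

lemma open_polydisc: "open (polydisc :: (complex ^ 'n::finite) set)"
proof -
  have eq: "polydisc = (\<Inter>k. {z :: complex ^ 'n. cmod (z $ k) < 1})" by (auto simp: polydisc_def)
  show ?thesis unfolding eq by (intro open_INT ballI finite open_Collect_less continuous_intros)
qed

text \<open>Cut off outside the polydisc, so that the monomials are members of \<open>bergman\<close> and their integrals over the
polydisc are integrals over the whole space.\<close>

definition mixed_monomial :: "('n::finite \<Rightarrow> nat) \<Rightarrow> ('n \<Rightarrow> nat) \<Rightarrow> complex ^ 'n \<Rightarrow> complex" where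
  "mixed_monomial a b z = (if z \<in> polydisc then monomial_symbol a b z else 0)"

lemma mixed_monomial_measurable[measurable]: "mixed_monomial a b \<in> borel_measurable borel"
proof -
  have "monomial_symbol a b \<in> borel_measurable borel"
    unfolding monomial_symbol_def by (intro borel_measurable_continuous_onI continuous_intros)
  then show ?thesis unfolding mixed_monomial_def[abs_def]
    by (intro measurable_If_set) (auto intro: borel_open open_polydisc)
qed

lemma mixed_monomial_coords:
  "mixed_monomial a b (\<chi> i. x i) = (\<Prod>i\<in>UNIV. indicator (ball 0 1) (x i) * (x i ^ a i * cnj (x i) ^ b i))"
proof (cases "\<forall>i. cmod (x i) < 1")
  case True
  then show ?thesis by (simp add: mixed_monomial_def monomial_symbol_def polydisc_def)
next
  case False
  then obtain i where "\<not> cmod (x i) < 1" by auto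
  then show ?thesis using False
    by (auto simp: mixed_monomial_def polydisc_def indicator_def intro!: prod_zero[symmetric] bexI[of _ i] exI[of _ i])
qed

lemma integrable_mixed_monomial: "integrable lborel (mixed_monomial a b)"
  by (subst integrable_vec_product)
     (auto simp: mixed_monomial_coords intro!: complex_coords.product_integrable_prod integrable_disc_monomial)

text \<open>The squared norm of a monomial.\<close>

definition monomial_weight :: "('n::finite \<Rightarrow> nat) \<Rightarrow> real" where
  "monomial_weight a = (\<Prod>k\<in>UNIV. pi / (real (a k) + 1))"

lemma monomial_weight_pos: "monomial_weight a > 0"
  unfolding monomial_weight_def by (auto intro!: prod_pos)

lemma integral_mixed_monomial:
  "integral\<^sup>L lborel (mixed_monomial a b) = (if a = b then of_real (monomial_weight a) else 0)"
proof -
  have "integral\<^sup>L lborel (mixed_monomial a b) =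
     (\<Prod>i\<in>UNIV. \<integral>x. indicator (ball 0 1) x * (x ^ a i * cnj x ^ b i) \<partial>lborel)"
    by (subst integral_vec_product)
       (auto simp: mixed_monomial_coords intro!: complex_coords.product_integral_prod integrable_disc_monomial)
  also have "\<dots> = (\<Prod>i\<in>UNIV. if a i = b i then of_real (pi / (real (a i) + 1)) else 0)"
    by (intro prod.cong refl) (simp add: integral_disc_monomial)
  also have "\<dots> = (if a = b then of_real (monomial_weight a) else 0)"
  proof (cases "a = b")
    case True
    then show ?thesis by (simp add: monomial_weight_def)
  next
    case False
    then obtain i where "a i \<noteq> b i" by auto
    then show ?thesis using False by (auto intro!: prod_zero)
  qed
  finally show ?thesis .
qed

lemma disc_kernel_bound:
  assumes "cmod w < 1" "cmod z < 1"
  shows "cmod (\<Sum>p<N. of_real ((real p + 1) / pi) * (w * cnj z) ^ p) \<le> 1 / (1 - cmod w) ^ 2 / pi"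
    and "cmod (disc_kernel w z) \<le> 1 / (1 - cmod w) ^ 2 / pi"
proof -
  have s: "(\<lambda>p. (real p + 1) / pi * cmod w ^ p) sums (1 / (1 - cmod w) ^ 2 / pi)"
    using sums_divide[OF geometric_deriv_sums[of "cmod w"], of pi] assms by (simp add: add.commute)
  show *: "cmod (\<Sum>p<N. of_real ((real p + 1) / pi) * (w * cnj z) ^ p) \<le> 1 / (1 - cmod w) ^ 2 / pi" for N
  proof -
    have "cmod (\<Sum>p<N. of_real ((real p + 1) / pi) * (w * cnj z) ^ p)
       \<le> (\<Sum>p<N. (real p + 1) / pi * cmod w ^ p)"
    proof (rule sum_norm_le)
      fix p
      have "cmod (of_real ((real p + 1) / pi) * (w * cnj z) ^ p) = (real p + 1) / pi * (cmod w ^ p * cmod z ^ p)"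
        by (simp only: norm_mult norm_power norm_of_real complex_mod_cnj power_mult_distrib) simp
      also have "\<dots> \<le> (real p + 1) / pi * (cmod w ^ p * 1)"
        using assms by (intro mult_left_mono power_le_one) auto
      finally show "cmod (of_real ((real p + 1) / pi) * (w * cnj z) ^ p) \<le> (real p + 1) / pi * cmod w ^ p" by simp
    qed
    also have "\<dots> \<le> 1 / (1 - cmod w) ^ 2 / pi"
      unfolding sums_unique[OF s] by (rule sum_le_suminf[OF sums_summable[OF s]]) auto
    finally show ?thesis .
  qed
  have "(\<lambda>N. \<Sum>p<N. of_real ((real p + 1) / pi) * (w * cnj z) ^ p) \<longlonglongrightarrow> disc_kernel w z"
    using disc_kernel_sums[OF assms] by (simp add: sums_def)
  from tendsto_norm[OF this] show "cmod (disc_kernel w z) \<le> 1 / (1 - cmod w) ^ 2 / pi"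
    by (rule tendsto_upperbound) (use * in auto)
qed

text \<open>Induction on the set \<open>J\<close> of coordinates that are integrated out, the others being frozen at those of
\<open>w\<close>. By Fubini's theorem almost every slice in a new coordinate \<open>i\<close> is integrable, and there the
one-variable formula replaces the integration by evaluation at \<open>w i\<close>. The same almost everywhere
identity shows that what remains is integrable over \<open>J\<close>, as the induction hypothesis requires.\<close>

lemma separately_holomorphic_reproducing:
  fixes F :: "('n::finite \<Rightarrow> complex) \<Rightarrow> complex"
  assumes hol: "\<And>x i. (\<And>j. j \<noteq> i \<Longrightarrow> cmod (x j) < 1) \<Longrightarrow> (\<lambda>t. F (x(i := t))) holomorphic_on ball 0 1"
    and out: "\<And>x i. \<not> cmod (x i) < 1 \<Longrightarrow> F x = 0"
    and w: "\<And>i. cmod (w i) < 1"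
    and int: "integrable (Pi\<^sub>M J (\<lambda>_. lborel)) (\<lambda>x. F (override_on w x J))"
  shows "(\<integral>x. F (override_on w x J) * (\<Prod>i\<in>J. disc_kernel (w i) (x i)) \<partial>Pi\<^sub>M J (\<lambda>_. lborel)) = F w"
proof -
  have "finite J" by simp
  then show ?thesis using int
  proof (induction J rule: finite_induct)
    case empty
    show ?case by (simp add: PiM_empty lebesgue_integral_count_space_finite)
  next
    case (insert i J)
    let ?M = "\<lambda>_::'n. lborel :: complex measure"
    let ?f = "\<lambda>x. F (override_on w x (insert i J))"
    let ?K = "\<lambda>J x. \<Prod>i\<in>J. disc_kernel (w i) (x i)"
    have upd: "override_on w (x(i := t)) (insert i J) = (override_on w x J)(i := t)" for x t
      using insert(2) by (auto simp: override_on_def fun_eq_iff)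
    have Km: "?K A \<in> borel_measurable (Pi\<^sub>M B ?M)" if AB: "A \<subseteq> B" for A B
    proof (rule borel_measurable_prod)
      fix j assume "j \<in> A"
      with AB have "j \<in> B" by (rule subsetD)
      then have "(\<lambda>x. x j) \<in> measurable (Pi\<^sub>M B ?M) lborel"
        by (rule measurable_component_singleton)
      then have "(\<lambda>x. x j) \<in> measurable (Pi\<^sub>M B ?M) borel" by simp
      then show "(\<lambda>x. disc_kernel (w j) (x j)) \<in> borel_measurable (Pi\<^sub>M B ?M)"
        by (rule measurable_compose[OF _ disc_kernel_measurable])
    qed
    have fm: "?f \<in> borel_measurable (Pi\<^sub>M (insert i J) ?M)" using insert(4) by auto
    \<comment> \<open>For fixed \<open>w\<close> the kernel is bounded where \<open>F\<close> does not vanish, so it does not destroy integrability.\<close>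
    have intK: "integrable (Pi\<^sub>M (insert i J) ?M) (\<lambda>x. ?f x * ?K A x)" if A: "A \<subseteq> insert i J" for A
    proof (rule Bochner_Integration.integrable_bound)
      define C where "C = (\<Prod>j\<in>A. 1 / (1 - cmod (w j)) ^ 2 / pi)"
      show "integrable (Pi\<^sub>M (insert i J) ?M) (\<lambda>x. C * norm (?f x))"
        using insert(4) by simp
      show "(\<lambda>x. ?f x * ?K A x) \<in> borel_measurable (Pi\<^sub>M (insert i J) ?M)"
        by (intro borel_measurable_times fm Km A)
      have "norm (?f x * ?K A x) \<le> norm (C * norm (?f x))" for x
      proof (cases "\<forall>j\<in>insert i J. cmod (x j) < 1")
        case True
        then have "norm (?K A x) \<le> C"
          unfolding C_def prod_norm[symmetric] using A
          by (intro prod_mono conjI norm_ge_zero disc_kernel_bound(2) w) auto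
        then have "norm (?f x) * norm (?K A x) \<le> norm (?f x) * norm C"
          by (intro mult_left_mono) auto
        then show ?thesis by (simp add: norm_mult mult.commute abs_mult)
      next
        case False
        then obtain j where "j \<in> insert i J" "\<not> cmod (x j) < 1" by auto
        then have "?f x = 0" by (intro out[of _ j]) (auto simp: override_on_def)
        then show ?thesis by simp
      qed
      then show "AE x in Pi\<^sub>M (insert i J) ?M. norm (?f x * ?K A x) \<le> norm (C * norm (?f x))" by simp
    qed
    have ins: "(\<lambda>(x, t). x(i := t)) \<in> measurable (Pi\<^sub>M J ?M \<Otimes>\<^sub>M lborel) (Pi\<^sub>M (insert i J) ?M)"
      using measurable_add_dim[of i J ?M] by simp
    interpret J: finite_product_sigma_finite ?M J by standard (rule insert(1))
    interpret P: pair_sigma_finite "Pi\<^sub>M J ?M" "lborel :: complex measure" ..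
    \<comment> \<open>Splitting off the coordinate \<open>i\<close> preserves the product measure.\<close>
    have distr: "distr (Pi\<^sub>M J ?M \<Otimes>\<^sub>M lborel) (Pi\<^sub>M (insert i J) ?M) (\<lambda>(x, t). x(i := t)) = Pi\<^sub>M (insert i J) ?M"
    proof (rule complex_coords.PiM_eqI)
      fix A :: "'n \<Rightarrow> complex set" assume A: "\<And>j. j \<in> insert i J \<Longrightarrow> A j \<in> sets lborel"
      have *: "(\<lambda>(x, t). x(i := t)) -` Pi\<^sub>E (insert i J) A \<inter> space (Pi\<^sub>M J ?M \<Otimes>\<^sub>M lborel) = Pi\<^sub>E J A \<times> A i"
        using insert(2) by (auto simp: space_pair_measure space_PiM PiE_iff extensional_def fun_upd_def split: if_splits)
      have "emeasure (distr (Pi\<^sub>M J ?M \<Otimes>\<^sub>M lborel) (Pi\<^sub>M (insert i J) ?M) (\<lambda>(x, t). x(i := t))) (Pi\<^sub>E (insert i J) A) =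
         emeasure (Pi\<^sub>M J ?M \<Otimes>\<^sub>M lborel) (Pi\<^sub>E J A \<times> A i)"
        using A insert(1) by (subst emeasure_distr[OF ins]) (auto simp: * intro!: sets_PiM_I_finite)
      also have "\<dots> = emeasure (Pi\<^sub>M J ?M) (Pi\<^sub>E J A) * emeasure lborel (A i)"
        using A insert(1) by (intro lborel.emeasure_pair_measure_Times) (auto intro!: sets_PiM_I_finite)
      also have "\<dots> = (\<Prod>j\<in>insert i J. emeasure lborel (A j))"
        using A insert(1,2) by (subst complex_coords.emeasure_PiM) (auto simp: mult.commute)
      finally show "emeasure (distr (Pi\<^sub>M J ?M \<Otimes>\<^sub>M lborel) (Pi\<^sub>M (insert i J) ?M) (\<lambda>(x, t). x(i := t))) (Pi\<^sub>E (insert i J) A) =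
         (\<Prod>j\<in>insert i J. emeasure lborel (A j))" .
    qed (use insert(1) in auto)
    have pair_int: "integrable (Pi\<^sub>M J ?M \<Otimes>\<^sub>M lborel) (\<lambda>(x, t). g (x(i := t)))"
      if "integrable (Pi\<^sub>M (insert i J) ?M) g" for g :: "_ \<Rightarrow> complex"
      using integrable_distr[OF ins, of g, unfolded distr, OF that] by (simp add: case_prod_unfold)
    have slice: "AE x in Pi\<^sub>M J ?M. integrable lborel (\<lambda>t. F ((override_on w x J)(i := t)))"
      using P.AE_integrable_fst'[OF pair_int[OF insert(4)]] by (simp only: upd prod.case)
    have inner: "AE x in Pi\<^sub>M J ?M. (\<integral>t. ?f (x(i := t)) * disc_kernel (w i) t \<partial>lborel) = F (override_on w x J)"
      using slice
    proof eventually_elim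
      case (elim x)
      let ?y = "override_on w x J"
      have "(\<integral>t. F (?y(i := t)) * disc_kernel (w i) t \<partial>lborel) = F (?y(i := w i))"
      proof (rule disc_kernel_reproducing[OF _ elim])
        show "(\<lambda>t. F (?y(i := t))) holomorphic_on ball 0 1"
        proof (cases "\<forall>j. j \<noteq> i \<longrightarrow> cmod (?y j) < 1")
          case False
          then obtain j where j: "j \<noteq> i" "\<not> cmod (?y j) < 1" by auto
          have "F (?y(i := t)) = 0" for t by (rule out[of _ j]) (use j in auto)
          then show ?thesis by simp
        qed (auto intro: hol)
        show "F (?y(i := t)) = 0" if "t \<notin> ball 0 1" for t
          by (rule out[of _ i]) (use that in auto)
      qed (rule w)
      moreover have "?y(i := w i) = ?y" using insert(2) by (auto simp: override_on_def fun_eq_iff)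
      ultimately show ?case by (simp only: upd)
    qed
    have Fm: "(\<lambda>x. F (override_on w x J)) \<in> borel_measurable (Pi\<^sub>M J ?M)"
    proof -
      have "(\<lambda>x. x(i := w i)) \<in> measurable (Pi\<^sub>M J ?M) (Pi\<^sub>M (insert i J) ?M)"
        using measurable_compose[OF measurable_Pair[OF measurable_ident measurable_const[of "w i"]] ins]
        by (simp add: id_def)
      from measurable_compose[OF this fm] have "(\<lambda>x. ?f (x(i := w i))) \<in> borel_measurable (Pi\<^sub>M J ?M)" .
      moreover have "override_on w (x(i := w i)) (insert i J) = override_on w x J" for x
        using insert(2) by (auto simp: override_on_def fun_eq_iff)
      ultimately show ?thesis by simp
    qed
    have "integrable (Pi\<^sub>M J ?M) (\<lambda>x. \<integral>t. ?f (x(i := t)) * disc_kernel (w i) t \<partial>lborel)"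
      using P.integrable_fst'[OF pair_int[OF intK[of "{i}"]]] by simp
    then have intJ: "integrable (Pi\<^sub>M J ?M) (\<lambda>x. F (override_on w x J))"
      by (subst integrable_cong_AE[OF _ _ inner, symmetric]) (auto intro: Fm)
    have Kins: "?K (insert i J) (x(i := t)) = disc_kernel (w i) t * ?K J x" for x t
    proof -
      have "(\<Prod>j\<in>J. disc_kernel (w j) ((x(i := t)) j)) = ?K J x"
        using insert(2) by (intro prod.cong) auto
      then show ?thesis using insert(1,2) by simp
    qed
    have "(\<integral>x. ?f x * ?K (insert i J) x \<partial>Pi\<^sub>M (insert i J) ?M) =
        (\<integral>x. (\<integral>t. ?f (x(i := t)) * ?K (insert i J) (x(i := t)) \<partial>lborel) \<partial>Pi\<^sub>M J ?M)"
      by (rule complex_coords.product_integral_insert[OF insert(1,2) intK[OF order_refl]])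
    also have "\<dots> = (\<integral>x. (\<integral>t. ?f (x(i := t)) * disc_kernel (w i) t \<partial>lborel) * ?K J x \<partial>Pi\<^sub>M J ?M)"
      by (simp only: Kins mult.assoc[symmetric] Bochner_Integration.integral_mult_left_zero)
    also have "\<dots> = (\<integral>x. F (override_on w x J) * ?K J x \<partial>Pi\<^sub>M J ?M)"
    proof (rule integral_cong_AE)
      have "(\<lambda>x. \<integral>t. ?f (x(i := t)) * disc_kernel (w i) t \<partial>lborel) \<in> borel_measurable (Pi\<^sub>M J ?M)"
        using \<open>integrable (Pi\<^sub>M J ?M) (\<lambda>x. \<integral>t. ?f (x(i := t)) * disc_kernel (w i) t \<partial>lborel)\<close> by auto
      then show "(\<lambda>x. (\<integral>t. ?f (x(i := t)) * disc_kernel (w i) t \<partial>lborel) * ?K J x) \<in> borel_measurable (Pi\<^sub>M J ?M)"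
        by (intro borel_measurable_times Km) auto
      show "(\<lambda>x. F (override_on w x J) * ?K J x) \<in> borel_measurable (Pi\<^sub>M J ?M)"
        by (intro borel_measurable_times Fm Km) auto
    qed (use inner in \<open>auto elim: eventually_mono\<close>)
    also have "\<dots> = F w" by (rule insert(3)[OF intJ])
    finally show ?case .
  qed
qed

text \<open>Functions on the polydisc are encoded by extension with \<open>0\<close>, as for \<open>bergman\<close>.\<close>

definition vanishes_off_polydisc :: "(complex ^ 'n::finite \<Rightarrow> complex) \<Rightarrow> bool" where
  "vanishes_off_polydisc f \<longleftrightarrow> (\<forall>z. z \<notin> polydisc \<longrightarrow> f z = 0)"

lemma holomorphic_vec_reproducing:
  fixes f :: "complex ^ 'n::finite \<Rightarrow> complex"
  assumes hol: "holomorphic_vec_on f polydisc" and out: "vanishes_off_polydisc f"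
    and int: "integrable lborel f" and w: "w \<in> polydisc"
  shows "(\<integral>z. f z * (\<Prod>i\<in>UNIV. disc_kernel (w $ i) (z $ i)) \<partial>lborel) = f w"
proof -
  let ?F = "\<lambda>x. f (\<chi> i. x i)"
  have fm: "f \<in> borel_measurable borel" using int by auto
  have "(\<integral>x. ?F (override_on (($) w) x UNIV) * (\<Prod>i\<in>UNIV. disc_kernel (w $ i) (x i)) \<partial>Pi\<^sub>M UNIV (\<lambda>_. lborel)) = ?F (($) w)"
  proof (rule separately_holomorphic_reproducing)
    fix x :: "'n \<Rightarrow> complex" and i assume x: "\<And>j. j \<noteq> i \<Longrightarrow> cmod (x j) < 1"
    let ?p = "\<lambda>t. (\<chi> j. (x(i := t)) j) :: complex ^ 'n"
    show "(\<lambda>t. ?F (x(i := t))) holomorphic_on ball 0 1"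
    proof (rule holomorphic_onI)
      fix t :: complex assume t: "t \<in> ball 0 1"
      have "?p t \<in> polydisc" using x t by (auto simp: polydisc_def)
      then obtain D where D: "(f has_derivative D) (at (?p t))" and lin: "\<And>c v. D (c *s v) = c * D v"
        using hol unfolding holomorphic_vec_on_def by blast
      have p: "(?p has_derivative (\<lambda>h. h *s axis i 1)) (at t)"
      proof -
        have eq: "?p = (\<lambda>t. (\<chi> j. if j = i then 0 else x j) + t *s axis i 1)"
          by (auto simp: fun_eq_iff vec_eq_iff axis_def)
        have "bounded_linear (\<lambda>h. h *s axis i 1 :: complex ^ 'n)"
          by (rule linear_conv_bounded_linear[THEN iffD1], rule linearI)
             (auto simp: vec_eq_iff algebra_simps axis_def)
        from has_derivative_add[OF has_derivative_const bounded_linear_imp_has_derivative[OF this]]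
        show ?thesis unfolding eq by simp
      qed
      have "((\<lambda>t. f (?p t)) has_derivative (\<lambda>h. D (h *s axis i 1))) (at t)"
        using has_derivative_compose[OF p D] by simp
      then have "((\<lambda>t. f (?p t)) has_field_derivative (D (axis i 1))) (at t)"
        by (simp add: has_field_derivative_def lin mult.commute[of _ "D (axis i 1)"])
      then show "(\<lambda>t. ?F (x(i := t))) field_differentiable at t within ball 0 1"
        using field_differentiable_at_within field_differentiable_def by blast
    qed
  next
    fix x :: "'n \<Rightarrow> complex" and i assume "\<not> cmod (x i) < 1"
    then have "(\<chi> i. x i) \<notin> polydisc" by (auto simp: polydisc_def)
    then show "?F x = 0" using out by (auto simp: vanishes_off_polydisc_def)
  next
    show "integrable (Pi\<^sub>M UNIV (\<lambda>_. lborel)) (\<lambda>x. ?F (override_on (($) w) x UNIV))"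
      using int by (simp add: integrable_vec_product[OF fm])
  qed (use w in \<open>auto simp: polydisc_def\<close>)
  moreover have "(\<lambda>z :: complex ^ 'n. f z * (\<Prod>i\<in>UNIV. disc_kernel (w $ i) (z $ i))) \<in> borel_measurable borel"
    by (intro borel_measurable_times fm borel_measurable_prod measurable_compose[OF _ disc_kernel_measurable]
        borel_measurable_continuous_onI continuous_intros)
  ultimately show ?thesis by (simp add: integral_vec_product)
qed

text \<open>Multi-index series are summed along these boxes, because the box sums of a product series are products of
one-variable partial sums.\<close>

definition index_box :: "nat \<Rightarrow> ('n::finite \<Rightarrow> nat) set" where
  "index_box N = {a. \<forall>k. a k < N}"

lemma index_box_PiE: "index_box N = Pi\<^sub>E UNIV (\<lambda>_. {..<N})"
  by (auto simp: index_box_def PiE_def)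

lemma finite_index_box[simp]: "finite (index_box N)"
  by (simp add: index_box_PiE finite_PiE)

text \<open>The product of the kernels is the limit of its box sums, uniformly bounded in \<open>z\<close> for fixed \<open>w\<close>. Putting
these into the reproducing formula expands \<open>f\<close> into monomials whose coefficients are the inner products
of \<open>f\<close> with the monomials. So the monomials are complete: these inner products determine \<open>f\<close>.\<close>

lemma holomorphic_vec_expansion:
  fixes f :: "complex ^ 'n::finite \<Rightarrow> complex"
  assumes hol: "holomorphic_vec_on f polydisc" and out: "vanishes_off_polydisc f"
    and int: "integrable lborel f" and w: "w \<in> polydisc"
  shows "(\<lambda>N. \<Sum>a\<in>index_box N. (\<integral>z. f z * cnj (monomial_symbol a 0 z) \<partial>lborel) / of_real (monomial_weight a)
            * monomial_symbol a 0 w) \<longlonglongrightarrow> f w"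
proof -
  have fm: "f \<in> borel_measurable borel" using int by auto
  have cm: "(\<lambda>z. cnj (monomial_symbol a b z)) \<in> borel_measurable borel" for a b :: "'n \<Rightarrow> nat"
    unfolding monomial_symbol_def by (intro borel_measurable_continuous_onI continuous_intros)
  let ?S = "\<lambda>N z. \<Prod>i\<in>UNIV. \<Sum>p<N. of_real ((real p + 1) / pi) * (w $ i * cnj (z $ i)) ^ p"
  let ?K = "\<lambda>z. \<Prod>i\<in>UNIV. disc_kernel (w $ i) (z $ i)"
  define C where "C = (\<Prod>i\<in>UNIV. 1 / (1 - cmod (w $ i)) ^ 2 / pi)"
  have wi: "cmod (w $ i) < 1" for i using w by (auto simp: polydisc_def)
  have lim: "(\<lambda>N. \<integral>z. f z * ?S N z \<partial>lborel) \<longlonglongrightarrow> (\<integral>z. f z * ?K z \<partial>lborel)"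
  proof (rule integral_dominated_convergence[where w = "\<lambda>z. norm (f z) * C"])
    show "AE z in lborel. (\<lambda>N. f z * ?S N z) \<longlonglongrightarrow> f z * ?K z"
    proof (rule AE_I2)
      fix z
      show "(\<lambda>N. f z * ?S N z) \<longlonglongrightarrow> f z * ?K z"
      proof (cases "z \<in> polydisc")
        case True
        then have "(\<lambda>N. \<Sum>p<N. of_real ((real p + 1) / pi) * (w $ i * cnj (z $ i)) ^ p) \<longlonglongrightarrow> disc_kernel (w $ i) (z $ i)" for i
          using disc_kernel_sums[OF wi[of i], of "z $ i"] unfolding sums_def by (auto simp: polydisc_def)
        then show ?thesis by (intro tendsto_intros)
      qed (use out in \<open>auto simp: vanishes_off_polydisc_def\<close>)
    qed
    show "AE z in lborel. norm (f z * ?S N z) \<le> norm (f z) * C" for N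
    proof (rule AE_I2)
      fix z
      show "norm (f z * ?S N z) \<le> norm (f z) * C"
      proof (cases "z \<in> polydisc")
        case True
        then have "norm (?S N z) \<le> C"
          unfolding C_def prod_norm[symmetric] using wi disc_kernel_bound(1)
          by (intro prod_mono) (auto simp: polydisc_def simp del: of_real_divide)
        then show ?thesis by (simp add: norm_mult mult_left_mono)
      qed (use out in \<open>auto simp: vanishes_off_polydisc_def\<close>)
    qed
    show "integrable lborel (\<lambda>z. norm (f z) * C)" using int by simp
    show "(\<lambda>z. f z * ?K z) \<in> borel_measurable lborel"
      by (simp, intro borel_measurable_times fm borel_measurable_prod measurable_compose[OF _ disc_kernel_measurable]
          borel_measurable_continuous_onI continuous_intros)
    have "?S N \<in> borel_measurable borel" for N
      by (intro borel_measurable_continuous_onI continuous_intros)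
    then show "(\<lambda>z. f z * ?S N z) \<in> borel_measurable lborel" for N
      by (simp, intro borel_measurable_times fm) auto
  qed
  have intm: "integrable lborel (\<lambda>z. f z * cnj (monomial_symbol a 0 z))" for a
  proof (rule Bochner_Integration.integrable_bound[OF int])
    show "(\<lambda>z. f z * cnj (monomial_symbol a 0 z)) \<in> borel_measurable lborel"
      by (simp, intro borel_measurable_times fm cm)
    have "norm (f z * cnj (monomial_symbol a 0 z)) \<le> norm (f z)" for z
    proof (cases "z \<in> polydisc")
      case True
      then have "cmod (monomial_symbol a 0 z) \<le> 1"
        unfolding monomial_symbol_def prod_norm[symmetric]
        by (intro prod_le_1) (auto simp: polydisc_def norm_power less_imp_le intro!: power_le_one)
      then show ?thesis by (simp add: norm_mult mult_left_le)
    qed (use out in \<open>auto simp: vanishes_off_polydisc_def\<close>)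
    then show "AE z in lborel. norm (f z * cnj (monomial_symbol a 0 z)) \<le> norm (f z)" by simp
  qed
  have S: "?S N z = (\<Sum>a\<in>index_box N. cnj (monomial_symbol a 0 z) * (monomial_symbol a 0 w / of_real (monomial_weight a)))" for N z
  proof -
    have "?S N z = (\<Sum>a\<in>index_box N. \<Prod>i\<in>UNIV. of_real ((real (a i) + 1) / pi) * (w $ i * cnj (z $ i)) ^ a i)"
      unfolding index_box_PiE by (rule prod_sum_PiE) auto
    also have "\<dots> = (\<Sum>a\<in>index_box N. cnj (monomial_symbol a 0 z) * (monomial_symbol a 0 w / of_real (monomial_weight a)))"
    proof (rule sum.cong[OF refl])
      fix a :: "'n \<Rightarrow> nat"
      have 1: "cnj (monomial_symbol a 0 z) = (\<Prod>i\<in>UNIV. cnj (z $ i) ^ a i)"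
        and 2: "monomial_symbol a 0 w = (\<Prod>i\<in>UNIV. (w $ i) ^ a i)"
        and 3: "of_real (monomial_weight a) = (\<Prod>i\<in>UNIV. complex_of_real (pi / (real (a i) + 1)))"
        by (simp_all add: monomial_symbol_def monomial_weight_def)
      show "(\<Prod>i\<in>UNIV. of_real ((real (a i) + 1) / pi) * (w $ i * cnj (z $ i)) ^ a i) =
         cnj (monomial_symbol a 0 z) * (monomial_symbol a 0 w / of_real (monomial_weight a))"
        unfolding 1 2 3 prod_dividef[symmetric] prod.distrib[symmetric]
        by (intro prod.cong refl) (simp add: power_mult_distrib)
    qed
    finally show ?thesis .
  qed
  have "(\<integral>z. f z * ?S N z \<partial>lborel) = (\<Sum>a\<in>index_box N. (\<integral>z. f z * cnj (monomial_symbol a 0 z) \<partial>lborel) / of_real (monomial_weight a)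
            * monomial_symbol a 0 w)" for N
  proof -
    have "f z * ?S N z = (\<Sum>a\<in>index_box N. (f z * cnj (monomial_symbol a 0 z)) * (monomial_symbol a 0 w / of_real (monomial_weight a)))" for z
      unfolding S by (simp only: sum_distrib_left mult.assoc)
    then have "(\<integral>z. f z * ?S N z \<partial>lborel) =
       (\<Sum>a\<in>index_box N. \<integral>z. (f z * cnj (monomial_symbol a 0 z)) * (monomial_symbol a 0 w / of_real (monomial_weight a)) \<partial>lborel)"
      by (simp only:) (rule Bochner_Integration.integral_sum, rule Bochner_Integration.integrable_mult_left, rule intm)
    also have "\<dots> = (\<Sum>a\<in>index_box N. (\<integral>z. f z * cnj (monomial_symbol a 0 z) \<partial>lborel) * (monomial_symbol a 0 w / of_real (monomial_weight a)))"
      by (simp only: Bochner_Integration.integral_mult_left_zero)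
    finally show ?thesis by simp
  qed
  with lim show ?thesis by (simp only: holomorphic_vec_reproducing[OF hol out int w])
qed

section \<open>The Hilbert space structure\<close>

lemma polydisc_lebesgue[measurable]: "polydisc \<in> sets (lebesgue :: (complex ^ 'n::finite) measure)"
  by (intro sets_completionI_sets) (simp add: borel_open[OF open_polydisc])

lemma space_polydisc_measure[simp]: "space (polydisc_measure :: (complex ^ 'n::finite) measure) = polydisc"
  by (simp add: space_restrict_space)

lemma borel_measurable_polydisc:
  "f \<in> borel_measurable borel \<Longrightarrow> f \<in> borel_measurable (polydisc_measure :: (complex ^ 'n::finite) measure)"
  by (intro measurable_restrict_space1 measurable_completion) simp

lemma
  fixes f :: "complex ^ 'n::finite \<Rightarrow> 'b::{banach, second_countable_topology}"
  assumes f: "f \<in> borel_measurable borel" and out: "\<And>z. z \<notin> polydisc \<Longrightarrow> f z = 0"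
  shows integrable_polydisc_iff: "integrable polydisc_measure f \<longleftrightarrow> integrable lborel f"
    and integral_polydisc: "integral\<^sup>L polydisc_measure f = integral\<^sup>L lborel f"
proof -
  have eq: "(\<lambda>z. indicator polydisc z *\<^sub>R f z) = f" using out by (auto simp: fun_eq_iff indicator_def)
  show "integrable polydisc_measure f \<longleftrightarrow> integrable lborel f"
    by (subst integrable_restrict_space) (simp_all add: eq integrable_completion f)
  show "integral\<^sup>L polydisc_measure f = integral\<^sup>L lborel f"
    by (subst integral_restrict_space) (simp_all add: eq integral_completion f)
qed

lemma integrable_polydisc_one: "integrable (polydisc_measure :: (complex ^ 'n::finite) measure) (\<lambda>_. 1 :: real)"
proof -
  have "integrable polydisc_measure (mixed_monomial 0 0 :: complex ^ 'n \<Rightarrow> complex)"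
    by (subst integrable_polydisc_iff) (auto simp: integrable_mixed_monomial mixed_monomial_def[of 0 0])
  then have "integrable polydisc_measure (\<lambda>z. norm (mixed_monomial (0 :: 'n \<Rightarrow> nat) 0 z))"
    by (rule integrable_norm)
  then show ?thesis
    by (rule Bochner_Integration.integrable_cong[THEN iffD1, rotated 2])
       (auto simp: mixed_monomial_def monomial_symbol_def)
qed

lemma L2_measurable: "f \<in> L2 \<Longrightarrow> f \<in> borel_measurable polydisc_measure"
  and L2_square: "f \<in> L2 \<Longrightarrow> integrable polydisc_measure (\<lambda>z. (cmod (f z))\<^sup>2)"
  by (auto simp: L2_def)

text \<open>The product is dominated by the sum of the squares; the integrals that define inner products therefore
exist, and the form is additive.\<close>

lemma L2_mult_cnj_integrable:
  assumes "f \<in> L2" "g \<in> L2"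
  shows "integrable polydisc_measure (\<lambda>z. f z * cnj (g z))"
proof (rule Bochner_Integration.integrable_bound)
  show "integrable polydisc_measure (\<lambda>z. (cmod (f z))\<^sup>2 + (cmod (g z))\<^sup>2)"
    using assms by (intro Bochner_Integration.integrable_add L2_square)
  have [measurable]: "f \<in> borel_measurable polydisc_measure" "g \<in> borel_measurable polydisc_measure"
    using assms by (auto intro: L2_measurable)
  have [measurable]: "cnj \<in> borel_measurable borel"
    by (intro borel_measurable_continuous_onI continuous_intros)
  show "(\<lambda>z. f z * cnj (g z)) \<in> borel_measurable polydisc_measure" by measurable
  have "x * y \<le> x\<^sup>2 + y\<^sup>2" if "x \<ge> 0" "y \<ge> 0" for x y :: real
    using sum_squares_bound[of x y] that by (auto intro: order_trans[rotated])
  then show "AE z in polydisc_measure. norm (f z * cnj (g z)) \<le> norm ((cmod (f z))\<^sup>2 + (cmod (g z))\<^sup>2)"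
    by (simp add: norm_mult)
qed

lemma L2_add: assumes "f \<in> L2" "g \<in> L2" shows "f + g \<in> L2"
proof -
  have [measurable]: "f \<in> borel_measurable polydisc_measure" "g \<in> borel_measurable polydisc_measure"
    using assms by (auto intro: L2_measurable)
  have "integrable polydisc_measure (\<lambda>z. (cmod (f z + g z))\<^sup>2)"
  proof (rule Bochner_Integration.integrable_bound)
    show "integrable polydisc_measure (\<lambda>z. 2 * (cmod (f z))\<^sup>2 + 2 * (cmod (g z))\<^sup>2)"
      using assms by (intro Bochner_Integration.integrable_add Bochner_Integration.integrable_mult_right L2_square)
    have "(cmod (a + b))\<^sup>2 \<le> 2 * (cmod a)\<^sup>2 + 2 * (cmod b)\<^sup>2" for a b
    proof -
      have "(cmod (a + b))\<^sup>2 \<le> (cmod a + cmod b)\<^sup>2" by (intro power_mono norm_triangle_ineq) simp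
      also have "\<dots> \<le> 2 * (cmod a)\<^sup>2 + 2 * (cmod b)\<^sup>2"
        using sum_squares_bound[of "cmod a" "cmod b"] by (simp add: power2_sum)
      finally show ?thesis .
    qed
    then show "AE z in polydisc_measure. norm ((cmod (f z + g z))\<^sup>2) \<le> norm (2 * (cmod (f z))\<^sup>2 + 2 * (cmod (g z))\<^sup>2)"
      by simp
  qed measurable
  then show ?thesis by (simp add: L2_def plus_fun_def)
qed

lemma L2_mult_bounded:
  assumes "f \<in> L2" and [measurable]: "\<phi> \<in> borel_measurable polydisc_measure"
    and B: "\<And>z. z \<in> polydisc \<Longrightarrow> cmod (\<phi> z) \<le> B"
  shows "\<phi> * f \<in> L2"
proof -
  have [measurable]: "f \<in> borel_measurable polydisc_measure" using assms by (auto intro: L2_measurable)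
  have "integrable polydisc_measure (\<lambda>z. (cmod (\<phi> z * f z))\<^sup>2)"
  proof (rule Bochner_Integration.integrable_bound)
    show "integrable polydisc_measure (\<lambda>z. B\<^sup>2 * (cmod (f z))\<^sup>2)"
      using assms by (intro Bochner_Integration.integrable_mult_right L2_square)
    show "AE z in polydisc_measure. norm ((cmod (\<phi> z * f z))\<^sup>2) \<le> norm (B\<^sup>2 * (cmod (f z))\<^sup>2)"
      by (rule AE_I2) (auto simp: norm_mult power_mult_distrib intro!: mult_right_mono power_mono B)
  qed measurable
  then show ?thesis by (simp add: L2_def times_fun_def)
qed

lemma L2_fscale: "f \<in> L2 \<Longrightarrow> fscale c f \<in> L2"
  using L2_mult_bounded[of f "\<lambda>_. c" "cmod c"] by (simp add: fscale_def times_fun_def)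

lemma fun_diff_fscale: "f - g = f + fscale (- 1) g"
  by (auto simp: fscale_def fun_eq_iff)

lemma L2_diff: "f \<in> L2 \<Longrightarrow> g \<in> L2 \<Longrightarrow> f - g \<in> L2"
  unfolding fun_diff_fscale by (intro L2_add L2_fscale)

lemma L2_zero: "0 \<in> L2"
  by (simp add: L2_def zero_fun_def)

lemma L2_sum: "(\<And>i. i \<in> I \<Longrightarrow> f i \<in> L2) \<Longrightarrow> sum f I \<in> L2"
  by (induction I rule: infinite_finite_induct) (auto intro: L2_add L2_zero)

lemma l2_inner_add_left: "f \<in> L2 \<Longrightarrow> g \<in> L2 \<Longrightarrow> h \<in> L2 \<Longrightarrow> l2_inner (f + g) h = l2_inner f h + l2_inner g h"
  unfolding l2_inner_def
  by (subst Bochner_Integration.integral_add[symmetric]) (auto intro: L2_mult_cnj_integrable simp: distrib_right)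

lemma l2_inner_fscale_left: "l2_inner (fscale c f) h = c * l2_inner f h"
  by (simp add: l2_inner_def fscale_def mult.assoc)

lemma l2_inner_commute: "l2_inner g f = cnj (l2_inner f g)"
  unfolding l2_inner_def by (subst Bochner_Integration.integral_cnj[symmetric]) (simp add: mult.commute)

lemma l2_inner_fscale_right: "l2_inner f (fscale c g) = cnj c * l2_inner f g"
  by (subst (1 2) l2_inner_commute) (simp add: l2_inner_fscale_left)

lemma l2_inner_diff_left: "f \<in> L2 \<Longrightarrow> g \<in> L2 \<Longrightarrow> h \<in> L2 \<Longrightarrow> l2_inner (f - g) h = l2_inner f h - l2_inner g h"
  unfolding fun_diff_fscale by (simp add: l2_inner_add_left L2_fscale l2_inner_fscale_left)

lemma l2_inner_diff_right: "f \<in> L2 \<Longrightarrow> g \<in> L2 \<Longrightarrow> h \<in> L2 \<Longrightarrow> l2_inner h (f - g) = l2_inner h f - l2_inner h g"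
  by (subst (1 2 3) l2_inner_commute) (simp add: l2_inner_diff_left)

lemma l2_inner_zero[simp]: "l2_inner 0 h = 0" "l2_inner h 0 = 0"
  by (simp_all add: l2_inner_def)

lemma l2_inner_sum_left:
  "(\<And>i. i \<in> I \<Longrightarrow> f i \<in> L2) \<Longrightarrow> h \<in> L2 \<Longrightarrow> l2_inner (sum f I) h = (\<Sum>i\<in>I. l2_inner (f i) h)"
  by (induction I rule: infinite_finite_induct) (auto simp: l2_inner_add_left L2_sum)

lemma l2_inner_sum_right:
  "(\<And>i. i \<in> I \<Longrightarrow> f i \<in> L2) \<Longrightarrow> h \<in> L2 \<Longrightarrow> l2_inner h (sum f I) = (\<Sum>i\<in>I. l2_inner h (f i))"
  by (subst l2_inner_commute, subst l2_inner_sum_left) (auto intro!: sum.cong l2_inner_commute[symmetric])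

lemma l2_inner_mult_left: "l2_inner (\<phi> * f) g = l2_inner f ((\<lambda>z. cnj (\<phi> z)) * g)"
  by (simp add: l2_inner_def times_fun_def mult_ac)

lemma l2_inner_cong:
  "(\<And>z. z \<in> polydisc \<Longrightarrow> f z = f' z) \<Longrightarrow> (\<And>z. z \<in> polydisc \<Longrightarrow> g z = g' z) \<Longrightarrow> l2_inner f g = l2_inner f' g'"
  unfolding l2_inner_def by (intro Bochner_Integration.integral_cong) auto

lemma l2_norm_nonneg: "l2_norm f \<ge> 0"
  by (simp add: l2_norm_def)

lemma l2_norm_square: "(l2_norm f)\<^sup>2 = (LINT z|polydisc_measure. (cmod (f z))\<^sup>2)"
  by (simp add: l2_norm_def)

lemma l2_inner_self: "l2_inner f f = of_real ((l2_norm f)\<^sup>2)"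
  unfolding l2_inner_def l2_norm_square integral_complex_of_real[symmetric]
  by (simp add: complex_norm_square[symmetric])

lemma l2_norm_fscale: "l2_norm (fscale c f) = cmod c * l2_norm f"
  by (simp add: l2_norm_def fscale_def norm_mult power_mult_distrib real_sqrt_mult)

lemma l2_norm_diff_square:
  assumes "f \<in> L2" "g \<in> L2"
  shows "(l2_norm (f - g))\<^sup>2 = (l2_norm f)\<^sup>2 - 2 * Re (l2_inner f g) + (l2_norm g)\<^sup>2"
proof -
  have "of_real ((l2_norm (f - g))\<^sup>2) = l2_inner f f - l2_inner f g - (cnj (l2_inner f g) - l2_inner g g)"
    unfolding l2_inner_self[symmetric] using assms by (simp add: l2_inner_diff_left l2_inner_diff_right L2_diff l2_inner_commute[of g f])
  then have "Re (of_real ((l2_norm (f - g))\<^sup>2)) = Re (l2_inner f f - l2_inner f g - (cnj (l2_inner f g) - l2_inner g g))"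
    by (simp only:)
  then show ?thesis by (simp add: l2_inner_self)
qed

text \<open>The squared distance from \<open>f\<close> to the multiples \<open>s * c\<close> of \<open>g\<close>, where \<open>c\<close> is the inner product of \<open>f\<close> and
\<open>g\<close> and \<open>s\<close> is real, is a nonnegative quadratic polynomial in \<open>s\<close>.\<close>

lemma l2_Cauchy_Schwarz:
  assumes f: "f \<in> L2" and g: "g \<in> L2"
  shows "cmod (l2_inner f g) \<le> l2_norm f * l2_norm g"
proof (cases "l2_inner f g = 0")
  case True
  then show ?thesis by (simp add: l2_norm_nonneg)
next
  case False
  define c where "c = l2_inner f g"
  define n where "n = (cmod c)\<^sup>2"
  have n: "n > 0" using False by (simp add: n_def c_def)
  have q: "0 \<le> (l2_norm f)\<^sup>2 - 2 * (s * n) + s\<^sup>2 * (n * (l2_norm g)\<^sup>2)" for s :: real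
  proof -
    have "0 \<le> (l2_norm (f - fscale (of_real s * c) g))\<^sup>2" by simp
    also have "\<dots> = (l2_norm f)\<^sup>2 - 2 * Re (cnj (of_real s * c) * c) + (cmod (of_real s * c) * l2_norm g)\<^sup>2"
      using f g by (simp only: l2_norm_diff_square L2_fscale l2_inner_fscale_right l2_norm_fscale c_def)
    also have "Re (cnj (of_real s * c) * c) = s * n"
      by (simp add: n_def cmod_power2) (simp add: power2_eq_square algebra_simps)
    finally show ?thesis by (simp add: norm_mult power_mult_distrib n_def)
  qed
  have g0: "l2_norm g \<noteq> 0"
  proof
    assume "l2_norm g = 0"
    \<comment> \<open>If \<open>g\<close> had norm zero, the polynomial would be linear with negative slope; this \<open>s\<close> makes it negative.\<close>
    then show False using q[of "((l2_norm f)\<^sup>2 + 1) / n"] n by (simp add: add_nonneg_pos) (smt (verit) zero_le_power2)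
  qed
  have "0 \<le> (l2_norm f)\<^sup>2 - n / (l2_norm g)\<^sup>2"
    using q[of "1 / (l2_norm g)\<^sup>2"] g0 by (simp add: power2_eq_square)
  then have "n \<le> (l2_norm f)\<^sup>2 * (l2_norm g)\<^sup>2"
    using g0 by (simp add: pos_divide_le_eq)
  then have "(cmod c)\<^sup>2 \<le> (l2_norm f * l2_norm g)\<^sup>2" by (simp add: n_def power_mult_distrib)
  then show ?thesis unfolding c_def
    by (rule power2_le_imp_le) (simp add: l2_norm_nonneg)
qed

text \<open>Limits of power series are shown to lie in \<open>L2\<close> by this: their partial sums converge pointwise and are bounded
in norm.\<close>

lemma l2_Fatou:
  assumes u: "\<And>N. u N \<in> L2" and lim: "\<And>z. z \<in> polydisc \<Longrightarrow> (\<lambda>N. u N z) \<longlonglongrightarrow> v z"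
    and bound: "\<And>N. (l2_norm (u N))\<^sup>2 \<le> C"
  shows "v \<in> L2" "(l2_norm v)\<^sup>2 \<le> C"
proof -
  have [measurable]: "u N \<in> borel_measurable polydisc_measure" for N using u by (auto intro: L2_measurable)
  have vm[measurable]: "v \<in> borel_measurable polydisc_measure"
    by (rule borel_measurable_LIMSEQ_metric[where f = u]) (auto intro: lim)
  have C: "C \<ge> 0" using order_trans[OF zero_le_power2 bound] .
  have "(\<integral>\<^sup>+z. ennreal ((cmod (v z))\<^sup>2) \<partial>polydisc_measure) =
        (\<integral>\<^sup>+z. liminf (\<lambda>N. ennreal ((cmod (u N z))\<^sup>2)) \<partial>polydisc_measure)"
  proof (rule nn_integral_cong)
    fix z :: "complex ^ 'a" assume "z \<in> space polydisc_measure"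
    then have "(\<lambda>N. ennreal ((cmod (u N z))\<^sup>2)) \<longlonglongrightarrow> ennreal ((cmod (v z))\<^sup>2)"
      by (intro tendsto_ennrealI tendsto_intros lim) simp
    then show "ennreal ((cmod (v z))\<^sup>2) = liminf (\<lambda>N. ennreal ((cmod (u N z))\<^sup>2))"
      using lim_imp_Liminf[OF sequentially_bot] by metis
  qed
  also have "\<dots> \<le> liminf (\<lambda>N. \<integral>\<^sup>+z. ennreal ((cmod (u N z))\<^sup>2) \<partial>polydisc_measure)"
    by (rule nn_integral_liminf) measurable
  also have "\<dots> \<le> liminf (\<lambda>N. ennreal C)"
  proof (rule Liminf_mono, rule always_eventually, rule allI)
    fix N
    have "(\<integral>\<^sup>+z. ennreal ((cmod (u N z))\<^sup>2) \<partial>polydisc_measure) = ennreal ((l2_norm (u N))\<^sup>2)"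
      unfolding l2_norm_square by (rule nn_integral_eq_integral) (auto intro: L2_square u)
    then show "(\<integral>\<^sup>+z. ennreal ((cmod (u N z))\<^sup>2) \<partial>polydisc_measure) \<le> ennreal C"
      using bound by (simp add: ennreal_leI)
  qed
  also have "\<dots> = ennreal C" by (simp add: Liminf_const)
  finally have le: "(\<integral>\<^sup>+z. ennreal ((cmod (v z))\<^sup>2) \<partial>polydisc_measure) \<le> ennreal C" .
  have int: "integrable polydisc_measure (\<lambda>z. (cmod (v z))\<^sup>2)"
    by (rule integrableI_nonneg) (use le in \<open>auto simp: top_unique less_top[symmetric]\<close>)
  then show "v \<in> L2" using vm by (simp add: L2_def)
  have "ennreal ((l2_norm v)\<^sup>2) \<le> ennreal C"
    using le nn_integral_eq_integral[OF int] unfolding l2_norm_square by simp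
  then show "(l2_norm v)\<^sup>2 \<le> C" using C by simp
qed

lemma L2_integrable:
  assumes "f \<in> L2" shows "integrable polydisc_measure f"
proof (rule Bochner_Integration.integrable_bound)
  show "integrable polydisc_measure (\<lambda>z. 1 + (cmod (f z))\<^sup>2)"
    using assms by (intro Bochner_Integration.integrable_add integrable_polydisc_one L2_square)
  show "f \<in> borel_measurable polydisc_measure" using assms by (rule L2_measurable)
  have "x \<le> 1 + x\<^sup>2" if "x \<ge> 0" for x :: real
    using sum_squares_bound[of x 1] that by auto
  then show "AE z in polydisc_measure. norm (f z) \<le> norm (1 + (cmod (f z))\<^sup>2)" by simp
qed


section \<open>Monomials and power series in the Bergman space\<close>

abbreviation monomial :: "('n::finite \<Rightarrow> nat) \<Rightarrow> complex ^ 'n \<Rightarrow> complex" where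
  "monomial a \<equiv> mixed_monomial a 0"

text \<open>Not normalised: the coefficient of \<open>f\<close> at the monomial \<open>a\<close> is \<open>coef f a\<close> divided by the weight of \<open>a\<close>.\<close>

abbreviation coef :: "(complex ^ 'n::finite \<Rightarrow> complex) \<Rightarrow> ('n \<Rightarrow> nat) \<Rightarrow> complex" where
  "coef f a \<equiv> l2_inner f (monomial a)"

lemma mixed_monomial_L2: "mixed_monomial a b \<in> L2"
proof -
  have 1: "(\<lambda>_. 1) \<in> L2"
    using integrable_polydisc_one by (simp add: L2_def)
  have "cmod (mixed_monomial a b z) \<le> 1" if "z \<in> polydisc" for z
    using that unfolding mixed_monomial_def monomial_symbol_def
    by (auto simp: prod_norm[symmetric] norm_mult norm_power polydisc_def less_imp_le
        intro!: prod_le_1 mult_le_one power_le_one)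
  from L2_mult_bounded[OF 1 borel_measurable_polydisc[OF mixed_monomial_measurable] this]
  show ?thesis by (simp add: times_fun_def)
qed

lemma mixed_monomial_mult_cnj:
  "mixed_monomial a b z * cnj (mixed_monomial c d z) = mixed_monomial (a + d) (b + c) z"
  by (simp add: mixed_monomial_def monomial_symbol_def power_add prod.distrib mult_ac)

lemma l2_inner_mixed_monomial:
  "l2_inner (mixed_monomial a b) (mixed_monomial c d) =
     (if a + d = b + c then of_real (monomial_weight (a + d)) else 0)"
  unfolding l2_inner_def mixed_monomial_mult_cnj
  by (subst integral_polydisc) (auto simp: integral_mixed_monomial mixed_monomial_def)

lemma coef_monomial: "coef (monomial a) b = (if a = b then of_real (monomial_weight a) else 0)"
  using l2_inner_mixed_monomial[of a 0 b 0] by simp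

lemma l2_norm_monomial: "(l2_norm (monomial a))\<^sup>2 = monomial_weight a"
proof -
  have "complex_of_real ((l2_norm (monomial a))\<^sup>2) = of_real (monomial_weight a)"
    by (simp only: l2_inner_self[symmetric] coef_monomial) simp
  then show ?thesis by (simp only: of_real_eq_iff)
qed

definition monomial_partial :: "('n::finite \<Rightarrow> nat) \<Rightarrow> 'n \<Rightarrow> complex ^ 'n \<Rightarrow> complex" where
  "monomial_partial a j z = of_nat (a j) * (z $ j) ^ (a j - 1) * (\<Prod>k\<in>UNIV - {j}. (z $ k) ^ a k)"

lemma monomial_symbol_has_derivative:
  "(monomial_symbol a 0 has_derivative (\<lambda>h. \<Sum>j\<in>UNIV. h $ j * monomial_partial a j z)) (at z within S)"
proof -
  have "((\<lambda>z. \<Prod>k\<in>UNIV. (z $ k) ^ a k) has_derivative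
     (\<lambda>h. \<Sum>j\<in>UNIV. (of_nat (a j) * h $ j * (z $ j) ^ (a j - 1)) * (\<Prod>k\<in>UNIV - {j}. (z $ k) ^ a k))) (at z within S)"
    by (intro has_derivative_prod has_derivative_power bounded_linear_imp_has_derivative bounded_linear_vec_nth)
  then show ?thesis by (simp add: monomial_partial_def monomial_symbol_def[abs_def] mult_ac)
qed

lemma bergman_L2: "f \<in> bergman \<Longrightarrow> f \<in> L2"
  and bergman_holomorphic: "f \<in> bergman \<Longrightarrow> holomorphic_vec_on f polydisc"
  and bergman_outside: "f \<in> bergman \<Longrightarrow> z \<notin> polydisc \<Longrightarrow> f z = 0"
  by (auto simp: bergman_def)

lemma bergman_add: "f \<in> bergman \<Longrightarrow> g \<in> bergman \<Longrightarrow> f + g \<in> bergman"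
proof -
  assume f: "f \<in> bergman" and g: "g \<in> bergman"
  have "holomorphic_vec_on (f + g) polydisc"
    unfolding holomorphic_vec_on_def
  proof
    fix z :: "complex ^ 'a" assume z: "z \<in> polydisc"
    obtain D where D: "(f has_derivative D) (at z)" "\<forall>c v. D (c *s v) = c * D v"
      using bergman_holomorphic[OF f] z unfolding holomorphic_vec_on_def by blast
    obtain E where E: "(g has_derivative E) (at z)" "\<forall>c v. E (c *s v) = c * E v"
      using bergman_holomorphic[OF g] z unfolding holomorphic_vec_on_def by blast
    have "(f + g has_derivative (\<lambda>v. D v + E v)) (at z)"
      unfolding plus_fun_def by (intro has_derivative_add D E)
    moreover have "\<forall>c v. D (c *s v) + E (c *s v) = c * (D v + E v)"
      using D E by (simp add: distrib_left)
    ultimately show "\<exists>D. (f + g has_derivative D) (at z) \<and> (\<forall>c v. D (c *s v) = c * D v)" by blast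
  qed
  then show ?thesis using f g by (auto simp: bergman_def L2_add)
qed

lemma bergman_fscale: "f \<in> bergman \<Longrightarrow> fscale c f \<in> bergman"
proof -
  assume f: "f \<in> bergman"
  have "holomorphic_vec_on (fscale c f) polydisc"
    unfolding holomorphic_vec_on_def
  proof
    fix z :: "complex ^ 'a" assume z: "z \<in> polydisc"
    obtain D where D: "(f has_derivative D) (at z)" "\<forall>c v. D (c *s v) = c * D v"
      using bergman_holomorphic[OF f] z unfolding holomorphic_vec_on_def by blast
    have "(fscale c f has_derivative (\<lambda>v. c * D v)) (at z)"
      unfolding fscale_def by (intro has_derivative_mult_right D)
    moreover have "\<forall>d v. c * D (d *s v) = d * (c * D v)" using D by simp
    ultimately show "\<exists>D. (fscale c f has_derivative D) (at z) \<and> (\<forall>c v. D (c *s v) = c * D v)" by blast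
  qed
  then show ?thesis using f by (auto simp: bergman_def L2_fscale) (simp add: fscale_def)
qed

lemma bergman_diff: "f \<in> bergman \<Longrightarrow> g \<in> bergman \<Longrightarrow> f - g \<in> bergman"
  unfolding fun_diff_fscale by (intro bergman_add bergman_fscale)

text \<open>A derivative written through partial derivatives, as here, is complex linear.\<close>

lemma bergmanI_holomorphic:
  assumes "F \<in> L2" and out: "\<And>z. z \<notin> polydisc \<Longrightarrow> F z = 0"
    and der: "\<And>z. z \<in> polydisc \<Longrightarrow> (F has_derivative (\<lambda>h. \<Sum>j\<in>UNIV. h $ j * p z j)) (at z)"
  shows "F \<in> bergman"
  unfolding bergman_def holomorphic_vec_on_def
proof (intro CollectI conjI ballI allI impI)
  fix z :: "complex ^ 'a" assume "z \<in> polydisc"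
  from der[OF this] show "\<exists>D. (F has_derivative D) (at z) \<and> (\<forall>c v. D (c *s v) = c * D v)"
    by (intro exI[of _ "\<lambda>h. \<Sum>j\<in>UNIV. h $ j * p z j"] conjI) (auto simp: sum_distrib_left mult.assoc)
qed (use assms in auto)

lemma monomial_bergman: "monomial a \<in> bergman"
proof (rule bergmanI_holomorphic[OF mixed_monomial_L2])
  fix z :: "complex ^ 'a" assume z: "z \<in> polydisc"
  show "(monomial a has_derivative (\<lambda>h. \<Sum>j\<in>UNIV. h $ j * monomial_partial a j z)) (at z)"
    by (rule has_derivative_transform_within_open[OF monomial_symbol_has_derivative open_polydisc z])
       (simp add: mixed_monomial_def)
qed (simp add: mixed_monomial_def)

lemma bergman_borel_measurable: assumes f: "f \<in> bergman" shows "f \<in> borel_measurable borel"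
proof -
  have "continuous_on polydisc f"
  proof (rule continuous_at_imp_continuous_on, rule ballI)
    fix z :: "complex ^ 'a" assume "z \<in> polydisc"
    then show "isCont f z"
      using bergman_holomorphic[OF f] has_derivative_continuous unfolding holomorphic_vec_on_def by blast
  qed
  then have "(\<lambda>z. if z \<in> polydisc then f z else 0) \<in> borel_measurable borel"
    by (intro borel_measurable_continuous_on_if borel_open open_polydisc continuous_intros)
  also have "(\<lambda>z. if z \<in> polydisc then f z else 0) = f"
    using bergman_outside[OF f] by auto
  finally show ?thesis .
qed

lemma bergman_expansion:
  assumes f: "f \<in> bergman" and w: "w \<in> polydisc"
  shows "(\<lambda>N. \<Sum>a\<in>index_box N. coef f a / of_real (monomial_weight a) * monomial a w) \<longlonglongrightarrow> f w"
proof -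
  note fm = bergman_borel_measurable[OF f]
  have int: "integrable lborel f"
    using L2_integrable[OF bergman_L2[OF f]] integrable_polydisc_iff[OF fm bergman_outside[OF f]] by simp
  have cm: "(\<lambda>z. cnj (monomial_symbol a 0 z)) \<in> borel_measurable borel" for a :: "'a \<Rightarrow> nat"
    unfolding monomial_symbol_def by (intro borel_measurable_continuous_onI continuous_intros)
  have "(\<integral>z. f z * cnj (monomial_symbol a 0 z) \<partial>lborel) = coef f a" for a
  proof -
    have "coef f a = (\<integral>z. f z * cnj (monomial_symbol a 0 z) \<partial>polydisc_measure)"
      unfolding l2_inner_def by (intro Bochner_Integration.integral_cong) (auto simp: mixed_monomial_def)
    also have "\<dots> = (\<integral>z. f z * cnj (monomial_symbol a 0 z) \<partial>lborel)"
      by (intro integral_polydisc borel_measurable_times fm cm) (simp add: bergman_outside[OF f])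
    finally show ?thesis by simp
  qed
  then show ?thesis
    using holomorphic_vec_expansion[OF bergman_holomorphic[OF f] _ int w] bergman_outside[OF f] w
    by (simp add: vanishes_off_polydisc_def mixed_monomial_def)
qed

text \<open>Completeness of the monomials. Every identity between elements of \<open>bergman\<close> below is checked on
coefficients.\<close>

lemma bergman_eqI:
  assumes f: "f \<in> bergman" and g: "g \<in> bergman" and eq: "\<And>a. coef f a = coef g a"
  shows "f = g"
proof
  fix z
  show "f z = g z"
  proof (cases "z \<in> polydisc")
    case True
    show ?thesis
      using bergman_expansion[OF f True] bergman_expansion[OF g True] unfolding eq by (rule LIMSEQ_unique)
  qed (simp add: bergman_outside[OF f] bergman_outside[OF g])
qed

definition monomial_sum :: "(('n::finite \<Rightarrow> nat) \<Rightarrow> complex) \<Rightarrow> ('n \<Rightarrow> nat) set \<Rightarrow> complex ^ 'n \<Rightarrow> complex" where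
  "monomial_sum c A = (\<Sum>a\<in>A. fscale (c a) (monomial a))"

lemma sum_fun_apply: "sum f A z = (\<Sum>a\<in>A. f a z)"
  by (induction A rule: infinite_finite_induct) auto

lemma monomial_sum_apply: "monomial_sum c A z = (\<Sum>a\<in>A. c a * monomial a z)"
  by (simp add: monomial_sum_def sum_fun_apply fscale_def)

lemma monomial_sum_L2: "monomial_sum c A \<in> L2"
  unfolding monomial_sum_def by (intro L2_sum L2_fscale mixed_monomial_L2)

lemma inner_monomial_sum_right:
  "f \<in> L2 \<Longrightarrow> l2_inner f (monomial_sum c A) = (\<Sum>a\<in>A. cnj (c a) * coef f a)"
  unfolding monomial_sum_def
  by (subst l2_inner_sum_right) (auto intro: L2_fscale mixed_monomial_L2 simp: l2_inner_fscale_right)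

lemma coef_monomial_sum:
  assumes "finite A"
  shows "coef (monomial_sum c A) b = (if b \<in> A then c b * of_real (monomial_weight b) else 0)"
proof -
  have "coef (monomial_sum c A) b = (\<Sum>a\<in>A. c a * coef (monomial a) b)"
    unfolding monomial_sum_def
    by (subst l2_inner_sum_left) (auto intro: L2_fscale mixed_monomial_L2 simp: l2_inner_fscale_left)
  also have "\<dots> = (\<Sum>a\<in>A. if a = b then c b * of_real (monomial_weight b) else 0)"
    by (intro sum.cong refl) (simp add: coef_monomial)
  finally show ?thesis using assms by simp
qed

lemma l2_norm_monomial_sum:
  assumes "finite A"
  shows "(l2_norm (monomial_sum c A))\<^sup>2 = (\<Sum>a\<in>A. (cmod (c a))\<^sup>2 * monomial_weight a)"
proof -
  have "complex_of_real ((l2_norm (monomial_sum c A))\<^sup>2) = (\<Sum>a\<in>A. cnj (c a) * (c a * of_real (monomial_weight a)))"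
    unfolding l2_inner_self[symmetric]
    by (subst inner_monomial_sum_right) (auto intro!: monomial_sum_L2 sum.cong simp: coef_monomial_sum assms)
  also have "\<dots> = of_real (\<Sum>a\<in>A. (cmod (c a))\<^sup>2 * monomial_weight a)"
    unfolding of_real_sum
    by (intro sum.cong refl) (simp only: of_real_mult complex_norm_square mult_ac)
  finally show ?thesis by (simp only: of_real_eq_iff)
qed

text \<open>The squared distance from \<open>f\<close> to its partial sum is nonnegative.\<close>

lemma Bessel_inequality:
  assumes f: "f \<in> L2" and A: "finite A"
  shows "(\<Sum>a\<in>A. (cmod (coef f a / of_real (monomial_weight a)))\<^sup>2 * monomial_weight a) \<le> (l2_norm f)\<^sup>2"
proof -
  let ?c = "\<lambda>a. coef f a / of_real (monomial_weight a)"
  let ?s = "\<Sum>a\<in>A. (cmod (?c a))\<^sup>2 * monomial_weight a"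
  have "l2_inner f (monomial_sum ?c A) = (\<Sum>a\<in>A. cnj (?c a) * coef f a)"
    by (rule inner_monomial_sum_right[OF f])
  also have "\<dots> = of_real ?s"
  proof (simp only: of_real_sum, intro sum.cong refl)
    fix a
    have "coef f a = ?c a * of_real (monomial_weight a)" using monomial_weight_pos[of a] by simp
    then have "cnj (?c a) * coef f a = (?c a * cnj (?c a)) * of_real (monomial_weight a)" by (metis mult.assoc mult.commute)
    then show "cnj (?c a) * coef f a = of_real ((cmod (?c a))\<^sup>2 * monomial_weight a)"
      by (simp only: complex_norm_square[symmetric] of_real_mult of_real_power)
  qed
  finally have i: "l2_inner f (monomial_sum ?c A) = of_real ?s" .
  have "0 \<le> (l2_norm (f - monomial_sum ?c A))\<^sup>2" by simp
  also have "\<dots> = (l2_norm f)\<^sup>2 - ?s"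
    by (simp only: l2_norm_diff_square[OF f monomial_sum_L2] i l2_norm_monomial_sum[OF A] Re_complex_of_real)
  finally show ?thesis by simp
qed

lemma index_box_mono: "M \<le> N \<Longrightarrow> index_box M \<subseteq> index_box N"
  by (auto simp: index_box_def intro: less_le_trans)

lemma finite_subset_index_box:
  fixes X :: "('n::finite \<Rightarrow> nat) set"
  assumes X: "finite X"
  shows "\<exists>N. X \<subseteq> index_box N"
proof -
  define N where "N = Suc (Max (insert 0 ((\<lambda>(a, k). a k) ` (X \<times> UNIV))))"
  have "a k < N" if "a \<in> X" for a k
    unfolding N_def less_Suc_eq_le using X that by (intro Max_ge) auto
  then have "X \<subseteq> index_box N" by (auto simp: index_box_def)
  then show ?thesis ..
qed

lemma filterlim_index_box: "filterlim index_box (finite_subsets_at_top (UNIV :: ('n::finite \<Rightarrow> nat) set)) sequentially"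
  unfolding filterlim_finite_subsets_at_top
proof (intro allI impI)
  fix X :: "('n \<Rightarrow> nat) set" assume "finite X \<and> X \<subseteq> UNIV"
  then obtain N where N: "X \<subseteq> index_box N" using finite_subset_index_box[of X] by auto
  show "\<forall>\<^sub>F N in sequentially. finite (index_box N) \<and> X \<subseteq> index_box N \<and> index_box N \<subseteq> UNIV"
    using order_trans[OF N index_box_mono] by (intro eventually_sequentiallyI[of N]) simp
qed

text \<open>Comparison with the second derivative of the geometric series.\<close>

lemma summable_square_geometric:
  fixes r :: real
  assumes "0 < r" "r < 1"
  shows "summable (\<lambda>p. (real p + 1)\<^sup>2 * r ^ p)"
proof -
  have s: "summable (\<lambda>n. diffs (\<lambda>_. 1) n * x ^ n)" if "norm x < 1" for x :: real
    by (rule termdiff_converges[where K = 1]) (use that in auto)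
  have "summable (\<lambda>n. diffs (diffs (\<lambda>_. 1)) n * r ^ n)"
    by (rule termdiff_converges[where K = 1]) (use assms s in auto)
  then have "summable (\<lambda>n. (real n + 1) * (real n + 2) * r ^ n)"
    by (simp add: diffs_def algebra_simps)
  then show ?thesis
    by (rule summable_comparison_test'[where N = 0])
       (use assms in \<open>auto simp: power2_eq_square intro!: mult_mono\<close>)
qed

lemma summable_on_square_geometric:
  fixes r :: real
  assumes r: "0 < r" "r < 1"
  shows "(\<lambda>a::'n::finite \<Rightarrow> nat. \<Prod>k\<in>UNIV. (real (a k) + 1)\<^sup>2 * r ^ a k) summable_on UNIV"
proof (rule nonneg_bdd_above_summable_on)
  let ?f = "\<lambda>a::'n \<Rightarrow> nat. \<Prod>k\<in>UNIV. (real (a k) + 1)\<^sup>2 * r ^ a k"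
  let ?s = "\<Sum>p. (real p + 1)\<^sup>2 * r ^ p"
  have nn: "?f a \<ge> 0" for a using r by (intro prod_nonneg) auto
  then show "0 \<le> ?f a" for a .
  show "bdd_above (sum ?f ` {F. F \<subseteq> UNIV \<and> finite F})"
  proof (rule bdd_aboveI, clarify)
    fix F :: "('n \<Rightarrow> nat) set" assume F: "finite F"
    obtain N where N: "F \<subseteq> index_box N" using finite_subset_index_box[OF F] by blast
    have "sum ?f F \<le> sum ?f (index_box N)" using N nn by (intro sum_mono2) auto
    also have "\<dots> = (\<Prod>k\<in>(UNIV :: 'n set). \<Sum>p<N. (real p + 1)\<^sup>2 * r ^ p)"
      unfolding index_box_PiE by (rule prod_sum_PiE[symmetric]) auto
    also have "\<dots> \<le> (\<Prod>k\<in>(UNIV :: 'n set). ?s)"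
      using r by (intro prod_mono conjI sum_nonneg sum_le_suminf summable_square_geometric) auto
    finally show "sum ?f F \<le> (\<Prod>k\<in>(UNIV :: 'n set). ?s)" .
  qed
qed

lemma monomial_partial_bound:
  fixes z :: "complex ^ 'n::finite"
  assumes r: "0 < r" "r < 1" and z: "\<And>k. cmod (z $ k) < r"
  shows "cmod (monomial_partial a j z) \<le> (\<Prod>k\<in>UNIV. (real (a k) + 1) * r ^ a k) / r"
proof -
  have rest: "cmod (\<Prod>k\<in>UNIV - {j}. (z $ k) ^ a k) \<le> (\<Prod>k\<in>UNIV - {j}. (real (a k) + 1) * r ^ a k)"
    unfolding prod_norm[symmetric]
  proof (intro prod_mono conjI norm_ge_zero)
    fix k
    have "cmod ((z $ k) ^ a k) \<le> r ^ a k"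
      unfolding norm_power using z[of k] by (intro power_mono) auto
    also have "\<dots> \<le> (real (a k) + 1) * r ^ a k" using r by (simp add: algebra_simps)
    finally show "cmod ((z $ k) ^ a k) \<le> (real (a k) + 1) * r ^ a k" .
  qed
  have head: "cmod (of_nat (a j) * (z $ j) ^ (a j - 1)) \<le> (real (a j) + 1) * r ^ a j / r"
  proof (cases "a j")
    case (Suc p)
    then have "cmod (of_nat (a j) * (z $ j) ^ (a j - 1)) = real (a j) * cmod (z $ j) ^ p"
      by (simp only: norm_mult norm_power norm_of_nat diff_Suc_1)
    also have "\<dots> \<le> real (a j) * r ^ p"
      by (intro mult_left_mono power_mono less_imp_le[OF z]) auto
    also have "\<dots> \<le> (real (a j) + 1) * r ^ p" using r by (intro mult_right_mono) auto
    finally show ?thesis using r Suc by simp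
  qed (use r in simp)
  have "cmod (monomial_partial a j z) \<le> ((real (a j) + 1) * r ^ a j / r) * (\<Prod>k\<in>UNIV - {j}. (real (a k) + 1) * r ^ a k)"
    unfolding monomial_partial_def norm_mult[of "_ * _"] using head rest r by (intro mult_mono) auto
  also have "\<dots> = (\<Prod>k\<in>UNIV. (real (a k) + 1) * r ^ a k) / r"
    by (subst (2) prod.remove[of _ j]) auto
  finally show ?thesis .
qed

text \<open>Coefficients of square summable series grow at most like \<open>\<Prod>k. a k + 1\<close>. On a polydisc of radius
\<open>r < 1\<close> the differentiated series is then dominated by a convergent numerical series, and the box sums
may be differentiated in the limit. The coefficient functions \<open>p\<close> are the partial derivatives of \<open>g\<close>.\<close>

lemma power_series_has_derivative:
  fixes c :: "('n::finite \<Rightarrow> nat) \<Rightarrow> complex"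
  assumes K: "\<And>a. cmod (c a) \<le> K * (\<Prod>k\<in>UNIV. real (a k) + 1)" and r: "0 < r" "r < 1"
  shows "\<exists>g p. \<forall>z. (\<forall>k. cmod (z $ k) < r) \<longrightarrow> (\<lambda>N. \<Sum>a\<in>index_box N. c a * monomial_symbol a 0 z) \<longlonglongrightarrow> g z \<and>
     (g has_derivative (\<lambda>h. \<Sum>j\<in>UNIV. h $ j * p z j)) (at z)"
proof -
  define S where "S = {z :: complex ^ 'n. \<forall>k. cmod (z $ k) < r}"
  have Seq: "S = (\<Inter>k. {z. cmod (z $ k) < r})" by (auto simp: S_def)
  have "open S"
    unfolding Seq by (intro open_INT ballI finite open_Collect_less continuous_intros)
  have "convex S"
    unfolding convex_def
  proof (intro ballI allI impI)
    fix x y :: "complex ^ 'n" and u v :: real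
    assume xy: "x \<in> S" "y \<in> S" and uv: "0 \<le> u" "0 \<le> v" "u + v = 1"
    have "u *\<^sub>R (x $ k) + v *\<^sub>R (y $ k) \<in> ball 0 r" for k
      using convex_ball[of "0::complex" r] xy uv unfolding convex_def S_def by auto
    then show "u *\<^sub>R x + v *\<^sub>R y \<in> S" by (simp add: S_def)
  qed
  define p where "p = (\<lambda>z j. \<Sum>\<^sub>\<infinity>a. c a * monomial_partial a j z)"
  have unif: "uniform_limit S (\<lambda>N z. \<Sum>a\<in>index_box N. c a * monomial_partial a j z) (\<lambda>z. p z j) sequentially" for j
  proof -
    have "uniform_limit S (\<lambda>X z. \<Sum>a\<in>X. c a * monomial_partial a j z) (\<lambda>z. p z j) (finite_subsets_at_top UNIV)"
      unfolding p_def
    proof (rule Weierstrass_m_test_general)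
      show "(\<lambda>a::'n \<Rightarrow> nat. (\<Prod>k\<in>UNIV. (real (a k) + 1)\<^sup>2 * r ^ a k) * (K / r)) summable_on UNIV"
        by (intro summable_on_cmult_left summable_on_square_geometric r)
      fix a :: "'n \<Rightarrow> nat" and z assume z: "z \<in> S"
      have "norm (c a * monomial_partial a j z) \<le>
          (K * (\<Prod>k\<in>UNIV. real (a k) + 1)) * ((\<Prod>k\<in>UNIV. (real (a k) + 1) * r ^ a k) / r)"
        unfolding norm_mult using z r
        by (intro mult_mono K monomial_partial_bound order_trans[OF norm_ge_zero K]) (auto simp: S_def)
      also have "\<dots> = (\<Prod>k\<in>UNIV. (real (a k) + 1)\<^sup>2 * r ^ a k) * (K / r)"
        by (simp add: prod.distrib power2_eq_square mult_ac)
      finally show "norm (c a * monomial_partial a j z) \<le> (\<Prod>k\<in>UNIV. (real (a k) + 1)\<^sup>2 * r ^ a k) * (K / r)" .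
    qed
    from filterlim_compose[OF this filterlim_index_box] show ?thesis by simp
  qed
  let ?n = "real CARD('n)"
  have "\<exists>g. \<forall>z\<in>S. (\<lambda>N. \<Sum>a\<in>index_box N. c a * monomial_symbol a 0 z) \<longlonglongrightarrow> g z \<and>
     (g has_derivative (\<lambda>h. \<Sum>j\<in>UNIV. h $ j * p z j)) (at z within S)"
  proof (rule has_derivative_sequence[OF \<open>convex S\<close>, where ?x0.0 = 0 and l = "c 0" and
        f' = "\<lambda>N z h. \<Sum>a\<in>index_box N. c a * (\<Sum>j\<in>UNIV. h $ j * monomial_partial a j z)"])
    show "((\<lambda>z. \<Sum>a\<in>index_box N. c a * monomial_symbol a 0 z) has_derivative
        (\<lambda>h. \<Sum>a\<in>index_box N. c a * (\<Sum>j\<in>UNIV. h $ j * monomial_partial a j z))) (at z within S)" for N z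
      by (intro has_derivative_sum has_derivative_mult_right monomial_symbol_has_derivative)
    \<comment> \<open>Convergence of the functions themselves is checked at the origin, where the box sums are constant.\<close>
    show "(0 :: complex ^ 'n) \<in> S" using r by (simp add: S_def)
    have "(\<Sum>a\<in>index_box N. c a * monomial_symbol a 0 0) = c 0" if "N > 0" for N
    proof -
      have z: "monomial_symbol a 0 (0 :: complex ^ 'n) = (if a = 0 then 1 else 0)" for a
        by (auto simp: monomial_symbol_def fun_eq_iff)
      have "(0 :: 'n \<Rightarrow> nat) \<in> index_box N" using that by (simp add: index_box_def)
      then show ?thesis unfolding z by (simp add: if_distrib[of "\<lambda>x. _ * x"] sum.delta cong: if_cong)
    qed
    then show "(\<lambda>N. \<Sum>a\<in>index_box N. c a * monomial_symbol a 0 0) \<longlonglongrightarrow> c 0"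
      by (intro tendsto_eventually) (auto intro: eventually_mono[OF eventually_gt_at_top[of 0]])
    fix e :: real assume e: "e > 0"
    have "\<forall>\<^sub>F N in sequentially. \<forall>j\<in>UNIV. \<forall>z\<in>S. dist (\<Sum>a\<in>index_box N. c a * monomial_partial a j z) (p z j) < e / ?n"
      using e uniform_limitD[OF unif] by (intro eventually_ball_finite) auto
    then show "\<forall>\<^sub>F N in sequentially. \<forall>z\<in>S. \<forall>h. norm ((\<Sum>a\<in>index_box N. c a * (\<Sum>j\<in>UNIV. h $ j * monomial_partial a j z)) -
        (\<Sum>j\<in>UNIV. h $ j * p z j)) \<le> e * norm h"
    proof (eventually_elim, intro ballI allI)
      case (elim N)
      fix z h assume z: "z \<in> S"
      have "(\<Sum>a\<in>index_box N. c a * (\<Sum>j\<in>UNIV. h $ j * monomial_partial a j z)) - (\<Sum>j\<in>UNIV. h $ j * p z j) =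
         (\<Sum>j\<in>UNIV. h $ j * ((\<Sum>a\<in>index_box N. c a * monomial_partial a j z) - p z j))"
        unfolding sum_distrib_left right_diff_distrib sum_subtractf
        by (subst sum.swap) (simp add: mult.left_commute)
      also have "norm \<dots> \<le> (\<Sum>j\<in>(UNIV :: 'n set). norm h * (e / ?n))"
      proof (rule sum_norm_le)
        fix j
        show "norm (h $ j * ((\<Sum>a\<in>index_box N. c a * monomial_partial a j z) - p z j)) \<le> norm h * (e / ?n)"
          unfolding norm_mult using elim z e
          by (intro mult_mono component_le_norm_cart) (auto simp: dist_norm less_imp_le Finite_Cartesian_Product.norm_nth_le)
      qed
      also have "\<dots> = e * norm h" by simp
      finally show "norm ((\<Sum>a\<in>index_box N. c a * (\<Sum>j\<in>UNIV. h $ j * monomial_partial a j z)) -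
        (\<Sum>j\<in>UNIV. h $ j * p z j)) \<le> e * norm h" .
    qed
  qed
  then obtain g where g: "\<forall>z\<in>S. (\<lambda>N. \<Sum>a\<in>index_box N. c a * monomial_symbol a 0 z) \<longlonglongrightarrow> g z \<and>
     (g has_derivative (\<lambda>h. \<Sum>j\<in>UNIV. h $ j * p z j)) (at z within S)" by blast
  show ?thesis
  proof (intro exI[of _ g] exI[of _ p] allI impI)
    fix z :: "complex ^ 'n" assume "\<forall>k. cmod (z $ k) < r"
    then have "z \<in> S" by (simp add: S_def)
    with g at_within_open[OF this \<open>open S\<close>]
    show "(\<lambda>N. \<Sum>a\<in>index_box N. c a * monomial_symbol a 0 z) \<longlonglongrightarrow> g z \<and>
       (g has_derivative (\<lambda>h. \<Sum>j\<in>UNIV. h $ j * p z j)) (at z)" by auto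
  qed
qed

lemma polydisc_radius:
  fixes z :: "complex ^ 'n::finite"
  assumes "z \<in> polydisc"
  obtains r where "0 < r" "r < 1" "\<And>k. cmod (z $ k) < r"
proof -
  define s where "s = Max (range (\<lambda>k. cmod (z $ k)))"
  have s: "cmod (z $ k) \<le> s" for k unfolding s_def by (intro Max_ge) auto
  have "s < 1" unfolding s_def using assms by (subst Max_less_iff) (auto simp: polydisc_def)
  moreover have "s \<ge> 0" using order_trans[OF norm_ge_zero s] .
  moreover have "cmod (z $ k) < (s + 1) / 2" for k using s[of k] \<open>s < 1\<close> by simp
  ultimately show ?thesis by (intro that[of "(s + 1) / 2"]) auto
qed

text \<open>The Riesz-Fischer direction: square summable coefficients are those of an element of \<open>bergman\<close>. The
series converges pointwise to a holomorphic \<open>F\<close>. Fatou's lemma for the box sums bounds the norm of \<open>F\<close>, and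
for their differences it bounds the distance from \<open>F\<close> to a box sum by the tail of the series. Hence the
box sums converge to \<open>F\<close> in norm, and the coefficients pass to the limit.\<close>

lemma bergman_synthesis:
  fixes c :: "('n::finite \<Rightarrow> nat) \<Rightarrow> complex"
  assumes C: "\<And>N. (\<Sum>a\<in>index_box N. (cmod (c a))\<^sup>2 * monomial_weight a) \<le> C"
  obtains F where "F \<in> bergman" "\<And>z. z \<in> polydisc \<Longrightarrow> (\<lambda>N. monomial_sum c (index_box N) z) \<longlonglongrightarrow> F z"
    "\<And>a. coef F a = c a * of_real (monomial_weight a)" "(l2_norm F)\<^sup>2 \<le> C"
    "(\<lambda>N. l2_norm (F - monomial_sum c (index_box N))) \<longlonglongrightarrow> 0"
proof -
  define s where "s = (\<lambda>N. \<Sum>a\<in>index_box N. (cmod (c a))\<^sup>2 * monomial_weight a)"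
  have wnn: "0 \<le> (cmod (c a))\<^sup>2 * monomial_weight a" for a
    using monomial_weight_pos[of a] by (simp add: less_imp_le)
  have K: "cmod (c a) \<le> sqrt C * (\<Prod>k\<in>UNIV. real (a k) + 1)" for a
  proof -
    obtain N where N: "a \<in> index_box N"
    proof
      show "a \<in> index_box (Suc (Max (range a)))" by (auto simp: index_box_def less_Suc_eq_le)
    qed
    have "(cmod (c a))\<^sup>2 * monomial_weight a \<le> s N"
      unfolding s_def using N wnn by (intro member_le_sum) auto
    also have "\<dots> \<le> C" using C by (simp add: s_def)
    finally have cw: "(cmod (c a))\<^sup>2 \<le> C * (1 / monomial_weight a)"
      using monomial_weight_pos[of a] by (simp add: pos_le_divide_eq)
    have w: "1 / monomial_weight a \<le> (\<Prod>k\<in>UNIV. real (a k) + 1)\<^sup>2"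
    proof -
      have "1 / monomial_weight a = (\<Prod>k\<in>UNIV. (real (a k) + 1) / pi)"
        unfolding monomial_weight_def by (simp add: prod_dividef)
      also have "\<dots> \<le> (\<Prod>k\<in>UNIV. (real (a k) + 1)\<^sup>2)"
      proof (intro prod_mono conjI)
        fix k
        have "(real (a k) + 1) / pi \<le> (real (a k) + 1) * 1"
          using pi_ge_two by (simp add: divide_le_eq mult_le_cancel_left1)
        also have "\<dots> \<le> (real (a k) + 1) * (real (a k) + 1)" by (intro mult_left_mono) auto
        finally show "(real (a k) + 1) / pi \<le> (real (a k) + 1)\<^sup>2" by (simp add: power2_eq_square)
      qed auto
      finally show ?thesis by (simp add: prod_power_distrib)
    qed
    have C0: "C \<ge> 0" using order_trans[OF sum_nonneg[OF wnn] C] .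
    have "(cmod (c a))\<^sup>2 \<le> C * (\<Prod>k\<in>UNIV. real (a k) + 1)\<^sup>2"
      by (rule order_trans[OF cw mult_left_mono[OF w C0]])
    then have "(cmod (c a))\<^sup>2 \<le> (sqrt C * (\<Prod>k\<in>UNIV. real (a k) + 1))\<^sup>2"
      using C0 by (simp add: power_mult_distrib)
    then show ?thesis
      by (rule power2_le_imp_le) (use C0 in \<open>auto intro!: mult_nonneg_nonneg prod_nonneg\<close>)
  qed
  define F where "F = (\<lambda>z. if z \<in> polydisc then lim (\<lambda>N. monomial_sum c (index_box N) z) else 0)"
  have msum: "monomial_sum c (index_box N) z = (\<Sum>a\<in>index_box N. c a * monomial_symbol a 0 z)" if "z \<in> polydisc" for N z
    using that by (simp add: monomial_sum_apply mixed_monomial_def)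
  have lim: "(\<lambda>N. monomial_sum c (index_box N) z) \<longlonglongrightarrow> F z"
    and der: "\<exists>p. (F has_derivative (\<lambda>h. \<Sum>j\<in>UNIV. h $ j * p j)) (at z)" if z: "z \<in> polydisc" for z
  proof -
    obtain r where r: "0 < r" "r < 1" "\<And>k. cmod (z $ k) < r" by (rule polydisc_radius[OF z]) blast
    obtain g p where gp: "\<And>z. (\<forall>k. cmod (z $ k) < r) \<Longrightarrow> (\<lambda>N. \<Sum>a\<in>index_box N. c a * monomial_symbol a 0 z) \<longlonglongrightarrow> g z"
      "\<And>z. (\<forall>k. cmod (z $ k) < r) \<Longrightarrow> (g has_derivative (\<lambda>h. \<Sum>j\<in>UNIV. h $ j * p z j)) (at z)"
      using power_series_has_derivative[OF K r(1,2)] by blast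
    have sub: "y \<in> polydisc" if "\<forall>k. cmod (y $ k) < r" for y
      using that r by (auto simp: polydisc_def intro: less_trans)
    have Fg: "F y = g y" if "\<forall>k. cmod (y $ k) < r" for y
      using gp(1)[OF that] sub[OF that] by (simp add: F_def msum limI)
    show "(\<lambda>N. monomial_sum c (index_box N) z) \<longlonglongrightarrow> F z"
      using gp(1)[of z] Fg[of z] r z by (simp add: msum)
    have o: "open {y :: complex ^ 'n. \<forall>k. cmod (y $ k) < r}"
    proof -
      have eq: "{y :: complex ^ 'n. \<forall>k. cmod (y $ k) < r} = (\<Inter>k. {y. cmod (y $ k) < r})" by auto
      show ?thesis unfolding eq by (intro open_INT ballI finite open_Collect_less continuous_intros)
    qed
    have "(F has_derivative (\<lambda>h. \<Sum>j\<in>UNIV. h $ j * p z j)) (at z)"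
      by (rule has_derivative_transform_within_open[OF gp(2) o]) (use r Fg in auto)
    then show "\<exists>p. (F has_derivative (\<lambda>h. \<Sum>j\<in>UNIV. h $ j * p j)) (at z)" by blast
  qed
  define p where "p = (\<lambda>z. SOME p. (F has_derivative (\<lambda>h. \<Sum>j\<in>UNIV. h $ j * p j)) (at z))"
  have p: "(F has_derivative (\<lambda>h. \<Sum>j\<in>UNIV. h $ j * p z j)) (at z)" if "z \<in> polydisc" for z
    unfolding p_def by (rule someI_ex[OF der[OF that]])
  have sC: "s N \<le> C" for N using C by (simp add: s_def)
  have FL2: "F \<in> L2" and FC: "(l2_norm F)\<^sup>2 \<le> C"
    using l2_Fatou[of "\<lambda>N. monomial_sum c (index_box N)" F C] lim monomial_sum_L2 sC
    by (auto simp: l2_norm_monomial_sum s_def)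
  have FB: "F \<in> bergman"
    by (rule bergmanI_holomorphic[OF FL2 _ p]) (simp add: F_def)
  have "incseq s"
    unfolding incseq_def s_def by (intro allI impI sum_mono2 index_box_mono wnn) auto
  then obtain L where L: "s \<longlonglongrightarrow> L" "\<And>N. s N \<le> L"
    using incseq_convergent[of s C] sC by blast
  have tail: "(l2_norm (F - monomial_sum c (index_box N)))\<^sup>2 \<le> L - s N" for N
  proof (rule l2_Fatou(2)[where u = "\<lambda>M. monomial_sum c (index_box (M + N)) - monomial_sum c (index_box N)"])
    show "monomial_sum c (index_box (M + N)) - monomial_sum c (index_box N) \<in> L2" for M
      by (intro L2_diff monomial_sum_L2)
    show "(\<lambda>M. (monomial_sum c (index_box (M + N)) - monomial_sum c (index_box N)) z) \<longlonglongrightarrow>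
        (F - monomial_sum c (index_box N)) z" if "z \<in> polydisc" for z
      unfolding fun_diff_def by (rule tendsto_diff[OF LIMSEQ_ignore_initial_segment[OF lim[OF that]] tendsto_const])
    fix M
    have sub: "(index_box N :: ('n \<Rightarrow> nat) set) \<subseteq> index_box (M + N)" by (rule index_box_mono) simp
    have "monomial_sum c (index_box (M + N)) - monomial_sum c (index_box N) = monomial_sum c (index_box (M + N) - index_box N)"
      unfolding monomial_sum_def using sub by (simp add: sum_diff)
    then have "(l2_norm (monomial_sum c (index_box (M + N)) - monomial_sum c (index_box N)))\<^sup>2 = s (M + N) - s N"
      unfolding s_def using sub by (simp add: l2_norm_monomial_sum sum_diff)
    then show "(l2_norm (monomial_sum c (index_box (M + N)) - monomial_sum c (index_box N)))\<^sup>2 \<le> L - s N"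
      using L(2)[of "M + N"] by simp
  qed
  have conv: "(\<lambda>N. l2_norm (F - monomial_sum c (index_box N))) \<longlonglongrightarrow> 0"
  proof -
    have "(\<lambda>N. L - s N) \<longlonglongrightarrow> L - L" by (intro tendsto_intros L)
    then have L0: "(\<lambda>N. L - s N) \<longlonglongrightarrow> 0" by simp
    have "(\<lambda>N. (l2_norm (F - monomial_sum c (index_box N)))\<^sup>2) \<longlonglongrightarrow> 0"
      by (rule tendsto_sandwich[OF _ _ tendsto_const[of 0] L0]) (simp_all add: tail)
    from tendsto_real_sqrt[OF this] show ?thesis by (simp add: l2_norm_nonneg)
  qed
  have "coef F a = c a * of_real (monomial_weight a)" for a
  proof -
    have "(\<lambda>N. coef (F - monomial_sum c (index_box N)) a) \<longlonglongrightarrow> 0"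
    proof (rule Lim_null_comparison)
      show "\<forall>\<^sub>F N in sequentially. norm (coef (F - monomial_sum c (index_box N)) a) \<le>
          l2_norm (F - monomial_sum c (index_box N)) * l2_norm (monomial a)"
        by (intro always_eventually allI l2_Cauchy_Schwarz L2_diff FL2 monomial_sum_L2 mixed_monomial_L2)
      show "(\<lambda>N. l2_norm (F - monomial_sum c (index_box N)) * l2_norm (monomial a)) \<longlonglongrightarrow> 0"
        using tendsto_mult_right[OF conv, of "l2_norm (monomial a)"] by simp
    qed
    \<comment> \<open>As soon as the box contains \<open>a\<close>, the coefficient of the box sum is the prescribed one.\<close>
    moreover have "\<forall>\<^sub>F N in sequentially. coef (F - monomial_sum c (index_box N)) a = coef F a - c a * of_real (monomial_weight a)"
    proof -
      have "\<forall>\<^sub>F N in sequentially. {a} \<subseteq> index_box N"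
        using filterlim_index_box[where 'n = 'n] unfolding filterlim_finite_subsets_at_top
        by (auto elim!: allE[of _ "{a}"] elim: eventually_mono)
      then show ?thesis
        by eventually_elim (simp add: l2_inner_diff_left FL2 monomial_sum_L2 mixed_monomial_L2 coef_monomial_sum)
    qed
    ultimately have "(\<lambda>N. coef F a - c a * of_real (monomial_weight a)) \<longlonglongrightarrow> 0"
      by (rule Lim_transform_eventually)
    then show ?thesis by (simp add: LIMSEQ_const_iff)
  qed
  then show ?thesis using that[OF FB lim _ FC conv] by blast
qed

text \<open>Synthesis from the coefficients of \<open>f\<close> gives back \<open>f\<close>, and synthesis converges in norm.\<close>

lemma bergman_sums_in_norm:
  assumes f: "f \<in> bergman"
  shows "(\<lambda>N. l2_norm (f - monomial_sum (\<lambda>a. coef f a / of_real (monomial_weight a)) (index_box N))) \<longlonglongrightarrow> 0"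
proof -
  let ?c = "\<lambda>a. coef f a / of_real (monomial_weight a)"
  obtain F where F: "F \<in> bergman" "\<And>z. z \<in> polydisc \<Longrightarrow> (\<lambda>N. monomial_sum ?c (index_box N) z) \<longlonglongrightarrow> F z"
    "\<And>a. coef F a = ?c a * of_real (monomial_weight a)" "(l2_norm F)\<^sup>2 \<le> (l2_norm f)\<^sup>2"
    "(\<lambda>N. l2_norm (F - monomial_sum ?c (index_box N))) \<longlonglongrightarrow> 0"
    by (rule bergman_synthesis[of ?c "(l2_norm f)\<^sup>2", OF Bessel_inequality[OF bergman_L2[OF f] finite_index_box]]) blast
  have "F = f"
  proof (rule bergman_eqI[OF F(1) f])
    show "coef F a = coef f a" for a using monomial_weight_pos[of a] by (simp add: F(3))
  qed
  then show ?thesis using F(5) by simp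
qed

text \<open>The box sums of \<open>h\<close> converge to \<open>h\<close> in norm, and \<open>u\<close> is orthogonal to each of them.\<close>

lemma orthogonal_to_monomials:
  assumes u: "u \<in> L2" and z: "\<And>a. coef u a = 0" and h: "h \<in> bergman"
  shows "l2_inner u h = 0"
proof -
  let ?S = "\<lambda>N. monomial_sum (\<lambda>a. coef h a / of_real (monomial_weight a)) (index_box N)"
  have "(\<lambda>N. l2_norm u * l2_norm (h - ?S N)) \<longlonglongrightarrow> l2_norm u * 0"
    by (intro tendsto_mult_left bergman_sums_in_norm h)
  moreover have "cmod (l2_inner u h) \<le> l2_norm u * l2_norm (h - ?S N)" for N
  proof -
    have "l2_inner u (h - ?S N) = l2_inner u h"
      by (simp add: l2_inner_diff_right bergman_L2[OF h] monomial_sum_L2 u inner_monomial_sum_right z)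
    then show ?thesis using l2_Cauchy_Schwarz[OF u L2_diff[OF bergman_L2[OF h] monomial_sum_L2]] by metis
  qed
  ultimately have "cmod (l2_inner u h) \<le> l2_norm u * 0"
    by (intro LIMSEQ_le_const) auto
  then show ?thesis by simp
qed


section \<open>The Hankel operator is diagonal on monomials\<close>

lemma bergman_zero: "0 \<in> bergman"
  using bergman_fscale[OF monomial_bergman[of 0], of 0] by (simp add: fscale_def zero_fun_def)

text \<open>Existence of the orthogonal projection: Bessel's inequality makes the coefficients of \<open>g\<close> square
summable, so that they can be synthesised.\<close>

lemma bergman_with_coefs:
  assumes g: "g \<in> L2"
  shows "\<exists>F\<in>bergman. \<forall>a. coef F a = coef g a"
proof -
  let ?c = "\<lambda>a. coef g a / of_real (monomial_weight a)"
  obtain F where F: "F \<in> bergman" "\<And>a. coef F a = ?c a * of_real (monomial_weight a)"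
    by (rule bergman_synthesis[of ?c "(l2_norm g)\<^sup>2", OF Bessel_inequality[OF g finite_index_box]]) blast
  have "coef F a = coef g a" for a
    using monomial_weight_pos[of a] by (simp add: F(2))
  then show ?thesis using F(1) by blast
qed

lemma orthogonal_difference_if_coefs_eq:
  assumes g: "g \<in> L2" and F: "F \<in> bergman" and eq: "\<And>a. coef F a = coef g a" and h: "h \<in> bergman"
  shows "l2_inner (g - F) h = 0"
proof (rule orthogonal_to_monomials[OF _ _ h])
  show "g - F \<in> L2" by (rule L2_diff[OF g bergman_L2[OF F]])
  show "coef (g - F) a = 0" for a
    by (simp only: l2_inner_diff_left[OF g bergman_L2[OF F] mixed_monomial_L2] eq diff_self)
qed

text \<open>The projection is determined by its coefficients; this evaluates the definite description in
\<open>bergman_proj\<close>.\<close>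

lemma bergman_proj_eqI:
  assumes g: "g \<in> L2" and F: "F \<in> bergman" and eq: "\<And>a. coef F a = coef g a"
  shows "bergman_proj g = F"
  unfolding bergman_proj_def
proof (rule the_equality)
  show "F \<in> bergman \<and> (\<forall>h\<in>bergman. l2_inner (g - F) h = 0)"
    using F orthogonal_difference_if_coefs_eq[OF g F eq] by blast
  fix G assume G: "G \<in> bergman \<and> (\<forall>h\<in>bergman. l2_inner (g - G) h = 0)"
  show "G = F"
  proof (rule bergman_eqI)
    fix a
    have "coef (g - G) a = 0" using G monomial_bergman by blast
    then have "coef g a - coef G a = 0"
      using G by (simp only: l2_inner_diff_left[OF g bergman_L2 mixed_monomial_L2])
    then show "coef G a = coef F a" by (simp add: eq)
  qed (use G F in auto)
qed

lemma bergman_proj_bergman: "g \<in> L2 \<Longrightarrow> bergman_proj g \<in> bergman"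
  and coef_bergman_proj: "g \<in> L2 \<Longrightarrow> coef (bergman_proj g) a = coef g a"
  using bergman_with_coefs bergman_proj_eqI by metis+

lemma inner_bergman_proj:
  assumes g: "g \<in> L2" and h: "h \<in> bergman"
  shows "l2_inner (bergman_proj g) h = l2_inner g h"
proof -
  have "l2_inner g h - l2_inner (bergman_proj g) h = 0"
    using orthogonal_difference_if_coefs_eq[OF g bergman_proj_bergman[OF g] coef_bergman_proj[OF g] h]
    by (simp only: l2_inner_diff_left[OF g bergman_L2[OF bergman_proj_bergman[OF g]] bergman_L2[OF h]])
  then show ?thesis by simp
qed

lemma coef_mixed_monomial: "coef (mixed_monomial a b) d = (if a = b + d then of_real (monomial_weight a) else 0)"
  using l2_inner_mixed_monomial[of a b d 0] by simp

lemma coef_fscale: "coef (fscale c f) a = c * coef f a"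
  by (rule l2_inner_fscale_left)

text \<open>The mixed monomial \<open>z\<^sup>a cnj z\<^sup>b\<close> is orthogonal to every monomial other than \<open>z\<^sup>(\<^sup>a\<^sup>-\<^sup>b\<^sup>)\<close>, so
its projection is a multiple of that one. The factor is the quotient of the weights of \<open>a\<close> and
\<open>a - b\<close>.\<close>

lemma inner_mixed_monomial:
  assumes f: "f \<in> bergman" and le: "\<And>k. b k \<le> a k"
  shows "l2_inner f (mixed_monomial a b) =
    of_real (\<Prod>k\<in>UNIV. (real (a k) - real (b k) + 1) / (real (a k) + 1)) * coef f (\<lambda>k. a k - b k)"
proof -
  let ?q = "\<Prod>k\<in>UNIV. (real (a k) - real (b k) + 1) / (real (a k) + 1)"
  let ?d = "\<lambda>k. a k - b k"
  have w: "?q * monomial_weight ?d = monomial_weight a"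
    unfolding monomial_weight_def prod.distrib[symmetric]
  proof (intro prod.cong refl)
    fix k
    have eq: "real (a k) - real (b k) + 1 = real (a k - b k) + 1" using le by (simp add: of_nat_diff)
    have cancel: "x / y * (pi / x) = pi / y" if "x \<noteq> 0" for x y :: real using that by simp
    show "(real (a k) - real (b k) + 1) / (real (a k) + 1) * (pi / (real (a k - b k) + 1)) = pi / (real (a k) + 1)"
      unfolding eq by (rule cancel) linarith
  qed
  have P: "bergman_proj (mixed_monomial a b) = fscale (of_real ?q) (monomial ?d)"
  proof (rule bergman_proj_eqI[OF mixed_monomial_L2])
    show "fscale (of_real ?q) (monomial ?d) \<in> bergman" by (intro bergman_fscale monomial_bergman)
    fix e
    have iff: "a = b + e \<longleftrightarrow> ?d = e" using le by (auto simp: fun_eq_iff) (metis le_add_diff_inverse)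
    show "coef (fscale (of_real ?q) (monomial ?d)) e = coef (mixed_monomial a b) e"
      by (simp only: coef_fscale coef_monomial coef_mixed_monomial iff w[symmetric]) simp
  qed
  have "l2_inner f (mixed_monomial a b) = cnj (l2_inner (bergman_proj (mixed_monomial a b)) f)"
    by (subst l2_inner_commute) (simp add: inner_bergman_proj[OF mixed_monomial_L2 f])
  also have "\<dots> = l2_inner f (fscale (of_real ?q) (monomial ?d))"
    unfolding P by (rule l2_inner_commute[symmetric])
  finally show ?thesis by (simp add: l2_inner_fscale_right)
qed

text \<open>The exponent \<open>a - b\<close> is now negative in some coordinate, and the mixed monomial is orthogonal to all monomials.\<close>

lemma inner_mixed_monomial_eq_0:
  assumes f: "f \<in> bergman" and le: "\<not> b k \<le> a k"
  shows "l2_inner f (mixed_monomial a b) = 0"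
proof -
  have "coef (mixed_monomial a b) e = 0" for e
    using le by (auto simp: coef_mixed_monomial)
  from orthogonal_to_monomials[OF mixed_monomial_L2 this f] show ?thesis
    by (subst l2_inner_commute) simp
qed

lemma monomial_symbol_L2_mult:
  assumes f: "f \<in> L2"
  shows "monomial_symbol n m * f \<in> L2" "(\<lambda>z. cnj (monomial_symbol n m z)) * f \<in> L2"
proof -
  have bd: "cmod (monomial_symbol n m z) \<le> 1" if "z \<in> polydisc" for z
    using that unfolding monomial_symbol_def
    by (auto simp: prod_norm[symmetric] norm_mult norm_power polydisc_def less_imp_le
        intro!: prod_le_1 mult_le_one power_le_one)
  have "monomial_symbol n m \<in> borel_measurable borel" "(\<lambda>z. cnj (monomial_symbol n m z)) \<in> borel_measurable borel"
    unfolding monomial_symbol_def by (intro borel_measurable_continuous_onI continuous_intros)+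
  then show "monomial_symbol n m * f \<in> L2" "(\<lambda>z. cnj (monomial_symbol n m z)) * f \<in> L2"
    using bd by (auto intro!: L2_mult_bounded[OF f, where B = 1] borel_measurable_polydisc)
qed

lemma hankel_L2: "f \<in> bergman \<Longrightarrow> hankel (monomial_symbol n m) f \<in> L2"
  unfolding hankel_def
  by (intro L2_diff monomial_symbol_L2_mult bergman_L2 bergman_proj_bergman)

lemma hankel_orthogonal:
  assumes "f \<in> bergman" "h \<in> bergman"
  shows "l2_inner h (hankel (monomial_symbol n m) f) = 0"
proof -
  let ?g = "monomial_symbol n m * f"
  have g: "?g \<in> L2" by (intro monomial_symbol_L2_mult bergman_L2 assms)
  have "l2_inner (hankel (monomial_symbol n m) f) h = 0"
    unfolding hankel_def
    by (rule orthogonal_difference_if_coefs_eq[OF g bergman_proj_bergman[OF g] coef_bergman_proj[OF g] assms(2)])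
  then show ?thesis by (subst l2_inner_commute) simp
qed

text \<open>As the range of the Hankel operator is orthogonal to \<open>bergman\<close>, the projection inside the first factor of
\<open>l2_inner (hankel \<psi> f') (hankel \<psi> f)\<close> contributes nothing. What is left is multiplication by the symbol, whose
adjoint is multiplication by the conjugate symbol followed by projection.\<close>

lemma hankel_square_eq:
  assumes f: "f \<in> bergman"
  shows "hankel_square (monomial_symbol n m) f =
    bergman_proj ((\<lambda>z. cnj (monomial_symbol n m z)) * hankel (monomial_symbol n m) f)"
proof -
  let ?\<psi> = "monomial_symbol n m"
  let ?g = "hankel ?\<psi> f"
  let ?h = "bergman_proj ((\<lambda>z. cnj (?\<psi> z)) * ?g)"
  note gL2 = hankel_L2[OF f, of n m]
  have h: "?h \<in> bergman" by (intro bergman_proj_bergman monomial_symbol_L2_mult gL2)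
  have adj: "l2_inner (hankel ?\<psi> f') ?g = l2_inner f' ?h" if f': "f' \<in> bergman" for f'
  proof -
    have "l2_inner (hankel ?\<psi> f') ?g = l2_inner (?\<psi> * f') ?g - l2_inner (bergman_proj (?\<psi> * f')) ?g"
      unfolding hankel_def[of ?\<psi> f']
      by (intro l2_inner_diff_left gL2 monomial_symbol_L2_mult bergman_L2 bergman_proj_bergman f')
    also have "l2_inner (bergman_proj (?\<psi> * f')) ?g = 0"
      by (intro hankel_orthogonal f bergman_proj_bergman monomial_symbol_L2_mult bergman_L2 f')
    also have "l2_inner (?\<psi> * f') ?g = l2_inner f' ((\<lambda>z. cnj (?\<psi> z)) * ?g)" by (rule l2_inner_mult_left)
    also have "\<dots> = l2_inner f' ?h"
      by (subst (1 2) l2_inner_commute)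
         (simp add: inner_bergman_proj[OF monomial_symbol_L2_mult(2)[OF gL2] f'])
    finally show ?thesis by simp
  qed
  show ?thesis
    unfolding hankel_square_def bergman_adjoint_def
  proof (rule the_equality)
    show "?h \<in> bergman \<and> (\<forall>f'\<in>bergman. l2_inner (hankel ?\<psi> f') ?g = l2_inner f' ?h)" using h adj by blast
    fix h' assume h': "h' \<in> bergman \<and> (\<forall>f'\<in>bergman. l2_inner (hankel ?\<psi> f') ?g = l2_inner f' h')"
    show "h' = ?h"
    proof (rule bergman_eqI)
      fix a
      have "l2_inner (monomial a) h' = l2_inner (monomial a) ?h" using h' adj monomial_bergman by metis
      then show "coef h' a = coef ?h a" by (metis l2_inner_commute)
    qed (use h h' in auto)
  qed
qed

text \<open>Moving all factors onto the monomial \<open>z\<^sup>a\<close>, the coefficient is that of \<open>cnj \<psi> * \<psi> * f\<close> minus that of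
\<open>cnj \<psi> * P (\<psi> * f)\<close>, where \<open>P\<close> is the projection. The first one yields the first product in
\<open>hankel_lambda\<close>. In the second one \<open>\<psi> * z\<^sup>a = z\<^sup>(\<^sup>n\<^sup>+\<^sup>a\<^sup>) cnj z\<^sup>m\<close> is projected. This gives \<open>0\<close> when
\<open>n + a - m\<close> is negative somewhere, which is the case distinction in \<open>hankel_lambda\<close>; otherwise two
quotients of weights multiply to the second product.\<close>

lemma coef_hankel_square:
  assumes f: "f \<in> bergman"
  shows "coef (hankel_square (monomial_symbol n m) f) a = of_real (hankel_lambda n m a UNIV) * coef f a"
proof -
  let ?\<psi> = "monomial_symbol n m"
  let ?A = "\<Prod>k\<in>UNIV. (real (a k) + 1) / (real (a k) + real (n k) + real (m k) + 1)"
  note fL2 = bergman_L2[OF f]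
  note \<psi>f = monomial_symbol_L2_mult(1)[OF fL2, of n m]
  have "coef (hankel_square ?\<psi> f) a = coef ((\<lambda>z. cnj (?\<psi> z)) * hankel ?\<psi> f) a"
    unfolding hankel_square_eq[OF f] by (intro coef_bergman_proj monomial_symbol_L2_mult hankel_L2 f)
  also have "\<dots> = l2_inner (hankel ?\<psi> f) (mixed_monomial (n + a) m)"
    unfolding l2_inner_mult_left
    by (intro l2_inner_cong) (auto simp: mixed_monomial_def monomial_symbol_def power_add prod.distrib mult_ac)
  also have "\<dots> = l2_inner (?\<psi> * f) (mixed_monomial (n + a) m) - l2_inner (bergman_proj (?\<psi> * f)) (mixed_monomial (n + a) m)"
    unfolding hankel_def
    by (rule l2_inner_diff_left[OF \<psi>f bergman_L2[OF bergman_proj_bergman[OF \<psi>f]] mixed_monomial_L2])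
  also have "l2_inner (?\<psi> * f) (mixed_monomial (n + a) m) = l2_inner f (mixed_monomial (n + a + m) (m + n))"
    unfolding l2_inner_mult_left
    by (intro l2_inner_cong) (auto simp: mixed_monomial_def monomial_symbol_def power_add prod.distrib mult_ac)
  also have "\<dots> = of_real ?A * coef f a"
  proof -
    have "(\<lambda>k. (n + a + m) k - (m + n) k) = a" by auto
    then show ?thesis
      by (subst inner_mixed_monomial[OF f]) (auto simp: add_ac)
  qed
  finally have eq: "coef (hankel_square ?\<psi> f) a =
     of_real ?A * coef f a - l2_inner (bergman_proj (?\<psi> * f)) (mixed_monomial (n + a) m)" .
  show ?thesis
  proof (cases "\<forall>k. m k \<le> n k + a k")
    case False
    then obtain k where k: "\<not> m k \<le> (n + a) k" by auto
    then have ex: "\<exists>k\<in>UNIV. int (a k) < int (m k) - int (n k)" by (intro bexI[of _ k]) auto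
    have "l2_inner (bergman_proj (?\<psi> * f)) (mixed_monomial (n + a) m) = 0"
      by (rule inner_mixed_monomial_eq_0[OF bergman_proj_bergman[OF \<psi>f], of m k "n + a", OF k])
    then show ?thesis using eq ex by (simp add: hankel_lambda_def)
  next
    case True
    have nex: "\<not> (\<exists>k\<in>UNIV. int (a k) < int (m k) - int (n k))"
    proof
      assume "\<exists>k\<in>UNIV. int (a k) < int (m k) - int (n k)"
      then obtain k where "int (a k) < int (m k) - int (n k)" by blast
      then have "\<not> m k \<le> n k + a k" by linarith
      then show False using True by blast
    qed
    let ?d = "\<lambda>k. n k + a k - m k"
    let ?B = "\<Prod>k\<in>UNIV. (real (n k + a k) - real (m k) + 1) / (real (n k + a k) + 1)"
    let ?C = "\<Prod>k\<in>UNIV. (real (n k + a k) - real (n k) + 1) / (real (n k + a k) + 1)"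
    have "l2_inner (bergman_proj (?\<psi> * f)) (mixed_monomial (n + a) m) = of_real ?B * coef (bergman_proj (?\<psi> * f)) ?d"
      using True by (subst inner_mixed_monomial[OF bergman_proj_bergman[OF \<psi>f]]) auto
    also have "coef (bergman_proj (?\<psi> * f)) ?d = coef (?\<psi> * f) ?d" by (rule coef_bergman_proj[OF \<psi>f])
    also have "\<dots> = l2_inner f (mixed_monomial (m + ?d) n)"
      unfolding l2_inner_mult_left
      by (intro l2_inner_cong) (auto simp: mixed_monomial_def monomial_symbol_def power_add prod.distrib mult_ac)
    also have "m + ?d = n + a" using True by (auto simp: fun_eq_iff)
    also have "l2_inner f (mixed_monomial (n + a) n) = of_real ?C * coef f a"
    proof -
      have "(\<lambda>k. (n + a) k - n k) = a" by auto
      then show ?thesis by (subst inner_mixed_monomial[OF f]) auto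
    qed
    finally have "l2_inner (bergman_proj (?\<psi> * f)) (mixed_monomial (n + a) m) = of_real (?B * ?C) * coef f a"
      by (simp only: of_real_mult mult.assoc)
    moreover have "?B * ?C = (\<Prod>k\<in>UNIV. (real (a k) + 1) * (real (a k) + real (n k) - real (m k) + 1) /
                    (real (a k) + real (n k) + 1)\<^sup>2)"
      unfolding prod.distrib[symmetric] by (intro prod.cong refl) (simp add: power2_eq_square mult_ac add_ac)
    ultimately have "coef (hankel_square ?\<psi> f) a = of_real (?A - (\<Prod>k\<in>UNIV. (real (a k) + 1) * (real (a k) + real (n k) - real (m k) + 1) /
                    (real (a k) + real (n k) + 1)\<^sup>2)) * coef f a"
      using eq by (simp only: of_real_diff left_diff_distrib)
    then show ?thesis using nex by (simp only: hankel_lambda_def if_False)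
  qed
qed

lemma hankel_square_bergman: "f \<in> bergman \<Longrightarrow> hankel_square (monomial_symbol n m) f \<in> bergman"
  unfolding hankel_square_eq by (intro bergman_proj_bergman monomial_symbol_L2_mult hankel_L2)


section \<open>Spectra and eigenspaces of diagonal operators\<close>

definition diagonal_operator ::
  "((complex ^ 'n::finite \<Rightarrow> complex) \<Rightarrow> (complex ^ 'n \<Rightarrow> complex)) \<Rightarrow> (('n \<Rightarrow> nat) \<Rightarrow> complex) \<Rightarrow> bool" where
  "diagonal_operator T d \<longleftrightarrow> (\<forall>f\<in>bergman. T f \<in> bergman \<and> (\<forall>a. coef (T f) a = d a * coef f a))"

lemma coef_add: "f \<in> bergman \<Longrightarrow> g \<in> bergman \<Longrightarrow> coef (f + g) a = coef f a + coef g a"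
  by (rule l2_inner_add_left[OF bergman_L2 bergman_L2 mixed_monomial_L2])

lemma coef_diff: "f \<in> bergman \<Longrightarrow> g \<in> bergman \<Longrightarrow> coef (f - g) a = coef f a - coef g a"
  by (rule l2_inner_diff_left[OF bergman_L2 bergman_L2 mixed_monomial_L2])

text \<open>Away from the closure of the diagonal the resolvent is the diagonal operator with entries
\<open>1 / (d a - \<mu>)\<close>. They are bounded by \<open>1 / \<delta>\<close>, so that it exists by synthesis and is bounded.\<close>

lemma diagonal_resolvent:
  assumes T: "diagonal_operator T d" and \<delta>: "\<delta> > 0" and gap: "\<And>a. cmod (d a - \<mu>) \<ge> \<delta>"
  shows "\<mu> \<notin> spectrum_on bergman T"
proof -
  have ne: "d a \<noteq> \<mu>" for a using gap[of a] \<delta> by auto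
  have ex: "\<exists>g. g \<in> bergman \<and> (\<forall>a. coef g a = coef f a / (d a - \<mu>)) \<and> l2_norm g \<le> (1 / \<delta>) * l2_norm f"
    if f: "f \<in> bergman" for f
  proof -
    let ?b = "\<lambda>a. coef f a / of_real (monomial_weight a)"
    let ?c = "\<lambda>a. ?b a / (d a - \<mu>)"
    have "(\<Sum>a\<in>index_box N. (cmod (?c a))\<^sup>2 * monomial_weight a) \<le> (l2_norm f / \<delta>)\<^sup>2" for N
    proof -
      have "(\<Sum>a\<in>index_box N. (cmod (?c a))\<^sup>2 * monomial_weight a) \<le>
         (\<Sum>a\<in>index_box N. ((cmod (?b a))\<^sup>2 * monomial_weight a) * (1 / \<delta>)\<^sup>2)"
      proof (rule sum_mono)
        fix a
        have "0 < cmod (d a - \<mu>) * \<delta>" using gap[of a] \<delta> by (intro mult_pos_pos) auto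
        then have "cmod (?b a) / cmod (d a - \<mu>) \<le> cmod (?b a) / \<delta>"
          by (intro divide_left_mono gap norm_ge_zero)
        then have "cmod (?c a) \<le> cmod (?b a) * (1 / \<delta>)"
          by (subst norm_divide) simp
        then have "(cmod (?c a))\<^sup>2 \<le> (cmod (?b a) * (1 / \<delta>))\<^sup>2" by (intro power_mono) auto
        then have "(cmod (?c a))\<^sup>2 * monomial_weight a \<le> (cmod (?b a) * (1 / \<delta>))\<^sup>2 * monomial_weight a"
          using monomial_weight_pos[of a] by (intro mult_right_mono) auto
        also have "\<dots> = ((cmod (?b a))\<^sup>2 * monomial_weight a) * (1 / \<delta>)\<^sup>2"
          unfolding power_mult_distrib by (simp only: mult_ac)
        finally show "(cmod (?c a))\<^sup>2 * monomial_weight a \<le> ((cmod (?b a))\<^sup>2 * monomial_weight a) * (1 / \<delta>)\<^sup>2" .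
      qed
      also have "\<dots> \<le> (l2_norm f)\<^sup>2 * (1 / \<delta>)\<^sup>2"
        unfolding sum_distrib_right[symmetric]
        by (intro mult_right_mono Bessel_inequality bergman_L2 f) auto
      finally show ?thesis by (simp add: power_divide)
    qed
    then obtain g where g: "g \<in> bergman" "\<And>a. coef g a = ?c a * of_real (monomial_weight a)" "(l2_norm g)\<^sup>2 \<le> (l2_norm f / \<delta>)\<^sup>2"
      by (rule bergman_synthesis) blast
    have "coef g a = coef f a / (d a - \<mu>)" for a
      using monomial_weight_pos[of a] by (simp add: g(2))
    moreover have "l2_norm g \<le> l2_norm f / \<delta>"
      using g(3) by (rule power2_le_imp_le) (use \<delta> in \<open>simp add: l2_norm_nonneg\<close>)
    ultimately show ?thesis using g(1) by auto
  qed
  \<comment> \<open>The chosen \<open>g\<close> is unique, as its coefficients are prescribed; hence \<open>R\<close> is linear.\<close>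
  define R where "R = (\<lambda>f. SOME g. g \<in> bergman \<and> (\<forall>a. coef g a = coef f a / (d a - \<mu>)) \<and> l2_norm g \<le> (1 / \<delta>) * l2_norm f)"
  have R: "R f \<in> bergman" "coef (R f) a = coef f a / (d a - \<mu>)" "l2_norm (R f) \<le> (1 / \<delta>) * l2_norm f"
    if "f \<in> bergman" for f a
    using someI_ex[OF ex[OF that]] unfolding R_def by blast+
  have Tb: "T f \<in> bergman" "coef (T f) a = d a * coef f a" if "f \<in> bergman" for f a
    using T that unfolding diagonal_operator_def by blast+
  have "bounded_operator_on bergman R"
    unfolding bounded_operator_on_def
  proof (intro conjI ballI allI)
    show "R ` bergman \<subseteq> bergman" using R by auto
    show "\<exists>C. \<forall>f\<in>bergman. l2_norm (R f) \<le> C * l2_norm f" using R(3) by blast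
    show "R (f + g) = R f + R g" if "f \<in> bergman" "g \<in> bergman" for f g
      using that by (intro bergman_eqI R bergman_add) (simp_all add: R coef_add bergman_add add_divide_distrib)
    show "R (fscale c f) = fscale c (R f)" if "f \<in> bergman" for c f
      using that by (intro bergman_eqI R bergman_fscale) (simp_all add: R coef_fscale bergman_fscale)
  qed
  moreover have "R (T f - fscale \<mu> f) = f" if f: "f \<in> bergman" for f
  proof (rule bergman_eqI)
    have b: "T f - fscale \<mu> f \<in> bergman" by (intro bergman_diff bergman_fscale Tb f)
    then show "R (T f - fscale \<mu> f) \<in> bergman" by (rule R)
    show "coef (R (T f - fscale \<mu> f)) a = coef f a" for a
      using ne[of a] by (simp only: R(2)[OF b] coef_diff[OF Tb(1)[OF f] bergman_fscale[OF f]] Tb(2)[OF f] coef_fscale)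
        (simp add: left_diff_distrib[symmetric])
  qed (rule f)
  moreover have "T (R f) - fscale \<mu> (R f) = f" if f: "f \<in> bergman" for f
  proof (rule bergman_eqI)
    show "T (R f) - fscale \<mu> (R f) \<in> bergman" by (intro bergman_diff bergman_fscale Tb R f)
    show "coef (T (R f) - fscale \<mu> (R f)) a = coef f a" for a
      using ne[of a] by (simp only: coef_diff[OF Tb(1)[OF R(1)[OF f]] bergman_fscale[OF R(1)[OF f]]] Tb(2)[OF R(1)[OF f]] coef_fscale R(2)[OF f])
        (simp add: diff_divide_distrib[symmetric] left_diff_distrib[symmetric])
  qed (rule f)
  ultimately show ?thesis unfolding spectrum_on_def by blast
qed

lemma l2_norm_monomial_pos: "l2_norm (monomial a) > 0"
proof -
  have "(l2_norm (monomial a))\<^sup>2 \<noteq> 0" using monomial_weight_pos[of a] by (simp add: l2_norm_monomial)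
  then show ?thesis using l2_norm_nonneg[of "monomial a"] by (simp add: order_less_le)
qed

text \<open>The monomials are approximate eigenvectors for \<open>\<mu>\<close>, so \<open>T - \<mu>\<close> cannot be bounded below, which a
bounded left inverse \<open>R\<close> would entail.\<close>

lemma diagonal_approximate_eigenvalue:
  assumes T: "diagonal_operator T d" and approx: "\<And>e. e > 0 \<Longrightarrow> \<exists>a. cmod (d a - \<mu>) < e"
  shows "\<mu> \<in> spectrum_on bergman T"
proof (rule ccontr)
  assume "\<mu> \<notin> spectrum_on bergman T"
  then obtain R where R: "bounded_operator_on bergman R" "\<And>f. f \<in> bergman \<Longrightarrow> R (T f - fscale \<mu> f) = f"
    unfolding spectrum_on_def by blast
  obtain C where C: "\<And>f. f \<in> bergman \<Longrightarrow> l2_norm (R f) \<le> C * l2_norm f"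
    using R(1) unfolding bounded_operator_on_def by blast
  have lin: "R (fscale c f) = fscale c (R f)" if "f \<in> bergman" for c f
    using R(1) that unfolding bounded_operator_on_def by blast
  have Tb: "T f \<in> bergman" "coef (T f) a = d a * coef f a" if "f \<in> bergman" for f a
    using T that unfolding diagonal_operator_def by blast+
  obtain a where a: "cmod (d a - \<mu>) < 1 / (\<bar>C\<bar> + 1)" using approx[of "1 / (\<bar>C\<bar> + 1)"] by (auto simp: add_nonneg_pos)
  let ?e = "monomial a"
  have "T ?e - fscale \<mu> ?e = fscale (d a - \<mu>) ?e"
  proof (rule bergman_eqI)
    show "T ?e - fscale \<mu> ?e \<in> bergman" by (intro bergman_diff bergman_fscale Tb monomial_bergman)
    show "fscale (d a - \<mu>) ?e \<in> bergman" by (intro bergman_fscale monomial_bergman)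
    show "coef (T ?e - fscale \<mu> ?e) b = coef (fscale (d a - \<mu>) ?e) b" for b
      by (simp only: coef_diff[OF Tb(1)[OF monomial_bergman] bergman_fscale[OF monomial_bergman]]
          Tb(2)[OF monomial_bergman] coef_fscale coef_monomial) (simp add: left_diff_distrib)
  qed
  then have "fscale (d a - \<mu>) (R ?e) = ?e"
    using R(2)[OF monomial_bergman, of a] lin[OF monomial_bergman] by metis
  then have "l2_norm ?e = cmod (d a - \<mu>) * l2_norm (R ?e)" by (metis l2_norm_fscale)
  also have "\<dots> \<le> cmod (d a - \<mu>) * (\<bar>C\<bar> * l2_norm ?e)"
    using C[OF monomial_bergman, of a] l2_norm_nonneg[of ?e]
    by (intro mult_left_mono order_trans[OF C[OF monomial_bergman]] mult_right_mono) auto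
  finally have "1 * l2_norm ?e \<le> (cmod (d a - \<mu>) * \<bar>C\<bar>) * l2_norm ?e" by simp
  then have "1 \<le> cmod (d a - \<mu>) * \<bar>C\<bar>" using l2_norm_monomial_pos[of a] by (simp only: mult_le_cancel_right_pos)
  also have "\<dots> \<le> cmod (d a - \<mu>) * (\<bar>C\<bar> + 1)" by (intro mult_left_mono) auto
  also have "\<dots> < 1" using a by (simp add: pos_less_divide_eq)
  finally show False by simp
qed

text \<open>The two cases are complementary: \<open>\<mu>\<close> either keeps a positive distance from all \<open>d a\<close> or is approximated by
them.\<close>

theorem spectrum_diagonal_operator:
  assumes T: "diagonal_operator T d"
  shows "spectrum_on bergman T = closure (range d)"
proof (intro set_eqI iffI)
  fix \<mu> assume \<mu>: "\<mu> \<in> closure (range d)"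
  show "\<mu> \<in> spectrum_on bergman T"
  proof (rule diagonal_approximate_eigenvalue[OF T])
    fix e :: real assume "e > 0"
    with \<mu> show "\<exists>a. cmod (d a - \<mu>) < e" by (auto simp: closure_approachable dist_norm)
  qed
next
  fix \<mu> assume \<mu>: "\<mu> \<in> spectrum_on bergman T"
  show "\<mu> \<in> closure (range d)"
  proof (rule ccontr)
    assume "\<mu> \<notin> closure (range d)"
    then obtain e where "e > 0" "\<And>a. e \<le> cmod (d a - \<mu>)"
      by (force simp: closure_approachable dist_norm not_less)
    from diagonal_resolvent[OF T this] \<mu> show False by simp
  qed
qed

lemma eigenspace_coefs:
  assumes T: "diagonal_operator T d" and f: "f \<in> bergman"
  shows "T f = fscale \<mu> f \<longleftrightarrow> (\<forall>a. coef f a \<noteq> 0 \<longrightarrow> d a = \<mu>)"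
proof -
  have Tb: "T f \<in> bergman" "coef (T f) a = d a * coef f a" for a
    using T f unfolding diagonal_operator_def by blast+
  have "T f = fscale \<mu> f \<longleftrightarrow> (\<forall>a. coef (T f) a = coef (fscale \<mu> f) a)"
    using bergman_eqI[OF Tb(1) bergman_fscale[OF f]] by auto
  then show ?thesis by (auto simp: Tb coef_fscale)
qed

lemma monomial_in_eigenspace:
  assumes T: "diagonal_operator T d" and "d a = \<mu>"
  shows "monomial a \<in> eigenspace_on bergman T \<mu>"
  unfolding eigenspace_on_def using assms
  by (auto simp: eigenspace_coefs[OF T monomial_bergman] coef_monomial monomial_bergman split: if_splits)

lemma eigenvalue_diagonal_operator:
  assumes T: "diagonal_operator T d" and \<mu>: "\<mu> \<in> eigenvalues_on bergman T"
  shows "\<exists>a. d a = \<mu>"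
proof -
  obtain f where f: "f \<in> bergman" "f \<noteq> 0" "T f = fscale \<mu> f" using \<mu> unfolding eigenvalues_on_def by blast
  have "\<exists>a. coef f a \<noteq> 0"
    using bergman_eqI[OF f(1) bergman_zero] f(2) by auto
  then show ?thesis using f eigenspace_coefs[OF T f(1)] by blast
qed

lemma monomial_sum_bergman: "finite A \<Longrightarrow> monomial_sum c A \<in> bergman"
  unfolding monomial_sum_def
proof (induction A rule: finite_induct)
  case empty
  show ?case unfolding sum.empty by (rule bergman_zero)
next
  case (insert a A)
  show ?case
    unfolding sum.insert[OF insert(1,2)] by (intro bergman_add bergman_fscale monomial_bergman insert(3))
qed

interpretation fscale: vector_space fscale by (rule vector_space_fscale)

text \<open>An eigenvector for \<open>\<mu>\<close> only has coefficients at the indices with \<open>d a = \<mu>\<close>.\<close>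

lemma finite_dimensional_eigenspace:
  assumes T: "diagonal_operator T d" and A: "finite {a. d a = \<mu>}"
  shows "finite_dimensional (eigenspace_on bergman T \<mu>)"
  unfolding finite_dimensional_def
proof (intro exI[of _ "monomial ` {a. d a = \<mu>}"] conjI subsetI)
  show "finite (monomial ` {a. d a = \<mu>})" using A by simp
  fix f assume "f \<in> eigenspace_on bergman T \<mu>"
  then have f: "f \<in> bergman" "T f = fscale \<mu> f" by (auto simp: eigenspace_on_def)
  let ?S = "monomial_sum (\<lambda>a. coef f a / of_real (monomial_weight a)) {a. d a = \<mu>}"
  have "f = ?S"
  proof (rule bergman_eqI[OF f(1) monomial_sum_bergman[OF A]])
    fix a
    show "coef f a = coef ?S a"
      using f(2) eigenspace_coefs[OF T f(1)] monomial_weight_pos[of a] by (auto simp: coef_monomial_sum A)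
  qed
  moreover have "?S \<in> fscale.span (monomial ` {a. d a = \<mu>})"
    unfolding monomial_sum_def by (intro fscale.span_sum fscale.span_scale fscale.span_base) auto
  ultimately show "f \<in> fscale.span (monomial ` {a. d a = \<mu>})" by simp
qed

lemma inj_monomial: "inj monomial"
proof (rule injI)
  fix a b :: "'a \<Rightarrow> nat" assume "monomial a = monomial b"
  then have "coef (monomial a) a = coef (monomial b) a" by simp
  then show "a = b" using monomial_weight_pos[of a] by (auto simp: coef_monomial split: if_splits)
qed

text \<open>Orthogonality: the coefficient at \<open>a\<close> of a linear relation isolates the scalar of the monomial \<open>a\<close>.\<close>

lemma independent_monomials: "fscale.independent (range (monomial :: ('n::finite \<Rightarrow> nat) \<Rightarrow> _))"
  unfolding fscale.dependent_explicit
proof clarify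
  fix S :: "(complex ^ 'n \<Rightarrow> complex) set" and u :: "(complex ^ 'n \<Rightarrow> complex) \<Rightarrow> complex" and v
  assume S: "finite S" "S \<subseteq> range monomial" and z: "(\<Sum>v\<in>S. fscale (u v) v) = 0" and v: "v \<in> S" "u v \<noteq> 0"
  obtain a where a: "v = monomial a" using S v by auto
  have L2: "w \<in> L2" if "w \<in> S" for w using S that mixed_monomial_L2 by auto
  have "0 = coef (\<Sum>v\<in>S. fscale (u v) v) a" by (simp add: z)
  also have "\<dots> = (\<Sum>w\<in>S. u w * coef w a)"
    by (subst l2_inner_sum_left) (auto intro: L2_fscale L2 mixed_monomial_L2 simp: l2_inner_fscale_left)
  also have "\<dots> = (\<Sum>w\<in>S. if w = v then u v * of_real (monomial_weight a) else 0)"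
  proof (rule sum.cong[OF refl])
    fix w assume "w \<in> S"
    then obtain b where b: "w = monomial b" using S by auto
    have "w = v \<longleftrightarrow> b = a" unfolding a b using inj_monomial by (rule inj_eq)
    then show "u w * coef w a = (if w = v then u v * of_real (monomial_weight a) else 0)"
      unfolding b by (auto simp: coef_monomial)
  qed
  also have "\<dots> = u v * of_real (monomial_weight a)" using S v by simp
  finally show False using v monomial_weight_pos[of a] by simp
qed

lemma infinite_dimensional_eigenspace:
  assumes T: "diagonal_operator T d" and A: "infinite {a. d a = \<mu>}"
  shows "\<not> finite_dimensional (eigenspace_on bergman T \<mu>)"
proof
  assume "finite_dimensional (eigenspace_on bergman T \<mu>)"
  then obtain S where S: "finite S" "eigenspace_on bergman T \<mu> \<subseteq> fscale.span S"
    unfolding finite_dimensional_def by blast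
  let ?M = "monomial ` {a. d a = \<mu>}"
  have "?M \<subseteq> fscale.span S" using S(2) monomial_in_eigenspace[OF T] by blast
  moreover have "fscale.independent ?M"
    using independent_monomials by (rule fscale.independent_mono) auto
  ultimately have "finite ?M" using fscale.independent_span_bound[OF S(1)] by blast
  then show False using A finite_imageD[OF _ inj_on_subset[OF inj_monomial subset_UNIV]] by blast
qed


section \<open>Limits of the eigenvalues\<close>

text \<open>The contribution of one coordinate to \<open>\<parallel>\<psi> * z\<^sup>a\<parallel>\<^sup>2 / \<parallel>z\<^sup>a\<parallel>\<^sup>2\<close>, with \<open>x\<close>, \<open>p\<close> and \<open>q\<close> the entries of
\<open>a\<close>, \<open>n\<close> and \<open>m\<close>.\<close>

definition norm_factor :: "real \<Rightarrow> real \<Rightarrow> real \<Rightarrow> real" where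
  "norm_factor p q x = (x + 1) / (x + p + q + 1)"

text \<open>The contribution of one coordinate to \<open>\<parallel>P (\<psi> * z\<^sup>a)\<parallel>\<^sup>2 / \<parallel>z\<^sup>a\<parallel>\<^sup>2\<close>, where \<open>P\<close> is the Bergman projection.\<close>

definition proj_factor :: "real \<Rightarrow> real \<Rightarrow> real \<Rightarrow> real" where
  "proj_factor p q x = (x + 1) * (x + p - q + 1) / (x + p + 1)\<^sup>2"

lemma hankel_lambda_factors:
  "hankel_lambda n m a B =
     (if \<exists>k\<in>B. int (a k) < int (m k) - int (n k)
      then \<Prod>k\<in>B. norm_factor (n k) (m k) (a k)
      else (\<Prod>k\<in>B. norm_factor (n k) (m k) (a k)) - (\<Prod>k\<in>B. proj_factor (n k) (m k) (a k)))"
  by (simp add: hankel_lambda_def norm_factor_def proj_factor_def)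

lemma norm_factor_limit: "((\<lambda>x. norm_factor p q x) \<longlongrightarrow> 1) at_top"
  unfolding norm_factor_def by real_asymp

lemma proj_factor_limit: "((\<lambda>x. proj_factor p q x) \<longlongrightarrow> 1) at_top"
  unfolding proj_factor_def by real_asymp

lemma norm_minus_proj_factor:
  assumes "x \<ge> 0" "p \<ge> 0" "q \<ge> 0"
  shows "norm_factor p q x - proj_factor p q x = (x + 1) * q\<^sup>2 / ((x + p + q + 1) * (x + p + 1)\<^sup>2)"
proof -
  have "x + p + q + 1 \<noteq> 0" "x + p + 1 \<noteq> 0" using assms by auto
  then show ?thesis
    unfolding norm_factor_def proj_factor_def
    by (simp add: divide_simps) (simp add: power2_eq_square algebra_simps)
qed

lemma factor_bounds:
  assumes "x \<ge> 0" "p \<ge> 0" "q \<ge> 0"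
  shows "norm_factor p q x > 0" "norm_factor p q x \<le> 1" "proj_factor p q x \<le> norm_factor p q x"
    and "p + q > 0 \<Longrightarrow> norm_factor p q x < 1" and "q > 0 \<Longrightarrow> proj_factor p q x < norm_factor p q x"
    and "x \<ge> q - p \<Longrightarrow> proj_factor p q x \<ge> 0"
proof -
  show "norm_factor p q x > 0" using assms by (simp add: norm_factor_def)
  show "norm_factor p q x \<le> 1" "p + q > 0 \<Longrightarrow> norm_factor p q x < 1" using assms by (simp_all add: norm_factor_def)
  show "x \<ge> q - p \<Longrightarrow> proj_factor p q x \<ge> 0" using assms by (simp add: proj_factor_def)
  have "(x + 1) * q\<^sup>2 / ((x + p + q + 1) * (x + p + 1)\<^sup>2) \<ge> 0" using assms by simp
  then show "proj_factor p q x \<le> norm_factor p q x" using norm_minus_proj_factor[OF assms] by linarith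
  assume "q > 0"
  then have "(x + 1) * q\<^sup>2 / ((x + p + q + 1) * (x + p + 1)\<^sup>2) > 0" using assms by (intro divide_pos_pos mult_pos_pos zero_less_power) auto
  then show "proj_factor p q x < norm_factor p q x" using norm_minus_proj_factor[OF assms] by linarith
qed

text \<open>Either some value is taken infinitely often, or each value only finitely often.\<close>

lemma nat_seq_const_or_at_top:
  fixes t :: "nat \<Rightarrow> nat"
  shows "\<exists>r. strict_mono r \<and> ((\<exists>c. \<forall>j. t (r j) = c) \<or> filterlim (\<lambda>j. t (r j)) at_top sequentially)"
proof (cases "\<exists>c. infinite {j. t j = c}")
  case True
  then obtain c where c: "infinite {j. t j = c}" by blast
  have "strict_mono (enumerate {j. t j = c})" by (intro strict_monoI enumerate_mono c)
  moreover have "t (enumerate {j. t j = c} j) = c" for j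
    using enumerate_in_set[OF c, of j] by simp
  ultimately show ?thesis by blast
next
  case False
  have "filterlim t at_top sequentially"
    unfolding filterlim_at_top
  proof
    fix Z
    have "{j. \<not> Z \<le> t j} = (\<Union>c\<in>{..<Z}. {j. t j = c})" by auto
    then have "finite {j. \<not> Z \<le> t j}" using False by simp
    then show "\<forall>\<^sub>F j in sequentially. Z \<le> t j"
      by (simp add: eventually_cofinite flip: cofinite_eq_sequentially)
  qed
  then show ?thesis using strict_mono_id by (intro exI[of _ id]) auto
qed

text \<open>The compactness behind both the closure of the set of eigenvalues and the finiteness of multiplicities:
coordinate by coordinate, a subsequence is constant or tends to infinity.\<close>

lemma multiindex_subsequence:
  fixes s :: "nat \<Rightarrow> 'n::finite \<Rightarrow> nat"
  obtains r B \<alpha> where "strict_mono r" "\<And>k j. k \<in> B \<Longrightarrow> s (r j) k = \<alpha> k"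
    "\<And>k. k \<notin> B \<Longrightarrow> filterlim (\<lambda>j. s (r j) k) at_top sequentially"
proof -
  have "\<exists>r B \<alpha>. strict_mono r \<and> (\<forall>k\<in>K. if k \<in> B then \<forall>j. s (r j) k = \<alpha> k else filterlim (\<lambda>j. s (r j) k) at_top sequentially)"
    if "finite K" for K
    using that
  proof induction
    case empty
    then show ?case using strict_mono_id by blast
  next
    case (insert i K)
    then obtain r B \<alpha> where r: "strict_mono r"
      "\<And>k. k \<in> K \<Longrightarrow> if k \<in> B then \<forall>j. s (r j) k = \<alpha> k else filterlim (\<lambda>j. s (r j) k) at_top sequentially" by blast
    obtain r' where r': "strict_mono r'"
      "(\<exists>c. \<forall>j. s (r (r' j)) i = c) \<or> filterlim (\<lambda>j. s (r (r' j)) i) at_top sequentially"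
      using nat_seq_const_or_at_top[of "\<lambda>j. s (r j) i"] by blast
    have sm: "strict_mono (\<lambda>j. r (r' j))" using strict_mono_o[OF r(1) r'(1)] by (simp add: o_def)
    have old: "if k \<in> B then \<forall>j. s (r (r' j)) k = \<alpha> k else filterlim (\<lambda>j. s (r (r' j)) k) at_top sequentially"
      if "k \<in> K" for k
      using r(2)[OF that] filterlim_compose[OF _ filterlim_subseq[OF r'(1)], of "\<lambda>j. s (r j) k"] by auto
    from r'(2) show ?case
    proof
      assume "\<exists>c. \<forall>j. s (r (r' j)) i = c"
      then obtain c where "\<forall>j. s (r (r' j)) i = c" by blast
      then show ?thesis using sm old insert(2)
        by (intro exI[of _ "\<lambda>j. r (r' j)"] exI[of _ "insert i B"] exI[of _ "\<alpha>(i := c)"]) auto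
    next
      assume "filterlim (\<lambda>j. s (r (r' j)) i) at_top sequentially"
      then show ?thesis using sm old insert(2)
        by (intro exI[of _ "\<lambda>j. r (r' j)"] exI[of _ "B - {i}"] exI[of _ \<alpha>]) auto
    qed
  qed
  from this[of UNIV] obtain r B \<alpha> where
    "strict_mono r" "\<forall>k. if k \<in> B then \<forall>j. s (r j) k = \<alpha> k else filterlim (\<lambda>j. s (r j) k) at_top sequentially" by auto
  then show ?thesis by (intro that[of r B \<alpha>]) (metis, metis, metis)
qed

lemma prod_limit_partial:
  fixes F :: "'n::finite \<Rightarrow> real \<Rightarrow> real" and s :: "nat \<Rightarrow> 'n \<Rightarrow> nat"
  assumes const: "\<And>k j. k \<in> B \<Longrightarrow> s j k = \<alpha> k"
    and top: "\<And>k. k \<notin> B \<Longrightarrow> filterlim (\<lambda>j. s j k) at_top sequentially"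
    and F: "\<And>k. (F k \<longlongrightarrow> 1) at_top"
  shows "(\<lambda>j. \<Prod>k\<in>UNIV. F k (s j k)) \<longlonglongrightarrow> (\<Prod>k\<in>B. F k (\<alpha> k))"
proof -
  have "(\<lambda>j. F k (real (s j k))) \<longlonglongrightarrow> (if k \<in> B then F k (\<alpha> k) else 1)" for k
  proof (cases "k \<in> B")
    case False
    then show ?thesis
      using filterlim_compose[OF F filterlim_compose[OF filterlim_real_sequentially top[OF False]]] by simp
  qed (simp add: const)
  then have "(\<lambda>j. \<Prod>k\<in>UNIV. F k (s j k)) \<longlonglongrightarrow> (\<Prod>k\<in>UNIV. if k \<in> B then F k (\<alpha> k) else 1)"
    by (intro tendsto_prod) auto
  then show ?thesis by (simp add: prod.If_cases)
qed

lemma eventually_above_off: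
  fixes s :: "nat \<Rightarrow> 'n::finite \<Rightarrow> nat"
  assumes top: "\<And>k. k \<notin> B \<Longrightarrow> filterlim (\<lambda>j. s j k) at_top sequentially"
  shows "\<forall>\<^sub>F j in sequentially. \<forall>k. k \<notin> B \<longrightarrow> m k \<le> s j k"
proof -
  have "\<forall>\<^sub>F j in sequentially. \<forall>k\<in>- B. m k \<le> s j k"
    using top by (intro eventually_ball_finite ballI) (auto simp: filterlim_at_top)
  then show ?thesis by (rule eventually_mono) auto
qed

text \<open>Coordinates that tend to infinity contribute factors with limit \<open>1\<close> and eventually no longer affect the case
distinction, so only those in \<open>B\<close> survive. For empty \<open>B\<close> the limit is \<open>1 - 1 = 0\<close>.\<close>

lemma hankel_lambda_limit:
  fixes s :: "nat \<Rightarrow> 'n::finite \<Rightarrow> nat"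
  assumes const: "\<And>k j. k \<in> B \<Longrightarrow> s j k = \<alpha> k"
    and top: "\<And>k. k \<notin> B \<Longrightarrow> filterlim (\<lambda>j. s j k) at_top sequentially"
  shows "(\<lambda>j. hankel_lambda n m (s j) UNIV) \<longlonglongrightarrow> hankel_lambda n m \<alpha> B"
proof -
  have limA: "(\<lambda>j. \<Prod>k\<in>UNIV. norm_factor (n k) (m k) (s j k)) \<longlonglongrightarrow> (\<Prod>k\<in>B. norm_factor (n k) (m k) (\<alpha> k))"
    by (rule prod_limit_partial[OF const top norm_factor_limit])
  have limB: "(\<lambda>j. \<Prod>k\<in>UNIV. proj_factor (n k) (m k) (s j k)) \<longlonglongrightarrow> (\<Prod>k\<in>B. proj_factor (n k) (m k) (\<alpha> k))"
    by (rule prod_limit_partial[OF const top proj_factor_limit])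
  have cond: "\<forall>\<^sub>F j in sequentially. (\<exists>k\<in>UNIV. int (s j k) < int (m k) - int (n k)) \<longleftrightarrow> (\<exists>k\<in>B. int (\<alpha> k) < int (m k) - int (n k))"
  proof (rule eventually_mono)
    show "\<forall>\<^sub>F j in sequentially. \<forall>k. k \<notin> B \<longrightarrow> m k \<le> s j k" by (rule eventually_above_off[OF top])
    fix j assume elim: "\<forall>k. k \<notin> B \<longrightarrow> m k \<le> s j k"
    have inB: "k \<in> B" if "int (s j k) < int (m k) - int (n k)" for k
      using elim[rule_format, of k] that by (cases "k \<in> B") auto
    show "(\<exists>k\<in>UNIV. int (s j k) < int (m k) - int (n k)) \<longleftrightarrow> (\<exists>k\<in>B. int (\<alpha> k) < int (m k) - int (n k))"
    proof
      assume "\<exists>k\<in>UNIV. int (s j k) < int (m k) - int (n k)"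
      then obtain k where k: "int (s j k) < int (m k) - int (n k)" by blast
      show "\<exists>k\<in>B. int (\<alpha> k) < int (m k) - int (n k)"
        using k inB[OF k] const[OF inB[OF k], of j] by (intro bexI[of _ k]) simp_all
    next
      assume "\<exists>k\<in>B. int (\<alpha> k) < int (m k) - int (n k)"
      then obtain k where k: "k \<in> B" "int (\<alpha> k) < int (m k) - int (n k)" by blast
      show "\<exists>k\<in>UNIV. int (s j k) < int (m k) - int (n k)"
        using k const[OF k(1), of j] by (intro bexI[of _ k]) simp_all
    qed
  qed
  show ?thesis
  proof (cases "\<exists>k\<in>B. int (\<alpha> k) < int (m k) - int (n k)")
    case True
    have "\<forall>\<^sub>F j in sequentially. (\<Prod>k\<in>UNIV. norm_factor (n k) (m k) (s j k)) = hankel_lambda n m (s j) UNIV"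
      using cond by eventually_elim (use True in \<open>simp add: hankel_lambda_factors\<close>)
    from Lim_transform_eventually[OF limA this] show ?thesis
      using True by (simp add: hankel_lambda_factors)
  next
    case False
    have "\<forall>\<^sub>F j in sequentially. (\<Prod>k\<in>UNIV. norm_factor (n k) (m k) (s j k)) - (\<Prod>k\<in>UNIV. proj_factor (n k) (m k) (s j k)) =
        hankel_lambda n m (s j) UNIV"
      using cond by eventually_elim (use False in \<open>simp add: hankel_lambda_factors\<close>)
    from Lim_transform_eventually[OF tendsto_diff[OF limA limB] this] show ?thesis
      using False by (simp add: hankel_lambda_factors)
  qed
qed

text \<open>With the empty set admitted for \<open>B\<close>, which accounts for \<open>0\<close>, the right-hand side is the set of all limits
along sequences of multi-indices, because every such sequence has a subsequence to which the limit
formula applies.\<close>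

lemma closure_hankel_lambda:
  "closure (range (\<lambda>a. complex_of_real (hankel_lambda n m a UNIV))) =
     {0} \<union> {complex_of_real (hankel_lambda n m \<alpha> B) |\<alpha> (B :: 'n::finite set). B \<noteq> {}}"
proof -
  have "{0} \<union> {complex_of_real (hankel_lambda n m \<alpha> B) |\<alpha> (B :: 'n set). B \<noteq> {}} =
      {complex_of_real (hankel_lambda n m \<alpha> B) |\<alpha> B. True}" (is "?L = ?R")
  proof
    have e: "hankel_lambda n m \<alpha> {} = 0" for \<alpha> by (simp add: hankel_lambda_def)
    have "0 = complex_of_real (hankel_lambda n m (\<lambda>_. 0) {})" by (simp add: e)
    then have "0 \<in> ?R" by blast
    then show "?L \<subseteq> ?R" by blast
    show "?R \<subseteq> ?L"
    proof
      fix z assume "z \<in> ?R"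
      then obtain \<alpha> and B :: "'n set" where z: "z = complex_of_real (hankel_lambda n m \<alpha> B)" by blast
      show "z \<in> ?L"
      proof (cases "B = {}")
        case True
        then show ?thesis by (simp add: z e)
      qed (use z in blast)
    qed
  qed
  also have "\<dots> = closure (range (\<lambda>a. complex_of_real (hankel_lambda n m a UNIV)))"
  proof (intro set_eqI iffI)
    fix z assume "z \<in> {complex_of_real (hankel_lambda n m \<alpha> B) |\<alpha> B. True}"
    then obtain \<alpha> B where z: "z = of_real (hankel_lambda n m \<alpha> B)" by blast
    \<comment> \<open>Let the coordinates outside \<open>B\<close> tend to infinity.\<close>
    define s where "s = (\<lambda>j k. if k \<in> B then \<alpha> k else j :: nat)"
    have "(\<lambda>j. hankel_lambda n m (s j) UNIV) \<longlonglongrightarrow> hankel_lambda n m \<alpha> B"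
      by (rule hankel_lambda_limit) (auto simp: s_def filterlim_ident)
    then have "(\<lambda>j. complex_of_real (hankel_lambda n m (s j) UNIV)) \<longlonglongrightarrow> z"
      unfolding z by (intro tendsto_of_real)
    then show "z \<in> closure (range (\<lambda>a. complex_of_real (hankel_lambda n m a UNIV)))"
      unfolding closure_sequential by (intro exI[of _ "\<lambda>j. complex_of_real (hankel_lambda n m (s j) UNIV)"]) auto
  next
    fix z assume "z \<in> closure (range (\<lambda>a. complex_of_real (hankel_lambda n m a UNIV)))"
    then obtain x where x: "\<And>j. x j \<in> range (\<lambda>a. complex_of_real (hankel_lambda n m a UNIV))" "x \<longlonglongrightarrow> z"
      unfolding closure_sequential by blast
    have "\<exists>a. x j = of_real (hankel_lambda n m a UNIV)" for j using x(1)[of j] by auto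
    then obtain s where s: "\<And>j. x j = of_real (hankel_lambda n m (s j) UNIV)" by metis
    obtain r B \<alpha> where r: "strict_mono r" "\<And>k j. k \<in> B \<Longrightarrow> s (r j) k = \<alpha> k"
      "\<And>k. k \<notin> B \<Longrightarrow> filterlim (\<lambda>j. s (r j) k) at_top sequentially"
      by (rule multiindex_subsequence[of s]) blast
    have "(\<lambda>j. hankel_lambda n m (s (r j)) UNIV) \<longlonglongrightarrow> hankel_lambda n m \<alpha> B"
      by (rule hankel_lambda_limit[OF r(2,3)])
    then have "(\<lambda>j. x (r j)) \<longlonglongrightarrow> of_real (hankel_lambda n m \<alpha> B)"
      unfolding s by (intro tendsto_of_real)
    moreover have "(\<lambda>j. x (r j)) \<longlonglongrightarrow> z" using LIMSEQ_subseq_LIMSEQ[OF x(2) r(1)] by (simp add: o_def)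
    ultimately have "z = of_real (hankel_lambda n m \<alpha> B)" by (rule LIMSEQ_unique[symmetric])
    then show "z \<in> {complex_of_real (hankel_lambda n m \<alpha> B) |\<alpha> B. True}" by blast
  qed
  finally show ?thesis ..
qed

lemma prod_strict_mono_real:
  fixes a b :: "'k \<Rightarrow> real"
  assumes S: "finite S" "\<And>k. k \<in> S \<Longrightarrow> 0 \<le> b k \<and> b k \<le> a k" "\<And>k. k \<in> S \<Longrightarrow> 0 < a k"
    and k0: "k0 \<in> S" "b k0 < a k0"
  shows "prod b S < prod a S"
proof -
  have "prod b S = b k0 * prod b (S - {k0})" using S k0 by (simp add: prod.remove)
  also have "\<dots> \<le> b k0 * prod a (S - {k0})" using S k0 by (intro mult_left_mono prod_mono) auto
  also have "\<dots> < a k0 * prod a (S - {k0})" using S k0 by (intro mult_strict_right_mono prod_pos) auto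
  also have "\<dots> = prod a S" using S k0 by (simp add: prod.remove)
  finally show ?thesis .
qed

text \<open>Both factors are \<open>1 - (p + q) / x\<close> up to terms of second order, and their difference is of second order in
\<open>1 / x\<close>. This quotient measures how closely they agree compared with their distance from \<open>1\<close>.\<close>

lemma factor_quotient:
  assumes "x \<ge> 0" "p \<ge> 0" "q \<ge> 0" "p + q > 0"
  shows "(norm_factor p q x - proj_factor p q x) / (1 - norm_factor p q x) = (x + 1) * (q\<^sup>2 / (p + q)) / (x + p + 1)\<^sup>2"
proof -
  have "1 - norm_factor p q x = (p + q) / (x + p + q + 1)"
    using assms by (simp add: norm_factor_def divide_simps)
  moreover have "A * c / (t * w) / (S / t) = A * (c / S) / w" if "t \<noteq> 0" for A c t w S :: real
    using that by (simp add: divide_simps)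
  ultimately show ?thesis
    unfolding norm_minus_proj_factor[OF assms(1-3)] using assms by simp
qed

lemma factor_quotient_limit: "((\<lambda>x::real. (x + 1) * c / (x + p + 1)\<^sup>2) \<longlongrightarrow> 0) at_top"
  by real_asymp

text \<open>Infinitely many indices in a fibre give a subsequence with a nonempty set of coordinates that tend to
infinity, the complement of \<open>B\<close>. Write \<open>aB\<close>, \<open>bB\<close> for the products of both kinds of factors over
\<open>B\<close>, and \<open>aC\<close>, \<open>bC\<close> for those over its complement. In the first case of the definition the value is
\<open>aB * aC\<close>, and it equals its limit \<open>aB\<close>; but \<open>aC < 1\<close>, as \<open>n k + m k \<ge> 1\<close> makes each factor less than
\<open>1\<close>. In the second case \<open>aB * aC - bB * bC = aB - bB\<close>, that is \<open>aB * (1 - aC) = bB * (1 - bC)\<close>. Since \<open>aC\<close> and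
\<open>bC\<close> are much closer to each other than to \<open>1\<close>, the quotient of \<open>1 - aC\<close> and \<open>1 - bC\<close> tends to
\<open>1\<close>. So \<open>aB = bB\<close>, hence also \<open>aC = bC\<close>. But the two kinds of factors differ strictly at a
coordinate \<open>k0\<close> with \<open>m k0 \<ge> 1\<close>, which lies in \<open>B\<close> or in its complement.\<close>

theorem finite_hankel_lambda_fibre:
  fixes n m :: "'n::finite \<Rightarrow> nat"
  assumes nm: "\<And>k. n k + m k \<ge> 1" and m: "m k0 \<ge> 1"
  shows "finite {a. hankel_lambda n m a UNIV = \<mu>}"
proof (rule ccontr)
  assume "infinite {a. hankel_lambda n m a UNIV = \<mu>}"
  then obtain s :: "nat \<Rightarrow> 'n \<Rightarrow> nat" where s: "inj s" "range s \<subseteq> {a. hankel_lambda n m a UNIV = \<mu>}"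
    using infinite_countable_subset by blast
  obtain r B \<alpha> where r: "strict_mono r" "\<And>k j. k \<in> B \<Longrightarrow> s (r j) k = \<alpha> k"
    "\<And>k. k \<notin> B \<Longrightarrow> filterlim (\<lambda>j. s (r j) k) at_top sequentially"
    by (rule multiindex_subsequence[of s]) blast
  define u where "u = (\<lambda>j. s (r j))"
  have u\<mu>: "hankel_lambda n m (u j) UNIV = \<mu>" for j using s(2) by (auto simp: u_def)
  have ne: "- B \<noteq> {}"
  proof
    assume "- B = {}"
    then have "B = UNIV" by auto
    then have "u 0 = u 1" using r(2) by (auto simp: u_def fun_eq_iff)
    then show False using s(1) r(1) by (auto simp: u_def inj_eq strict_mono_eq)
  qed
  let ?A = "\<lambda>k x. norm_factor (real (n k)) (real (m k)) (real x)"
  let ?P = "\<lambda>k x. proj_factor (real (n k)) (real (m k)) (real x)"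
  have pos: "real (n k) + real (m k) > 0" for k
    using nm[of k] by linarith
  have A: "0 < ?A k x" "?A k x < 1" "?P k x \<le> ?A k x" for k x
    using factor_bounds[of "real x" "real (n k)" "real (m k)"] pos[of k] by auto
  have Pnn: "0 \<le> ?P k x" if "\<not> int x < int (m k) - int (n k)" for k x
    using that by (intro factor_bounds) linarith+
  have PA: "?P k0 x < ?A k0 x" for x using m by (intro factor_bounds) auto
  define aB where "aB = (\<Prod>k\<in>B. ?A k (\<alpha> k))"
  define aC where "aC = (\<lambda>j. \<Prod>k\<in>-B. ?A k (u j k))"
  have aB: "aB > 0" unfolding aB_def by (intro prod_pos A)
  have aC1: "aC j < 1" for j
  proof -
    obtain k1 where "k1 \<in> - B" using ne by blast
    then have "prod (\<lambda>k. ?A k (u j k)) (- B) < prod (\<lambda>k. 1) (- B)"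
      by (intro prod_strict_mono_real[where ?k0.0 = k1] conjI less_imp_le[OF A(1)] less_imp_le[OF A(2)] A(2)) simp_all
    then show ?thesis by (simp add: aC_def)
  qed
  have split: "(\<Prod>k\<in>UNIV. F k (u j k)) = (\<Prod>k\<in>B. F k (\<alpha> k)) * (\<Prod>k\<in>-B. F k (u j k))" for F :: "'n \<Rightarrow> nat \<Rightarrow> real" and j
  proof -
    have "(\<Prod>k\<in>B. F k (u j k)) = (\<Prod>k\<in>B. F k (\<alpha> k))" using r(2) by (intro prod.cong) (auto simp: u_def)
    then show ?thesis using prod.union_disjoint[of B "- B" "\<lambda>k. F k (u j k)"] by (simp add: Compl_partition)
  qed
  have "(\<lambda>j. hankel_lambda n m (u j) UNIV) \<longlonglongrightarrow> hankel_lambda n m \<alpha> B"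
    unfolding u_def by (rule hankel_lambda_limit[OF r(2,3)])
  then have lim: "\<mu> = hankel_lambda n m \<alpha> B" by (simp add: u\<mu> LIMSEQ_const_iff)
  show False
  proof (cases "\<exists>k\<in>B. int (\<alpha> k) < int (m k) - int (n k)")
    case True
    then obtain k where "k \<in> B" "int (\<alpha> k) < int (m k) - int (n k)" by blast
    then have "\<exists>k\<in>UNIV. int (u 0 k) < int (m k) - int (n k)"
      using r(2) by (intro bexI[of _ k]) (auto simp: u_def)
    then have "\<mu> = aB * aC 0"
      using u\<mu>[of 0] by (simp add: hankel_lambda_factors split[of ?A] aB_def aC_def)
    moreover have "\<mu> = aB" using lim True by (simp add: hankel_lambda_factors aB_def)
    ultimately show False using aB aC1[of 0] by simp
  next
    case False
    define bB where "bB = (\<Prod>k\<in>B. ?P k (\<alpha> k))"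
    define bC where "bC = (\<lambda>j. \<Prod>k\<in>-B. ?P k (u j k))"
    have bB: "0 \<le> bB" unfolding bB_def using False by (intro prod_nonneg Pnn) auto
    have \<mu>B: "\<mu> = aB - bB" using lim False by (simp add: hankel_lambda_factors aB_def bB_def)
    have ev: "\<forall>\<^sub>F j in sequentially. \<forall>k. k \<notin> B \<longrightarrow> m k \<le> u j k"
      unfolding u_def by (rule eventually_above_off[OF r(3)])
    have eq: "aB * (1 - aC j) = bB * (1 - bC j)" if j: "\<forall>k. k \<notin> B \<longrightarrow> m k \<le> u j k" for j
    proof -
      have "\<not> int (u j k) < int (m k) - int (n k)" for k
      proof (cases "k \<in> B")
        case True
        then show ?thesis using False r(2)[OF True] by (simp add: u_def)
      next
        case False
        then have "m k \<le> u j k" using j by blast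
        then show ?thesis by linarith
      qed
      then have "\<mu> = aB * aC j - bB * bC j"
        using u\<mu>[of j] by (simp add: hankel_lambda_factors split[of ?A] split[of ?P] aB_def aC_def bB_def bC_def)
      then show ?thesis using \<mu>B by (simp add: algebra_simps)
    qed
    have PC: "0 \<le> ?P k (u j k)" if "\<forall>k. k \<notin> B \<longrightarrow> m k \<le> u j k" "k \<notin> B" for j k
    proof (rule Pnn)
      have "m k \<le> u j k" using that by blast
      then show "\<not> int (u j k) < int (m k) - int (n k)" by linarith
    qed
    let ?q = "\<lambda>k x. (x + 1) * ((real (m k))\<^sup>2 / (real (n k) + real (m k))) / (x + real (n k) + 1)\<^sup>2"
    have le: "aB - bB \<le> bB * (\<Sum>k\<in>-B. ?q k (real (u j k)))" if j: "\<forall>k. k \<notin> B \<longrightarrow> m k \<le> u j k" for j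
    proof -
      have d: "1 - aC j > 0" using aC1 by simp
      have "norm (aC j - bC j) \<le> (\<Sum>k\<in>-B. norm (?A k (u j k) - ?P k (u j k)))"
        unfolding aC_def bC_def
      proof (rule norm_prod_diff)
        fix k assume k: "k \<in> - B"
        show "norm (?A k (u j k)) \<le> 1" using A(1,2)[of k "u j k"] by simp
        show "norm (?P k (u j k)) \<le> 1" using PC[OF j, of k] A(2,3)[of k "u j k"] k by simp
      qed
      also have "\<dots> = (\<Sum>k\<in>-B. ?A k (u j k) - ?P k (u j k))"
        using A by (intro sum.cong) auto
      finally have "(aC j - bC j) / (1 - aC j) \<le> (\<Sum>k\<in>-B. ?A k (u j k) - ?P k (u j k)) / (1 - aC j)"
        using d by (intro divide_right_mono) auto
      also have "\<dots> = (\<Sum>k\<in>-B. (?A k (u j k) - ?P k (u j k)) / (1 - aC j))" by (rule sum_divide_distrib)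
      also have "\<dots> \<le> (\<Sum>k\<in>-B. (?A k (u j k) - ?P k (u j k)) / (1 - ?A k (u j k)))"
      proof (rule sum_mono)
        fix k assume k: "k \<in> - B"
        have "aC j = ?A k (u j k) * (\<Prod>k\<in>-B - {k}. ?A k (u j k))"
          unfolding aC_def using k by (intro prod.remove) auto
        also have "\<dots> \<le> ?A k (u j k) * 1"
          by (intro mult_left_mono prod_le_1 conjI less_imp_le[OF A(1)] less_imp_le[OF A(2)])
        finally show "(?A k (u j k) - ?P k (u j k)) / (1 - aC j) \<le> (?A k (u j k) - ?P k (u j k)) / (1 - ?A k (u j k))"
          using A(2,3)[of k "u j k"] d by (intro divide_left_mono mult_pos_pos) simp_all
      qed
      also have "\<dots> = (\<Sum>k\<in>-B. ?q k (real (u j k)))"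
        using pos by (intro sum.cong refl factor_quotient) auto
      finally have *: "(aC j - bC j) / (1 - aC j) \<le> (\<Sum>k\<in>-B. ?q k (real (u j k)))" .
      have "(aB - bB) * (1 - aC j) = bB * (aC j - bC j)" using eq[OF j] by (simp add: algebra_simps)
      then have "aB - bB = bB * ((aC j - bC j) / (1 - aC j))" using d by (simp add: eq_divide_eq)
      also have "\<dots> \<le> bB * (\<Sum>k\<in>-B. ?q k (real (u j k)))" by (rule mult_left_mono[OF * bB])
      finally show ?thesis .
    qed
    have "(\<lambda>j. bB * (\<Sum>k\<in>-B. ?q k (real (u j k)))) \<longlonglongrightarrow> bB * (\<Sum>k\<in>-B. 0)"
    proof (intro tendsto_mult_left tendsto_sum)
      fix k assume "k \<in> - B"
      then have "filterlim (\<lambda>j. u j k) at_top sequentially" using r(3) by (simp add: u_def)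
      then show "(\<lambda>j. ?q k (real (u j k))) \<longlonglongrightarrow> 0"
        by (intro filterlim_compose[OF factor_quotient_limit] filterlim_compose[OF filterlim_real_sequentially])
    qed
    then have "(\<lambda>j. bB * (\<Sum>k\<in>-B. ?q k (real (u j k)))) \<longlonglongrightarrow> 0" by simp
    moreover have "\<forall>\<^sub>F j in sequentially. aB - bB \<le> bB * (\<Sum>k\<in>-B. ?q k (real (u j k)))"
      using ev by (rule eventually_mono) (rule le)
    ultimately have "aB - bB \<le> 0"
      by (rule tendsto_lowerbound) (rule sequentially_bot)
    moreover have PB: "0 \<le> ?P k (\<alpha> k) \<and> ?P k (\<alpha> k) \<le> ?A k (\<alpha> k)" if "k \<in> B" for k
      using False that by (intro conjI Pnn A(3)) blast
    then have "bB \<le> aB" unfolding aB_def bB_def by (rule prod_mono)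
    ultimately have ab: "bB = aB" by simp
    have k0: "k0 \<notin> B"
    proof
      assume "k0 \<in> B"
      then have "bB < aB" unfolding aB_def bB_def
        by (intro prod_strict_mono_real[where ?k0.0 = k0] PB PA A(1) finite)
      then show False using ab by simp
    qed
    obtain j where j: "\<forall>k. k \<notin> B \<longrightarrow> m k \<le> u j k"
      using eventually_happens[OF ev] by auto
    have "aC j = bC j" using eq[OF j] aB ab by simp
    moreover have "bC j < aC j" unfolding aC_def bC_def
      by (rule prod_strict_mono_real[where ?k0.0 = k0]) (use PC[OF j] A(1,3) PA k0 in simp_all)
    ultimately show False by simp
  qed
qed

text \<open>The coordinate \<open>k\<close> contributes the factor \<open>1\<close> to both products and never affects the case distinction, so
it can be changed at will.\<close>

theorem infinite_hankel_lambda_fibre: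
  fixes n m :: "'n::finite \<Rightarrow> nat"
  assumes k: "n k + m k = 0"
  shows "infinite {a. hankel_lambda n m a UNIV = hankel_lambda n m a0 UNIV}"
proof -
  have z: "n k = 0" "m k = 0" using k by auto
  have eq: "hankel_lambda n m (a0(k := x)) UNIV = hankel_lambda n m a0 UNIV" for x
  proof -
    have F: "(\<Prod>i\<in>UNIV. F i ((a0(k := x)) i)) = (\<Prod>i\<in>UNIV. F i (a0 i))" if "\<And>x y. F k x = F k y" for F :: "'n \<Rightarrow> nat \<Rightarrow> real"
      using that by (intro prod.cong refl) auto
    have c: "(\<exists>i\<in>UNIV. int ((a0(k := x)) i) < int (m i) - int (n i)) \<longleftrightarrow> (\<exists>i\<in>UNIV. int (a0 i) < int (m i) - int (n i))"
      using z by (intro bex_cong refl) auto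
    have "norm_factor (n k) (m k) y = 1" "proj_factor (n k) (m k) y = 1" if "y \<ge> 0" for y
      using that z by (auto simp: norm_factor_def proj_factor_def power2_eq_square)
    then show ?thesis
      unfolding hankel_lambda_factors c
      using F[of "\<lambda>i x. norm_factor (n i) (m i) (real x)"] F[of "\<lambda>i x. proj_factor (n i) (m i) (real x)"] by simp
  qed
  have "inj (\<lambda>x. a0(k := x))" by (auto simp: inj_def fun_eq_iff)
  then have "infinite (range (\<lambda>x. a0(k := x)))" by (rule range_inj_infinite)
  moreover have "range (\<lambda>x. a0(k := x)) \<subseteq> {a. hankel_lambda n m a UNIV = hankel_lambda n m a0 UNIV}"
    using eq by auto
  ultimately show ?thesis using infinite_super by blast
qed

section \<open>Spectrum and multiplicities\<close>

theorem theorem3: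
  fixes n m :: "'n::finite \<Rightarrow> nat"
  shows "spectrum_on bergman (hankel_square (monomial_symbol n m)) =
           {0} \<union> {complex_of_real (hankel_lambda n m \<alpha> B) |\<alpha> B. B \<noteq> {}} \<and>
         ((\<forall>k. n k + m k \<ge> 1) \<and> (\<exists>k. m k \<ge> 1) \<longrightarrow>
           (\<forall>\<mu>\<in>eigenvalues_on bergman (hankel_square (monomial_symbol n m)).
              finite_dimensional
                (eigenspace_on bergman (hankel_square (monomial_symbol n m)) \<mu>))) \<and>
         ((\<exists>k. n k + m k = 0) \<longrightarrow>
           (\<forall>\<mu>\<in>eigenvalues_on bergman (hankel_square (monomial_symbol n m)).
              \<not> finite_dimensional
                (eigenspace_on bergman (hankel_square (monomial_symbol n m)) \<mu>)))"
proof -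
  let ?T = "hankel_square (monomial_symbol n m)"
  let ?d = "\<lambda>a. complex_of_real (hankel_lambda n m a UNIV)"
  have T: "diagonal_operator ?T ?d"
    unfolding diagonal_operator_def by (simp add: hankel_square_bergman coef_hankel_square)
  show ?thesis
  proof (intro conjI impI ballI)
    show "spectrum_on bergman ?T = {0} \<union> {complex_of_real (hankel_lambda n m \<alpha> B) |\<alpha> B. B \<noteq> {}}"
      by (simp only: spectrum_diagonal_operator[OF T] closure_hankel_lambda)
  next
    fix \<mu> assume nm: "(\<forall>k. n k + m k \<ge> 1) \<and> (\<exists>k. m k \<ge> 1)" and \<mu>: "\<mu> \<in> eigenvalues_on bergman ?T"
    obtain a0 where a0: "?d a0 = \<mu>" using eigenvalue_diagonal_operator[OF T \<mu>] by blast
    have "finite {a. hankel_lambda n m a UNIV = hankel_lambda n m a0 UNIV}"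
    proof -
      obtain k0 where "m k0 \<ge> 1" using nm by blast
      then show ?thesis using nm by (intro finite_hankel_lambda_fibre[where ?k0.0 = k0]) simp_all
    qed
    then have "finite {a. ?d a = \<mu>}" unfolding a0[symmetric] of_real_eq_iff .
    then show "finite_dimensional (eigenspace_on bergman ?T \<mu>)" by (rule finite_dimensional_eigenspace[OF T])
  next
    fix \<mu> assume nm: "\<exists>k. n k + m k = 0" and \<mu>: "\<mu> \<in> eigenvalues_on bergman ?T"
    obtain a0 where a0: "?d a0 = \<mu>" using eigenvalue_diagonal_operator[OF T \<mu>] by blast
    have "infinite {a. hankel_lambda n m a UNIV = hankel_lambda n m a0 UNIV}"
    proof -
      obtain k where "n k + m k = 0" using nm by (rule exE)
      then show ?thesis by (rule infinite_hankel_lambda_fibre)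
    qed
    then have "infinite {a. ?d a = \<mu>}" unfolding a0[symmetric] of_real_eq_iff .
    then show "\<not> finite_dimensional (eigenspace_on bergman ?T \<mu>)" by (rule infinite_dimensional_eigenspace[OF T])
  qed
qed

end
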